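(* Let $(V,\omega)$ be a $2n$-dimensional real symplectic space, $L,L_0\in\Lambda(V,\omega)$, $\psi:[0,T]\to\mathrm{Sp}(V,\omega)$ continuous with $\psi(0)=\mathrm{Id}$, $P=\psi(T)$ and $\ell(t)=\psi(t)L$. Let $\epsilon=\mathrm{Gr}(P)\cap\Delta+\Delta\cap(L\oplus L_0)\subset V\oplus V$. Then $$\Big|\iota^{\mathrm{CLM}}\big(L_0,\ell(t);t\in[0,T]\big)-\iota^{\mathrm{CZ}}\big(\psi(t);t\in[0,T]\big)\Big|\le 2n-\dim\epsilon.$$
   Context: For a real symplectic space $(W,\Omega)$ of dimension $2m$ with Lagrangian Grassmannian $\Lambda(W,\Omega)$, $L_0\in\Lambda(W,\Omega)$ and a continuous path $\ell:[a,b]\to\Lambda(W,\Omega)$, $\iota^{\mathrm{CLM}}(L_0,\ell(t);t\in[a,b])\in\mathbb Z$ denotes the Cappell–Lee–Miller Maslov index: the intersection index of $\ell$ with the Maslov cycle $\Sigma(L_0)=\{L: L\cap L_0\neq\{0\}\}$; it is invariant under fixed-endpoint homotopies, additive under concatenation, and for $\mathscr C^1$ paths with only regular crossings equals $n_+(\Gamma(\ell,L_0,a))+\sum_{a<t<b}\operatorname{sgn}\Gamma(\ell,L_0,t)-n_-(\Gamma(\ell,L_0,b))$, where a crossing is $t_0$ with $\ell(t_0)\cap L_0\ne\{0\}$, the crossing form on $\ell(t_0)\cap L_0$ is $\Gamma(\ell,L_0,t_0)[v]=\frac{d}{dt}|_{t=t_0}\Omega(v,w(t))$ with $w(t)$ the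 unique vector in a fixed Lagrangian $U$ transversal to $\ell(t_0)$ such that $v+w(t)\in\ell(t)$, and regular means nondegenerate. The space $V\oplus V$ carries the symplectic form $(-\omega)\oplus\omega$, i.e. $((v_1,v_2),(w_1,w_2))\mapsto-\omega(v_1,w_1)+\omega(v_2,w_2)$; $\Delta=\{(v,v):v\in V\}$ is the diagonal and $\mathrm{Gr}(A)=\{(v,Av):v\in V\}$ the graph of $A$; for $A$ symplectic these are Lagrangian in $V\oplus V$. The generalized Conley–Zehnder index of a continuous path $\psi$ in $\mathrm{Sp}(V,\omega)$ is $\iota^{\mathrm{CZ}}(\psi(t);t\in[a,b])=\iota^{\mathrm{CLM}}(\Delta,\mathrm{Gr}\,\psi(t);t\in[a,b])$. *)

theory Defs
  imports "HOL-Analysis.Analysis"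
begin

definition symplectic_form :: "('b::euclidean_space \<Rightarrow> 'b \<Rightarrow> real) \<Rightarrow> bool" where
  "symplectic_form \<Omega> \<longleftrightarrow>
     (\<forall>u. linear (\<Omega> u)) \<and> (\<forall>v. linear (\<lambda>u. \<Omega> u v)) \<and>
     (\<forall>u v. \<Omega> u v = - \<Omega> v u) \<and>
     (\<forall>u. (\<forall>v. \<Omega> u v = 0) \<longrightarrow> u = 0)"

definition lagrangian :: "('b::euclidean_space \<Rightarrow> 'b \<Rightarrow> real) \<Rightarrow> 'b set \<Rightarrow> bool" where
  "lagrangian \<Omega> L \<longleftrightarrow> subspace L \<and> (\<forall>u\<in>L. \<forall>v\<in>L. \<Omega> u v = 0) \<and> 2 * dim L = DIM('b)"

definition symplectic_map :: "('b::euclidean_space \<Rightarrow> 'b \<Rightarrow> real) \<Rightarrow> ('b \<Rightarrow> 'b) \<Rightarrow> bool" where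
  "symplectic_map \<Omega> A \<longleftrightarrow> linear A \<and> bij A \<and> (\<forall>u v. \<Omega> (A u) (A v) = \<Omega> u v)"

definition sum_form :: "('a::euclidean_space \<Rightarrow> 'a \<Rightarrow> real) \<Rightarrow> ('a \<times> 'a) \<Rightarrow> ('a \<times> 'a) \<Rightarrow> real" where
  "sum_form \<omega> p q = - \<omega> (fst p) (fst q) + \<omega> (snd p) (snd q)"

definition diagonal :: "('a \<times> 'a) set" where
  "diagonal = {(v, v) | v. True}"

definition graph :: "('a \<Rightarrow> 'a) \<Rightarrow> ('a \<times> 'a) set" where
  "graph A = {(v, A v) | v. True}"

definition set_sum :: "'b::real_vector set \<Rightarrow> 'b set \<Rightarrow> 'b set" where
  "set_sum A B = {x + y | x y. x \<in> A \<and> y \<in> B}"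

text \<open>Orthogonal projection onto a subspace (w.r.t. the auxiliary Euclidean inner product);
the topology/smooth structure of the Grassmannian is that induced by these projections
(it does not depend on the chosen inner product).\<close>
definition proj :: "'b::euclidean_space set \<Rightarrow> 'b \<Rightarrow> 'b" where
  "proj L x = (THE y. y \<in> L \<and> (\<forall>z\<in>L. inner (x - y) z = 0))"

definition lagr_path :: "('b::euclidean_space \<Rightarrow> 'b \<Rightarrow> real) \<Rightarrow> real \<Rightarrow> real \<Rightarrow> (real \<Rightarrow> 'b set) \<Rightarrow> bool" where
  "lagr_path \<Omega> a b l \<longleftrightarrow> (\<forall>t\<in>{a..b}. lagrangian \<Omega> (l t)) \<and>
     (\<forall>x. continuous_on {a..b} (\<lambda>t. proj (l t) x))"

definition C1_lagr_path :: "('b::euclidean_space \<Rightarrow> 'b \<Rightarrow> real) \<Rightarrow> real \<Rightarrow> real \<Rightarrow> (real \<Rightarrow> 'b set) \<Rightarrow> bool" where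
  "C1_lagr_path \<Omega> a b l \<longleftrightarrow> lagr_path \<Omega> a b l \<and>
     (\<forall>x. \<exists>D. continuous_on {a..b} D \<and>
        (\<forall>t\<in>{a..b}. ((\<lambda>s. proj (l s) x) has_vector_derivative D t) (at t within {a..b})))"

definition fe_homotopic :: "('b::euclidean_space \<Rightarrow> 'b \<Rightarrow> real) \<Rightarrow> real \<Rightarrow> real \<Rightarrow> (real \<Rightarrow> 'b set) \<Rightarrow> (real \<Rightarrow> 'b set) \<Rightarrow> bool" where
  "fe_homotopic \<Omega> a b l l' \<longleftrightarrow> (\<exists>H :: real \<Rightarrow> real \<Rightarrow> 'b set.
     (\<forall>s\<in>{0..1}. \<forall>t\<in>{a..b}. lagrangian \<Omega> (H s t)) \<and>
     (\<forall>x. continuous_on ({0..1} \<times> {a..b}) (\<lambda>(s, t). proj (H s t) x)) \<and>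
     (\<forall>t\<in>{a..b}. H 0 t = l t \<and> H 1 t = l' t) \<and>
     (\<forall>s\<in>{0..1}. H s a = l a \<and> H s b = l b))"

definition polar :: "('b::real_vector \<Rightarrow> real) \<Rightarrow> 'b \<Rightarrow> 'b \<Rightarrow> real" where
  "polar q u v = (q (u + v) - q u - q v) / 2"

definition n_plus :: "('b::euclidean_space \<Rightarrow> real) \<Rightarrow> 'b set \<Rightarrow> nat" where
  "n_plus q W = Max {dim S | S. subspace S \<and> S \<subseteq> W \<and> (\<forall>v\<in>S. v \<noteq> 0 \<longrightarrow> q v > 0)}"

definition n_minus :: "('b::euclidean_space \<Rightarrow> real) \<Rightarrow> 'b set \<Rightarrow> nat" where
  "n_minus q W = Max {dim S | S. subspace S \<and> S \<subseteq> W \<and> (\<forall>v\<in>S. v \<noteq> 0 \<longrightarrow> q v < 0)}"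

definition signature :: "('b::euclidean_space \<Rightarrow> real) \<Rightarrow> 'b set \<Rightarrow> int" where
  "signature q W = int (n_plus q W) - int (n_minus q W)"

definition nondegenerate_on :: "('b::euclidean_space \<Rightarrow> real) \<Rightarrow> 'b set \<Rightarrow> bool" where
  "nondegenerate_on q W \<longleftrightarrow> (\<forall>v\<in>W. v \<noteq> 0 \<longrightarrow> (\<exists>u\<in>W. polar q v u \<noteq> 0))"

definition crossing :: "'b::euclidean_space set \<Rightarrow> (real \<Rightarrow> 'b set) \<Rightarrow> real \<Rightarrow> bool" where
  "crossing L0 l t \<longleftrightarrow> l t \<inter> L0 \<noteq> {0}"

definition transversal_lagr :: "('b::euclidean_space \<Rightarrow> 'b \<Rightarrow> real) \<Rightarrow> 'b set \<Rightarrow> 'b set" where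
  "transversal_lagr \<Omega> L = (SOME U. lagrangian \<Omega> U \<and> U \<inter> L = {0})"

definition wvec :: "'b::euclidean_space set \<Rightarrow> (real \<Rightarrow> 'b set) \<Rightarrow> 'b \<Rightarrow> real \<Rightarrow> 'b" where
  "wvec U l v t = (THE w. w \<in> U \<and> v + w \<in> l t)"

definition crossing_form :: "('b::euclidean_space \<Rightarrow> 'b \<Rightarrow> real) \<Rightarrow> real \<Rightarrow> real \<Rightarrow> (real \<Rightarrow> 'b set) \<Rightarrow> real \<Rightarrow> 'b \<Rightarrow> real" where
  "crossing_form \<Omega> a b l t0 v =
     (THE d. ((\<lambda>t. \<Omega> v (wvec (transversal_lagr \<Omega> (l t0)) l v t)) has_real_derivative d)
               (at t0 within {a..b}))"

definition regular_crossings :: "('b::euclidean_space \<Rightarrow> 'b \<Rightarrow> real) \<Rightarrow> 'b set \<Rightarrow> real \<Rightarrow> real \<Rightarrow> (real \<Rightarrow> 'b set) \<Rightarrow> bool" where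
  "regular_crossings \<Omega> L0 a b l \<longleftrightarrow>
     (\<forall>t\<in>{a..b}. crossing L0 l t \<longrightarrow> nondegenerate_on (crossing_form \<Omega> a b l t) (l t \<inter> L0))"

text \<open>The crossing-form formula, valid for C^1 paths with only regular crossings.\<close>
definition crossing_sum :: "('b::euclidean_space \<Rightarrow> 'b \<Rightarrow> real) \<Rightarrow> 'b set \<Rightarrow> real \<Rightarrow> real \<Rightarrow> (real \<Rightarrow> 'b set) \<Rightarrow> int" where
  "crossing_sum \<Omega> L0 a b l =
     int (n_plus (crossing_form \<Omega> a b l a) (l a \<inter> L0))
     + (\<Sum>t\<in>{t. a < t \<and> t < b \<and> crossing L0 l t}. signature (crossing_form \<Omega> a b l t) (l t \<inter> L0))
     - int (n_minus (crossing_form \<Omega> a b l b) (l b \<inter> L0))"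

text \<open>The Cappell--Lee--Miller index of a continuous Lagrangian path: the common value of the
crossing-form formula on C^1 paths with only regular crossings that are homotopic to ell with
fixed endpoints (well defined by fixed-endpoint homotopy invariance).\<close>
definition CLM :: "('b::euclidean_space \<Rightarrow> 'b \<Rightarrow> real) \<Rightarrow> 'b set \<Rightarrow> (real \<Rightarrow> 'b set) \<Rightarrow> real \<Rightarrow> real \<Rightarrow> int" where
  "CLM \<Omega> L0 l a b = (THE k. \<exists>l'. fe_homotopic \<Omega> a b l l' \<and> C1_lagr_path \<Omega> a b l' \<and>
        regular_crossings \<Omega> L0 a b l' \<and> k = crossing_sum \<Omega> L0 a b l')"

definition CZ :: "('a::euclidean_space \<Rightarrow> 'a \<Rightarrow> real) \<Rightarrow> (real \<Rightarrow> 'a \<Rightarrow> 'a) \<Rightarrow> real \<Rightarrow> real \<Rightarrow> int" where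
  "CZ \<omega> \<psi> a b = CLM (sum_form \<omega>) diagonal (\<lambda>t. graph (\<psi> t)) a b"

end

theory Submission
  imports Defs
begin

text \<open>
  Let \<open>\<tau>(A, B, C)\<close> be the Kashiwara index, the signature of \<open>\<Omega>(x,y) + \<Omega>(y,z) + \<Omega>(z,x)\<close> on \<open>A \<times> B \<times> C\<close>; it is a
  cocycle. Near a parameter where \<open>\<ell>\<close> is transversal to \<open>U\<close>, twice the Maslov index relative to \<open>L\<^sub>0\<close> changes
  like \<open>\<tau>(L\<^sub>0, \<ell>, U)\<close>, and by the cocycle identity these local functions fit together to a potential \<open>m\<close>,
  also over a homotopy. Its total increment is thus homotopy invariant; on regular \<open>C\<^sup>1\<close> paths it is computed
  by the crossing forms. Every path \<open>\<Psi>(t) \<Lambda>\<close> is homotopic to a regular one made of segments along which the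
  Lagrangian moves in a definite direction, so the CLM index is half the increment of \<open>m\<close> plus endpoint terms.

  The index of \<open>\<psi>(t) L\<close> relative to \<open>L\<^sub>0\<close> is that of \<open>Gr \<psi>(t)\<close> relative to \<open>\<delta> = L \<times> L\<^sub>0\<close>. Changing the reference
  Lagrangian from \<open>\<Delta>\<close> to \<open>\<delta>\<close> changes the potential by \<open>\<tau>(\<delta>, \<Delta>, Gr \<psi>(t))\<close>, which vanishes at \<open>t = 0\<close>, and the claim
  follows from \<open>|\<tau>(A, B, C)| \<le> N - dim A\<inter>B - dim B\<inter>C - dim A\<inter>C + 2 dim A\<inter>B\<inter>C\<close>, \<open>N = dim A\<close>.
\<close>

section \<open>Signatures of quadratic forms\<close>

text \<open>\<open>CLM\<close> is a definite description, so nothing can be said about it before a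
  regular representative is known to exist and all of them to give one number. Existence is proved
  for paths \<open>\<Psi>(t) \<Lambda>\<close> only; this suffices, since \<open>\<psi>(t) L\<close>
  and \<open>Gr \<psi>(t) = (id \<times> \<psi>(t)) \<Delta>\<close> both have this form. A straight
  chart segment between two nearby positions of \<open>\<Lambda>\<close> may have degenerate
  crossings. A detour over a Lagrangian lying far enough in a positive direction makes both halves
  definite, and definite crossings are regular. The corners of the detour are chosen generically so
  as not to be crossings, and the speed drops to zero there to keep the path continuously
  differentiable.

  The factor two arises because a potential jumps by the signature on each side of a crossing. The
  convention \<open>n_plus\<close> at the start and \<open>n_minus\<close> at the end then becomes
  the dimension of the intersection with \<open>L0\<close> at the two ends. With these terms the
  bound on \<open>\<tau>\<close> acts asymmetrically: one side gives \<open>CLM \<le> CZ\<close>,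
  the other exactly \<open>CZ - CLM \<le> 2n - dim \<epsilon>\<close>.\<close>

lemmas bilinear_arith =
  bilinear_ladd bilinear_radd bilinear_lmul bilinear_rmul bilinear_lneg bilinear_rneg
  bilinear_lzero bilinear_rzero bilinear_lsub bilinear_rsub

definition symmetric_bilinear :: "('b::euclidean_space \<Rightarrow> 'b \<Rightarrow> real) \<Rightarrow> bool" where
  "symmetric_bilinear B \<longleftrightarrow> bilinear B \<and> (\<forall>x y. B x y = B y x)"

definition radical :: "('b::euclidean_space \<Rightarrow> 'b \<Rightarrow> real) \<Rightarrow> 'b set \<Rightarrow> 'b set" where
  "radical B W = {x \<in> W. \<forall>y\<in>W. B x y = 0}"

section \<open>Dimension counts for subspaces and annihilators\<close>

lemma subspace_complement_exists:
  fixes R W :: "'b::euclidean_space set"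
  assumes "subspace R" "subspace W" "R \<subseteq> W"
  obtains C where "subspace C" "C \<subseteq> W" "C \<inter> R = {0}" "dim C + dim R = dim W"
    "\<And>w. w \<in> W \<Longrightarrow> \<exists>c\<in>C. \<exists>r\<in>R. w = c + r"
proof
  let ?C = "{y \<in> W. \<forall>x\<in>R. orthogonal x y}"
  show C: "subspace ?C"
    using assms(2) by (auto simp: subspace_def orthogonal_def inner_right_distrib)
  show "?C \<subseteq> W" by auto
  show "?C \<inter> R = {0}"
    using assms by (auto simp: orthogonal_def subspace_0)
  show "dim ?C + dim R = dim W"
    using dim_subspace_orthogonal_to_vectors[OF assms] .
  fix w assume w: "w \<in> W"
  obtain r c where "w = r + c" "r \<in> span R" "\<And>x. x \<in> span R \<Longrightarrow> orthogonal c x"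
    using orthogonal_subspace_decomp_exists[of R w] by metis
  moreover have "span R = R" using assms by simp
  moreover have "c = w - r" using \<open>w = r + c\<close> by simp
  ultimately show "\<exists>c\<in>?C. \<exists>r\<in>R. w = c + r"
    using assms w by (intro bexI[of _ c] bexI[of _ r])
      (auto simp: orthogonal_commute intro!: subspace_diff)
qed

lemma rank_nullity_on:
  fixes f :: "'b::euclidean_space \<Rightarrow> 'c::euclidean_space"
  assumes "linear f" "subspace W"
  shows "dim (f ` W) + dim {x \<in> W. f x = 0} = dim W"
proof -
  let ?R = "{x \<in> W. f x = 0}"
  have R: "subspace ?R"
    using assms by (auto simp: subspace_def linear_0 linear_add linear_cmul)
  obtain C where C: "subspace C" "C \<subseteq> W" "C \<inter> ?R = {0}" "dim C + dim ?R = dim W"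
    "\<And>w. w \<in> W \<Longrightarrow> \<exists>c\<in>C. \<exists>r\<in>?R. w = c + r"
    using subspace_complement_exists[OF R assms(2)] by auto
  have inj: "inj_on f (span C)"
  proof (rule inj_onI)
    fix x y assume xy: "x \<in> span C" "y \<in> span C" "f x = f y"
    have "x - y \<in> C" using xy C(1) by (simp add: subspace_diff span_eq_iff[THEN iffD2])
    moreover have "f (x - y) = 0" using xy assms by (simp add: linear_diff)
    moreover have "x - y \<in> C \<inter> ?R" using calculation C(2) by auto
    ultimately show "x = y" using C(3) by simp
  qed
  have "f ` W = f ` C"
  proof
    show "f ` W \<subseteq> f ` C"
    proof (safe)
      fix w assume "w \<in> W"
      then obtain c r where "c \<in> C" "r \<in> ?R" "w = c + r" using C(5) by blast
      then have "f w = f c" using assms by (simp add: linear_add)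
      then show "f w \<in> f ` C" using \<open>c \<in> C\<close> by blast
    qed
  qed (use C in auto)
  then show ?thesis
    using dim_image_eq[OF assms(1) inj] C(4) by simp
qed

lemma dim_add_le_of_disjoint:
  fixes S T W :: "'b::euclidean_space set"
  assumes "subspace S" "subspace T" "subspace W" "S \<subseteq> W" "T \<subseteq> W" "S \<inter> T \<subseteq> {0}"
  shows "dim S + dim T \<le> dim W"
proof -
  have "dim (S \<inter> T) = 0" using assms by (simp add: dim_eq_0)
  moreover have "dim {x + y |x y. x \<in> S \<and> y \<in> T} \<le> dim W"
    using assms by (intro dim_subset) (auto intro: subspace_add)
  ultimately show ?thesis using dim_sums_Int[OF assms(1,2)] by linarith
qed

lemma dim_Int_ge:
  fixes S T W :: "'b::euclidean_space set"
  assumes "subspace S" "subspace T" "subspace W" "S \<subseteq> W" "T \<subseteq> W"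
  shows "dim S + dim T \<le> dim W + dim (S \<inter> T)"
proof -
  have "dim {x + y |x y. x \<in> S \<and> y \<in> T} \<le> dim W"
    using assms by (intro dim_subset) (auto intro: subspace_add)
  then show ?thesis using dim_sums_Int[OF assms(1,2)] by simp
qed

lemma subspace_sums_eq:
  fixes S T W :: "'b::euclidean_space set"
  assumes "subspace S" "subspace T" "subspace W" "S \<subseteq> W" "T \<subseteq> W" "S \<inter> T \<subseteq> {0}"
    and "dim W \<le> dim S + dim T" and "w \<in> W"
  shows "\<exists>s\<in>S. \<exists>t\<in>T. w = s + t"
proof -
  let ?Z = "{x + y |x y. x \<in> S \<and> y \<in> T}"
  have "dim (S \<inter> T) = 0" using assms by (simp add: dim_eq_0)
  then have "dim ?Z = dim S + dim T" using dim_sums_Int[OF assms(1,2)] by linarith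
  moreover have "subspace ?Z" using subspace_sums[OF assms(1,2)] .
  moreover have "?Z \<subseteq> W" using assms by (auto intro: subspace_add)
  ultimately have "?Z = W" using assms by (intro subspace_dim_equal) auto
  then show ?thesis using assms(8) by blast
qed

text \<open>Annihilating \<open>S\<close> means annihilating a basis \<open>X\<close> of it. The map
  \<open>f\<close> packs these \<open>dim S\<close> functionals into one linear map into
  \<open>span X\<close>, so its kernel has codimension at most \<open>dim S\<close>.\<close>

lemma dim_annihilator_ge:
  fixes B :: "'b::euclidean_space \<Rightarrow> 'c::euclidean_space \<Rightarrow> real"
  assumes "bilinear B" "subspace W" "subspace S"
  shows "dim W \<le> dim {w \<in> W. \<forall>s\<in>S. B w s = 0} + dim S"
proof -
  obtain X where X: "X \<subseteq> S" "independent X" "S \<subseteq> span X" "card X = dim S"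
    using basis_exists[of S] by metis
  have fin: "finite X" using X(2) by (rule finiteI_independent)
  define f where "f w = (\<Sum>x\<in>X. B w x *\<^sub>R x)" for w
  have lf: "linear f"
    unfolding f_def using assms(1)
    by (intro linearI) (auto simp: bilinear_arith scaleR_left_distrib sum.distrib scaleR_sum_right)
  have "{w \<in> W. f w = 0} \<subseteq> {w \<in> W. \<forall>s\<in>S. B w s = 0}"
  proof (safe)
    fix w s assume w: "w \<in> W" "f w = 0" "s \<in> S"
    have "\<forall>x\<in>X. B w x = 0"
      using independentD[OF X(2) fin order_refl, of "B w"] w(2) unfolding f_def by blast
    moreover have "linear (B w)" using assms(1) by (simp add: bilinear_def)
    ultimately have "\<forall>x\<in>span X. B w x = 0"
      by (metis linear_eq_0_on_span)
    then show "B w s = 0" using w(3) X(3) by auto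
  qed
  then have 1: "dim {w \<in> W. f w = 0} \<le> dim {w \<in> W. \<forall>s\<in>S. B w s = 0}" by (rule dim_subset)
  have "f ` W \<subseteq> span X"
    unfolding f_def by (rule image_subsetI) (intro span_sum span_scale span_base)
  then have "dim (f ` W) \<le> dim S"
    using X(4) fin dim_le_card by (metis span_minimal subspace_span span_span)
  then show ?thesis using rank_nullity_on[OF lf assms(2)] 1 by linarith
qed

lemma subspace_annihilator:
  assumes "bilinear B" "subspace W"
  shows "subspace {w \<in> W. \<forall>s\<in>S. B w s = 0}"
  using assms by (auto simp: subspace_def bilinear_arith)

lemma subspace_radical:
  "symmetric_bilinear B \<Longrightarrow> subspace W \<Longrightarrow> subspace (radical B W)"
  unfolding radical_def symmetric_bilinear_def by (intro subspace_annihilator) auto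

section \<open>The indices of a form as maximal dimensions of definite subspaces\<close>

lemma finite_dims:
  "finite {dim S |S :: 'b::euclidean_space set. P S}"
  by (rule finite_subset[of _ "{..DIM('b)}"]) (auto intro: dim_subset_UNIV)

lemma n_plus_ge:
  assumes "subspace S" "S \<subseteq> W" "\<And>v. v \<in> S \<Longrightarrow> v \<noteq> 0 \<Longrightarrow> q v > 0"
  shows "dim S \<le> n_plus q W"
  unfolding n_plus_def by (rule Max_ge[OF finite_dims]) (use assms in blast)

lemma n_plus_attained:
  assumes "subspace W"
  shows "\<exists>S. subspace S \<and> S \<subseteq> W \<and> (\<forall>v\<in>S. v \<noteq> 0 \<longrightarrow> q v > 0) \<and> dim S = n_plus q W"
proof -
  let ?A = "{dim S | S. subspace S \<and> S \<subseteq> W \<and> (\<forall>v\<in>S. v \<noteq> 0 \<longrightarrow> q v > 0)}"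
  have "dim ({0} :: 'a set) \<in> ?A"
    using assms by (auto intro!: exI[of _ "{0}"] simp: subspace_0)
  then have "Max ?A \<in> ?A" by (intro Max_in[OF finite_dims]) blast
  then show ?thesis unfolding n_plus_def by auto
qed

lemma n_minus_eq_n_plus: "n_minus q W = n_plus (\<lambda>x. - q x) W"
  by (simp add: n_minus_def n_plus_def)

lemma n_plus_cong: "(\<And>x. x \<in> W \<Longrightarrow> q x = q' x) \<Longrightarrow> n_plus q W = n_plus q' W"
  unfolding n_plus_def by (intro arg_cong[where f=Max] Collect_cong) (metis subsetD)

lemma n_minus_cong: "(\<And>x. x \<in> W \<Longrightarrow> q x = q' x) \<Longrightarrow> n_minus q W = n_minus q' W"
  unfolding n_minus_eq_n_plus by (rule n_plus_cong) simp

lemma signature_cong: "(\<And>x. x \<in> W \<Longrightarrow> q x = q' x) \<Longrightarrow> signature q W = signature q' W"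
  unfolding signature_def using n_plus_cong[of W q q'] n_minus_cong[of W q q'] by simp

lemma n_plus_scale: "c > 0 \<Longrightarrow> n_plus (\<lambda>x. c * q x) W = n_plus q W"
  by (simp add: n_plus_def zero_less_mult_iff)

lemma signature_scale: "c > 0 \<Longrightarrow> signature (\<lambda>x. c * q x) W = signature q W"
  using n_plus_scale[of c q W] n_plus_scale[of c "\<lambda>x. - q x" W]
  by (simp add: signature_def n_minus_eq_n_plus)

lemma signature_uminus: "signature (\<lambda>x. - q x) W = - signature q W"
  by (simp add: signature_def n_minus_eq_n_plus)

lemma symmetric_bilinear_uminus:
  "symmetric_bilinear B \<Longrightarrow> symmetric_bilinear (\<lambda>x y. - B x y)"
  unfolding symmetric_bilinear_def bilinear_def by (auto intro: linear_compose_neg)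

text \<open>A maximal positive subspace \<open>P\<close> has its orthogonal \<open>Q\<close> as a complement, on which the form is
  negative semidefinite, and the isotropic vectors of \<open>Q\<close> are exactly the radical.\<close>
lemma sylvester:
  fixes W :: "'b::euclidean_space set"
  assumes B: "symmetric_bilinear B" and W: "subspace W"
  shows "n_plus (\<lambda>x. B x x) W + n_minus (\<lambda>x. B x x) W + dim (radical B W) = dim W"
proof -
  let ?R = "radical B W"
  have bil: "bilinear B" and sym: "\<And>x y. B x y = B y x"
    using B by (auto simp: symmetric_bilinear_def)
  have R: "subspace ?R" using B W by (rule subspace_radical)
  obtain P where P: "subspace P" "P \<subseteq> W" "\<And>v. v \<in> P \<Longrightarrow> v \<noteq> 0 \<Longrightarrow> B v v > 0"
    "dim P = n_plus (\<lambda>x. B x x) W"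
    using n_plus_attained[OF W, of "\<lambda>x. B x x"] by blast
  define Q where "Q = {w \<in> W. \<forall>p\<in>P. B w p = 0}"
  have Q: "subspace Q" "Q \<subseteq> W" "dim W \<le> dim Q + dim P"
    unfolding Q_def using subspace_annihilator[OF bil W] dim_annihilator_ge[OF bil W P(1)] by auto
  have PQ: "P \<inter> Q \<subseteq> {0}" unfolding Q_def using P(3) by force
  have decomp: "\<exists>p\<in>P. \<exists>x\<in>Q. w = p + x" if "w \<in> W" for w
    using subspace_sums_eq[OF P(1) Q(1) W P(2) Q(2) PQ] Q(3) that by simp
  have neg: "B w w \<le> 0" if w: "w \<in> Q" for w
  proof (rule ccontr)
    assume "\<not> B w w \<le> 0"
    then have pos: "B w w > 0" by simp
    then have w0: "w \<notin> P" using w P bil unfolding Q_def by force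
    \<comment> \<open>\<open>w\<close> is positive and orthogonal to \<open>P\<close>, so adjoining
      it would enlarge a positive definite subspace whose dimension is already maximal.\<close>
    let ?S = "span (insert w P)"
    have "?S \<subseteq> W" using w P W Q by (intro span_minimal) auto
    moreover have "B v v > 0" if v: "v \<in> ?S" "v \<noteq> 0" for v
    proof -
      obtain k where k: "v - k *\<^sub>R w \<in> P"
        using v P(1) by (auto simp: span_insert span_eq_iff[THEN iffD2])
      define p where "p = v - k *\<^sub>R w"
      have "B w p = 0" using w k unfolding Q_def p_def by auto
      have vp: "v = p + k *\<^sub>R w" by (simp add: p_def)
      have "B v v = B p p + k^2 * B w w"
        unfolding vp using \<open>B w p = 0\<close> sym[of p w] bil by (simp add: bilinear_arith power2_eq_square)
      moreover have "B p p \<ge> 0" using P(3)[of p] k p_def bil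
        by (cases "p = 0") (auto simp: bilinear_arith)
      moreover have "p \<noteq> 0 \<or> k \<noteq> 0" using v vp by auto
      ultimately show ?thesis using pos P(3)[of p] k p_def
        by (cases "k = 0") (auto intro!: add_nonneg_pos simp: zero_less_mult_iff)
    qed
    ultimately have "dim ?S \<le> n_plus (\<lambda>x. B x x) W"
      by (intro n_plus_ge) auto
    moreover have "dim ?S = dim P + 1"
      using w0 P(1) by (simp add: dim_insert span_eq_iff[THEN iffD2])
    ultimately show False using P(4) by simp
  qed
  have rad: "w \<in> ?R" if w: "w \<in> Q" "B w w = 0" for w
  proof -
    have 0: "B w z = 0" if z: "z \<in> Q" for z
    proof (rule ccontr)
      assume nz: "B w z \<noteq> 0"
      have *: "2 * t * B w z + t^2 * B z z \<le> 0" for t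
        using neg[of "w + t *\<^sub>R z"] w z Q(1) sym[of z w] bil
        by (simp add: subspace_add subspace_scale bilinear_arith power2_eq_square algebra_simps)
      \<comment> \<open>Any \<open>c > 0\<close> with \<open>2 * c + B z z > 0\<close> serves: at
        \<open>t = B w z / c\<close> the form takes the value \<open>t^2 * (2 * c + B z z)\<close>
        on \<open>w + t *\<^sub>R z\<close>, against \<open>neg\<close>.\<close>
      define c where "c = \<bar>B z z\<bar> + 1"
      have c: "c > 0" "B z z > - c" by (auto simp: c_def)
      define t where "t = B w z / c"
      have "2 * t * B w z + t^2 * B z z = t^2 * (2 * c + B z z)"
        using c by (simp add: t_def power2_eq_square field_simps)
      moreover have "\<dots> > 0" using c nz by (intro mult_pos_pos) (auto simp: t_def)
      ultimately show False using *[of t] by simp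
    qed
    have "B w y = 0" if y: "y \<in> W" for y
    proof -
      obtain p x where "p \<in> P" "x \<in> Q" "y = p + x" using decomp y by blast
      then show ?thesis using 0 w bil unfolding Q_def by (simp add: bilinear_arith)
    qed
    then show ?thesis using w Q(2) unfolding radical_def by auto
  qed
  have RQ: "?R \<subseteq> Q" using P(2) unfolding radical_def Q_def by auto
  obtain N where N: "subspace N" "N \<subseteq> Q" "N \<inter> ?R = {0}" "dim N + dim ?R = dim Q"
    using subspace_complement_exists[OF R Q(1) RQ] by metis
  have "B v v < 0" if "v \<in> N" "v \<noteq> 0" for v
    using neg[of v] rad[of v] N that by force
  then have ge: "dim N \<le> n_minus (\<lambda>x. B x x) W"
    unfolding n_minus_eq_n_plus using N Q by (intro n_plus_ge) auto
  obtain M where M: "subspace M" "M \<subseteq> W" "\<And>v. v \<in> M \<Longrightarrow> v \<noteq> 0 \<Longrightarrow> B v v < 0"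
    "dim M = n_minus (\<lambda>x. B x x) W"
    using n_plus_attained[OF W, of "\<lambda>x. - B x x"] unfolding n_minus_eq_n_plus by auto
  \<comment> \<open>The form is nonnegative on \<open>P + ?R\<close>, so a negative definite
    \<open>M\<close> meets it only in 0. This is the upper bound on \<open>n_minus\<close> that
    matches \<open>ge\<close>.\<close>
  let ?PR = "{x + y |x y. x \<in> P \<and> y \<in> ?R}"
  have "P \<inter> ?R \<subseteq> {0}" using PQ RQ by auto
  then have dPR: "dim ?PR = dim P + dim ?R"
    using dim_sums_Int[OF P(1) R] by (simp add: dim_eq_0[THEN iffD2])
  have "M \<inter> ?PR \<subseteq> {0}"
  proof (clarsimp)
    fix x y assume xy: "x + y \<in> M" "x \<in> P" "y \<in> ?R"
    have z: "B y x = 0" "B y y = 0" "B x y = 0"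
      using xy P(2) sym unfolding radical_def by auto
    have "B x x \<ge> 0" using P(3)[OF xy(2)] bil by (cases "x = 0") (auto simp: bilinear_arith)
    then have "B (x + y) (x + y) \<ge> 0" using bil z by (simp add: bilinear_arith)
    then show "x + y = 0" using M(3)[OF xy(1)] by fastforce
  qed
  then have "dim M + dim ?PR \<le> dim W"
    using M subspace_sums[OF P(1) R] W P(2) radical_def[of B W]
    by (intro dim_add_le_of_disjoint) (auto intro: subspace_add)
  then show ?thesis using ge M(4) dPR P(4) N(4) Q(3) by linarith
qed

text \<open>A subspace on which the pulled back function is positive meets the kernel of
  \<open>f\<close> only in 0, so \<open>f\<close> embeds it; conversely a positive subspace of the
  image lifts to a complement of the kernel in its preimage. Maps with a kernel are the ones that
  matter: forms on Lagrangians are later pulled back to whole spaces along projections.\<close>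

lemma n_plus_pullback:
  fixes f :: "'b::euclidean_space \<Rightarrow> 'c::euclidean_space"
  assumes f: "linear f" and V: "subspace V" and q: "q 0 = 0"
  shows "n_plus (\<lambda>x. q (f x)) V = n_plus q (f ` V)"
proof (rule antisym)
  obtain S where S: "subspace S" "S \<subseteq> V" "\<And>v. v \<in> S \<Longrightarrow> v \<noteq> 0 \<Longrightarrow> q (f v) > 0"
    "dim S = n_plus (\<lambda>x. q (f x)) V"
    using n_plus_attained[OF V, of "\<lambda>x. q (f x)"] by auto
  have "x = 0" if "x \<in> S" "f x = 0" for x
    using S(3)[OF that(1)] q that(2) by (cases "x = 0") auto
  then have k: "{x \<in> S. f x = 0} = {0}"
    using f subspace_0[OF S(1)] by (auto simp: linear_0)
  have "dim (f ` S) = dim S" using rank_nullity_on[OF f S(1)] k by simp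
  moreover have "dim (f ` S) \<le> n_plus q (f ` V)"
  proof (rule n_plus_ge)
    show "subspace (f ` S)" using f S(1) by (rule linear_subspace_image)
    show "f ` S \<subseteq> f ` V" using S by auto
    fix v assume "v \<in> f ` S" "v \<noteq> 0"
    then obtain x where "x \<in> S" "v = f x" by blast
    moreover have "x \<noteq> 0" using \<open>v \<noteq> 0\<close> \<open>v = f x\<close> f by (auto simp: linear_0)
    ultimately show "q v > 0" using S(3)[of x] by simp
  qed
  ultimately show "n_plus (\<lambda>x. q (f x)) V \<le> n_plus q (f ` V)" using S(4) by simp
next
  obtain S where S: "subspace S" "S \<subseteq> f ` V" "\<And>v. v \<in> S \<Longrightarrow> v \<noteq> 0 \<Longrightarrow> q v > 0"
    "dim S = n_plus q (f ` V)"
    using n_plus_attained[OF linear_subspace_image[OF f V], of q] by auto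
  let ?X = "{x \<in> V. f x \<in> S}" and ?K = "{x \<in> V. f x = 0}"
  have X: "subspace ?X" "subspace ?K" "?K \<subseteq> ?X"
    using V S(1) f by (auto simp: subspace_def linear_0 linear_add linear_cmul)
  obtain C where C: "subspace C" "C \<subseteq> ?X" "C \<inter> ?K = {0}" "dim C + dim ?K = dim ?X"
    by (rule subspace_complement_exists[OF X(2,1,3)])
  have "f ` ?X = S" using S(2) by auto
  moreover have "{x \<in> ?X. f x = 0} = ?K" using X by auto
  ultimately have "dim S + dim ?K = dim ?X" using rank_nullity_on[OF f X(1)] by simp
  then have "dim C = dim S" using C by simp
  moreover have "dim C \<le> n_plus (\<lambda>x. q (f x)) V"
  proof (rule n_plus_ge[OF C(1)])
    show "C \<subseteq> V" using C(2) by auto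
    fix v assume "v \<in> C" "v \<noteq> 0"
    then have "f v \<in> S" "f v \<noteq> 0" using C(2,3) by blast+
    then show "q (f v) > 0" by (rule S(3))
  qed
  ultimately show "n_plus q (f ` V) \<le> n_plus (\<lambda>x. q (f x)) V" using S(4) by simp
qed

lemma signature_pullback:
  fixes f :: "'b::euclidean_space \<Rightarrow> 'c::euclidean_space"
  assumes "linear f" "subspace V" "q 0 = 0"
  shows "signature (\<lambda>x. q (f x)) V = signature q (f ` V)"
  using n_plus_pullback[OF assms(1,2), of q] n_plus_pullback[OF assms(1,2), of "\<lambda>x. - q x"] assms(3)
  by (simp add: signature_def n_minus_eq_n_plus)

section \<open>Direct sums of forms and reduction by isotropic subspaces\<close>

definition direct_sum_form ::
  "('b \<Rightarrow> 'b \<Rightarrow> real) \<Rightarrow> ('c \<Rightarrow> 'c \<Rightarrow> real) \<Rightarrow> 'b \<times> 'c \<Rightarrow> 'b \<times> 'c \<Rightarrow> real" where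
  "direct_sum_form B C = (\<lambda>x y. B (fst x) (fst y) + C (snd x) (snd y))"

lemma symmetric_bilinear_direct_sum:
  assumes "symmetric_bilinear B" "symmetric_bilinear C"
  shows "symmetric_bilinear (direct_sum_form B C)"
proof -
  have bil: "bilinear B" "bilinear C" and sym: "\<And>x y. B x y = B y x" "\<And>x y. C x y = C y x"
    using assms unfolding symmetric_bilinear_def by blast+
  have "bilinear (direct_sum_form B C)"
    unfolding bilinear_def direct_sum_form_def
    by (intro conjI allI linearI) (simp_all add: bilinear_arith[OF bil(1)] bilinear_arith[OF bil(2)] algebra_simps)
  then show ?thesis
    unfolding symmetric_bilinear_def direct_sum_form_def using sym by metis
qed

lemma n_plus_direct_sum_ge:
  fixes V :: "'b::euclidean_space set" and W :: "'c::euclidean_space set"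
  assumes "symmetric_bilinear B" "symmetric_bilinear C" "subspace V" "subspace W"
  shows "n_plus (\<lambda>x. B x x) V + n_plus (\<lambda>x. C x x) W
     \<le> n_plus (\<lambda>x. direct_sum_form B C x x) (V \<times> W)"
proof -
  have bil: "bilinear B" "bilinear C" using assms by (auto simp: symmetric_bilinear_def)
  obtain S where S: "subspace S" "S \<subseteq> V" "\<And>v. v \<in> S \<Longrightarrow> v \<noteq> 0 \<Longrightarrow> B v v > 0"
    "dim S = n_plus (\<lambda>x. B x x) V" using n_plus_attained[OF assms(3), of "\<lambda>x. B x x"] by blast
  obtain T where T: "subspace T" "T \<subseteq> W" "\<And>v. v \<in> T \<Longrightarrow> v \<noteq> 0 \<Longrightarrow> C v v > 0"
    "dim T = n_plus (\<lambda>x. C x x) W" using n_plus_attained[OF assms(4), of "\<lambda>x. C x x"] by blast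
  have "dim (S \<times> T) \<le> n_plus (\<lambda>x. direct_sum_form B C x x) (V \<times> W)"
  proof (rule n_plus_ge)
    show "subspace (S \<times> T)" using S T by (simp add: subspace_Times)
    show "S \<times> T \<subseteq> V \<times> W" using S T by auto
    fix v assume v: "v \<in> S \<times> T" "v \<noteq> 0"
    obtain x y where xy: "v = (x, y)" by (cases v)
    have "B x x \<ge> 0" "C y y \<ge> 0" using S(3)[of x] T(3)[of y] v xy bil
      by (cases "x = 0"; cases "y = 0"; force simp: bilinear_arith)+
    moreover have "x \<noteq> 0 \<or> y \<noteq> 0" using v xy by (auto simp: zero_prod_def)
    ultimately show "direct_sum_form B C v v > 0"
      using S(3)[of x] T(3)[of y] v xy by (auto simp: direct_sum_form_def add_pos_nonneg add_nonneg_pos)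
  qed
  then show ?thesis using S T by (simp add: dim_Times)
qed

text \<open>Products of definite subspaces give \<open>\<ge>\<close> for both indices. Since the
  radical of the sum is the product of the radicals, the total count in \<open>sylvester\<close>
  leaves no room for a strict inequality.\<close>

lemma
  fixes V :: "'b::euclidean_space set" and W :: "'c::euclidean_space set"
  assumes "symmetric_bilinear B" "symmetric_bilinear C" "subspace V" "subspace W"
  shows n_plus_direct_sum: "n_plus (\<lambda>x. direct_sum_form B C x x) (V \<times> W)
     = n_plus (\<lambda>x. B x x) V + n_plus (\<lambda>x. C x x) W" (is ?p)
    and n_minus_direct_sum: "n_minus (\<lambda>x. direct_sum_form B C x x) (V \<times> W)
     = n_minus (\<lambda>x. B x x) V + n_minus (\<lambda>x. C x x) W" (is ?n)
    and signature_direct_sum: "signature (\<lambda>x. direct_sum_form B C x x) (V \<times> W)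
     = signature (\<lambda>x. B x x) V + signature (\<lambda>x. C x x) W" (is ?s)
proof -
  note neg = symmetric_bilinear_uminus[OF assms(1)] symmetric_bilinear_uminus[OF assms(2)]
  have "(\<lambda>x. direct_sum_form (\<lambda>x y. - B x y) (\<lambda>x y. - C x y) x x) = (\<lambda>x. - direct_sum_form B C x x)"
    by (auto simp: direct_sum_form_def)
  then have ge: "n_minus (\<lambda>x. B x x) V + n_minus (\<lambda>x. C x x) W
     \<le> n_minus (\<lambda>x. direct_sum_form B C x x) (V \<times> W)"
    using n_plus_direct_sum_ge[OF neg assms(3,4)] unfolding n_minus_eq_n_plus by simp
  have bil: "bilinear B" "bilinear C" using assms by (auto simp: symmetric_bilinear_def)
  have "radical (direct_sum_form B C) (V \<times> W) = radical B V \<times> radical C W"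
  proof (auto simp: radical_def direct_sum_form_def)
    fix a b y assume h: "\<forall>y\<in>V. \<forall>ya\<in>W. B a y + C b ya = 0"
    show "B a y = 0" if "y \<in> V" using h[rule_format, OF that subspace_0[OF assms(4)]] bil
      by (simp add: bilinear_arith)
  next
    fix a b y assume h: "\<forall>y\<in>V. \<forall>ya\<in>W. B a y + C b ya = 0"
    show "C b y = 0" if "y \<in> W" using h[rule_format, OF subspace_0[OF assms(3)] that] bil
      by (simp add: bilinear_arith)
  qed
  then have "dim (radical (direct_sum_form B C) (V \<times> W)) = dim (radical B V) + dim (radical C W)"
    using assms by (simp add: dim_Times subspace_radical)
  then have e: "n_plus (\<lambda>x. direct_sum_form B C x x) (V \<times> W) + n_minus (\<lambda>x. direct_sum_form B C x x) (V \<times> W)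
     = n_plus (\<lambda>x. B x x) V + n_minus (\<lambda>x. B x x) V + n_plus (\<lambda>x. C x x) W + n_minus (\<lambda>x. C x x) W"
    using sylvester[OF symmetric_bilinear_direct_sum[OF assms(1,2)] subspace_Times[OF assms(3,4)]]
      sylvester[OF assms(1,3)] sylvester[OF assms(2,4)] dim_Times[OF assms(3,4)] by linarith
  show ?p using e ge n_plus_direct_sum_ge[OF assms] by linarith
  show ?n using e ge n_plus_direct_sum_ge[OF assms] by linarith
  then show ?s using \<open>?p\<close> by (simp add: signature_def)
qed

text \<open>Passing to the orthogonal \<open>?J\<close> of \<open>I\<close> lowers each index by at
  most the codimension of \<open>?J\<close>. With \<open>C\<close> a complement of
  \<open>I \<inter> ?R\<close> in \<open>I\<close>, that codimension is at most
  \<open>dim C\<close>, while the radical grows by at least \<open>dim C\<close>. By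
  \<open>sylvester\<close> the two drops then add up to at least twice the codimension, so both are
  equal to it and cancel in the signature.\<close>

lemma signature_reduction:
  fixes W :: "'b::euclidean_space set"
  assumes B: "symmetric_bilinear B" and W: "subspace W" and I: "subspace I" "I \<subseteq> W"
    and iso: "\<And>x y. x \<in> I \<Longrightarrow> y \<in> I \<Longrightarrow> B x y = 0"
  shows "signature (\<lambda>x. B x x) W = signature (\<lambda>x. B x x) {w \<in> W. \<forall>i\<in>I. B w i = 0}"
proof -
  let ?J = "{w \<in> W. \<forall>i\<in>I. B w i = 0}" and ?R = "radical B W"
  have bil: "bilinear B" and sym: "\<And>x y. B x y = B y x"
    using B by (auto simp: symmetric_bilinear_def)
  have J: "subspace ?J" "?J \<subseteq> W" using subspace_annihilator[OF bil W] by auto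
  have R: "subspace ?R" using subspace_radical[OF B W] .
  have IR: "subspace (I \<inter> ?R)" using I R by (simp add: subspace_inter)
  obtain C where C: "subspace C" "C \<subseteq> I" "C \<inter> (I \<inter> ?R) = {0}" "dim C + dim (I \<inter> ?R) = dim I"
    "\<And>w. w \<in> I \<Longrightarrow> \<exists>c\<in>C. \<exists>r\<in>I \<inter> ?R. w = c + r"
    using subspace_complement_exists[OF IR I(1)] by blast
  have "{w \<in> W. \<forall>c\<in>C. B w c = 0} \<subseteq> ?J"
  proof clarify
    fix w i assume w: "w \<in> W" "\<forall>c\<in>C. B w c = 0" "i \<in> I"
    obtain c r where "c \<in> C" "r \<in> ?R" "i = c + r" using C(5)[OF w(3)] by auto
    moreover then have "B w r = 0" using w(1) sym unfolding radical_def by auto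
    ultimately show "B w i = 0" using w bil by (simp add: bilinear_arith)
  qed
  then have codim: "dim W \<le> dim ?J + dim C"
    using dim_annihilator_ge[OF bil W C(1)] dim_subset order_trans add_right_mono by meson
  let ?Z = "{x + y |x y. x \<in> I \<and> y \<in> ?R}"
  have RW: "?R \<subseteq> W" by (auto simp: radical_def)
  have "?Z \<subseteq> radical B ?J"
  proof clarify
    fix x y assume xy: "x \<in> I" "y \<in> ?R"
    have y0: "B y z = 0" if "z \<in> W" for z using xy that by (auto simp: radical_def)
    show "x + y \<in> radical B ?J"
      unfolding radical_def using xy I RW W iso y0 bil sym[of x]
      by (auto simp: bilinear_arith subset_iff intro!: subspace_add)
  qed
  then have "dim ?Z \<le> dim (radical B ?J)" by (rule dim_subset)
  then have rad: "dim C + dim ?R \<le> dim (radical B ?J)"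
    using dim_sums_Int[OF I(1) R] C(4) by linarith
  \<comment> \<open>The factor \<open>s\<close> takes the values 1 and -1, which treats both indices
    at once.\<close>
  have le: "n_plus (\<lambda>x. s * B x x) W + dim ?J \<le> n_plus (\<lambda>x. s * B x x) ?J + dim W" for s :: real
  proof -
    obtain P where P: "subspace P" "P \<subseteq> W" "\<And>v. v \<in> P \<Longrightarrow> v \<noteq> 0 \<Longrightarrow> s * B v v > 0"
      "dim P = n_plus (\<lambda>x. s * B x x) W"
      using n_plus_attained[OF W, of "\<lambda>x. s * B x x"] by blast
    have "dim (P \<inter> ?J) \<le> n_plus (\<lambda>x. s * B x x) ?J"
      using P J by (intro n_plus_ge) (auto intro: subspace_inter)
    then show ?thesis using dim_Int_ge[OF P(1) J(1) W P(2) J(2)] P(4) by linarith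
  qed
  have a: "n_plus (\<lambda>x. B x x) W + dim ?J \<le> n_plus (\<lambda>x. B x x) ?J + dim W"
    "n_minus (\<lambda>x. B x x) W + dim ?J \<le> n_minus (\<lambda>x. B x x) ?J + dim W"
    using le[of 1] le[of "-1"] unfolding n_minus_eq_n_plus by simp_all
  show ?thesis
    unfolding signature_def
    using a codim rad sylvester[OF B W] sylvester[OF B J(1)] dim_subset[OF J(2)] by linarith
qed

lemma abs_signature_le:
  assumes B: "symmetric_bilinear B" and W: "subspace W" and R: "R \<subseteq> radical B W"
  shows "\<bar>signature (\<lambda>x. B x x) W\<bar> \<le> int (dim W) - int (dim R)"
  using sylvester[OF B W] dim_subset[OF R] unfolding signature_def by linarith

section \<open>Semicontinuity of the indices under limits of forms\<close>

lemma tendsto_bilinear_euclidean: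
  fixes B :: "'b::euclidean_space \<Rightarrow> 'c::euclidean_space \<Rightarrow> real"
  assumes "bilinear B" "(f \<longlongrightarrow> x) F" "(g \<longlongrightarrow> y) F"
  shows "((\<lambda>t. B (f t) (g t)) \<longlongrightarrow> B x y) F"
  using Lim_bilinear[OF assms(2,3)] assms(1) bilinear_conv_bounded_bilinear by blast

text \<open>By compactness the limit form is at least some \<open>c > 0\<close> on the unit sphere
  of \<open>S\<close>. Convergence of the finitely many values on basis pairs is uniform on that
  sphere, because coordinates of unit vectors are at most 1; \<open>D t\<close> is the resulting
  bound. Homogeneity does the rest.\<close>

lemma eventually_positive_definite:
  fixes S :: "'b::euclidean_space set" and B0 :: "'b \<Rightarrow> 'b \<Rightarrow> real"
  assumes lim: "\<And>x y. ((\<lambda>t. B t x y) \<longlongrightarrow> B0 x y) F"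
    and bil: "\<forall>\<^sub>F t in F. bilinear (B t)" "bilinear B0"
    and S: "subspace S" and pos: "\<And>v. v \<in> S \<Longrightarrow> v \<noteq> 0 \<Longrightarrow> B0 v v > 0"
  shows "\<forall>\<^sub>F t in F. \<forall>v\<in>S. v \<noteq> 0 \<longrightarrow> B t v v > 0"
proof -
  let ?K = "S \<inter> sphere 0 1"
  have cont: "continuous_on ?K (\<lambda>v. B0 v v)"
    unfolding continuous_on_def by (intro ballI tendsto_bilinear_euclidean[OF bil(2)] tendsto_ident_at)
  have comp: "compact ?K" using closed_subspace[OF S] by (simp add: closed_Int_compact)
  obtain c where c: "c > 0" "\<And>v. v \<in> ?K \<Longrightarrow> B0 v v \<ge> c"
  proof (cases "?K = {}")
    case True then show ?thesis using that[of 1] by auto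
  next
    case False
    then obtain v where v: "v \<in> ?K" "\<And>w. w \<in> ?K \<Longrightarrow> B0 v v \<le> B0 w w"
      using continuous_attains_inf[OF comp False cont] by blast
    then show ?thesis using that[of "B0 v v"] pos[of v] by force
  qed
  define D where "D t = (\<Sum>i\<in>Basis. \<Sum>j\<in>Basis. \<bar>B t i j - B0 i j\<bar>)" for t
  have "(D \<longlongrightarrow> (\<Sum>i\<in>(Basis::'b set). \<Sum>j\<in>(Basis::'b set). \<bar>B0 i j - B0 i j\<bar>)) F"
    unfolding D_def by (intro tendsto_intros lim)
  then have "(D \<longlongrightarrow> 0) F" by simp
  then have "\<forall>\<^sub>F t in F. D t < c" using c(1) by (rule order_tendstoD)
  then show ?thesis
    using bil(1)
  proof eventually_elim
    fix t assume D: "D t < c" and bilt: "bilinear (B t)"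
    have d: "\<bar>B t v v - B0 v v\<bar> \<le> D t" if v: "norm v = 1" for v
    proof -
      have e: "A v v = (\<Sum>i\<in>Basis. \<Sum>j\<in>Basis. (v \<bullet> i) * (v \<bullet> j) * A i j)" if A: "bilinear A"
        for A :: "'b \<Rightarrow> 'b \<Rightarrow> real"
      proof -
        have "A v v = A (\<Sum>i\<in>Basis. (v \<bullet> i) *\<^sub>R i) (\<Sum>j\<in>Basis. (v \<bullet> j) *\<^sub>R j)"
          by (simp add: euclidean_representation)
        also have "\<dots> = (\<Sum>i\<in>Basis. \<Sum>j\<in>Basis. A ((v \<bullet> i) *\<^sub>R i) ((v \<bullet> j) *\<^sub>R j))"
          using bilinear_sum[OF A, of "\<lambda>i. (v \<bullet> i) *\<^sub>R i" Basis "\<lambda>j. (v \<bullet> j) *\<^sub>R j" Basis]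
          by (simp add: sum.cartesian_product)
        finally show ?thesis using A by (simp add: bilinear_arith mult.assoc)
      qed
      have "\<bar>B t v v - B0 v v\<bar> = \<bar>\<Sum>i\<in>Basis. \<Sum>j\<in>Basis. (v \<bullet> i) * (v \<bullet> j) * (B t i j - B0 i j)\<bar>"
        unfolding e[OF bilt] e[OF bil(2)] by (simp add: sum_subtractf algebra_simps)
      also have "\<dots> \<le> D t"
        unfolding D_def
      proof (rule order_trans[OF sum_abs], rule sum_mono, rule order_trans[OF sum_abs], rule sum_mono)
        fix i j :: 'b assume ij: "i \<in> Basis" "j \<in> Basis"
        have "\<bar>v \<bullet> i\<bar> * \<bar>v \<bullet> j\<bar> \<le> 1"
          using Basis_le_norm[OF ij(1), of v] Basis_le_norm[OF ij(2), of v] v by (simp add: mult_le_one)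
        then show "\<bar>(v \<bullet> i) * (v \<bullet> j) * (B t i j - B0 i j)\<bar> \<le> \<bar>B t i j - B0 i j\<bar>"
          by (simp add: abs_mult mult_left_le_one_le)
      qed
      finally show ?thesis .
    qed
    show "\<forall>v\<in>S. v \<noteq> 0 \<longrightarrow> B t v v > 0"
    proof (intro ballI impI)
      fix v assume v: "v \<in> S" "v \<noteq> 0"
      define u where "u = (1 / norm v) *\<^sub>R v"
      have u: "u \<in> ?K" using v S by (simp add: u_def subspace_scale)
      have vu: "v = norm v *\<^sub>R u" using v by (simp add: u_def)
      have "B t u u > 0" using d[of u] c(2)[OF u] D u by auto
      moreover have "B t v v = (norm v)^2 * B t u u"
        using bilt by (subst (1 2) vu) (simp add: bilinear_arith power2_eq_square)
      ultimately show "B t v v > 0" using v by simp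
    qed
  qed
qed

text \<open>Limits yield only lower semicontinuity. Equality is obtained later by bounding both
  indices from below and comparing their sum with \<open>sylvester\<close>, once the dimension of
  the radical is under control.\<close>

lemma eventually_n_plus_ge:
  fixes W :: "'b::euclidean_space set" and B0 :: "'b \<Rightarrow> 'b \<Rightarrow> real"
  assumes "\<And>x y. ((\<lambda>t. B t x y) \<longlongrightarrow> B0 x y) F" "\<forall>\<^sub>F t in F. bilinear (B t)" "bilinear B0" "subspace W"
  shows "\<forall>\<^sub>F t in F. n_plus (\<lambda>x. B0 x x) W \<le> n_plus (\<lambda>x. B t x x) W"
proof -
  obtain S where S: "subspace S" "S \<subseteq> W" "\<And>v. v \<in> S \<Longrightarrow> v \<noteq> 0 \<Longrightarrow> B0 v v > 0"
    "dim S = n_plus (\<lambda>x. B0 x x) W" using n_plus_attained[OF assms(4), of "\<lambda>x. B0 x x"] by blast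
  have "\<forall>\<^sub>F t in F. \<forall>v\<in>S. v \<noteq> 0 \<longrightarrow> B t v v > 0"
    by (rule eventually_positive_definite[OF assms(1-3) S(1) S(3)])
  then show ?thesis
  proof eventually_elim
    fix t assume "\<forall>v\<in>S. v \<noteq> 0 \<longrightarrow> B t v v > 0"
    then have "dim S \<le> n_plus (\<lambda>x. B t x x) W" using S(1,2) by (intro n_plus_ge) auto
    then show "n_plus (\<lambda>x. B0 x x) W \<le> n_plus (\<lambda>x. B t x x) W" using S(4) by simp
  qed
qed

lemma eventually_n_minus_ge:
  fixes W :: "'b::euclidean_space set" and B0 :: "'b \<Rightarrow> 'b \<Rightarrow> real"
  assumes lim: "\<And>x y. ((\<lambda>t. B t x y) \<longlongrightarrow> B0 x y) F" and bil: "\<forall>\<^sub>F t in F. bilinear (B t)" "bilinear B0"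
    and W: "subspace W"
  shows "\<forall>\<^sub>F t in F. n_minus (\<lambda>x. B0 x x) W \<le> n_minus (\<lambda>x. B t x x) W"
  unfolding n_minus_eq_n_plus
proof (rule eventually_n_plus_ge[OF _ _ _ W, of "\<lambda>t x y. - B t x y" "\<lambda>x y. - B0 x y"])
  show "\<forall>\<^sub>F t in F. bilinear (\<lambda>x y. - B t x y)"
    using bil(1) by eventually_elim (auto simp: bilinear_def intro: linear_compose_neg)
  show "bilinear (\<lambda>x y. - B0 x y)"
    using bil(2) by (auto simp: bilinear_def intro: linear_compose_neg)
qed (intro tendsto_intros lim)

section \<open>Lagrangian subspaces and the Kashiwara index\<close>

lemma symplectic_bilinear: "symplectic_form \<Omega> \<Longrightarrow> bilinear \<Omega>"
  unfolding symplectic_form_def bilinear_def by blast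

lemma symplectic_skew: "symplectic_form \<Omega> \<Longrightarrow> \<Omega> u v = - \<Omega> v u"
  unfolding symplectic_form_def by blast

lemma symplectic_self: "symplectic_form \<Omega> \<Longrightarrow> \<Omega> u u = 0"
  using symplectic_skew[of \<Omega> u u] by simp

lemma symplectic_nondegenerate: "symplectic_form \<Omega> \<Longrightarrow> (\<And>v. \<Omega> u v = 0) \<Longrightarrow> u = 0"
  unfolding symplectic_form_def by blast

lemma subspace_complement_UNIV:
  fixes R :: "'b::euclidean_space set"
  assumes "subspace R"
  shows "\<exists>C. subspace C \<and> dim C + dim R = DIM('b) \<and> (\<forall>w. \<exists>c\<in>C. \<exists>r\<in>R. w = c + r)"
proof (rule subspace_complement_exists[OF assms subspace_UNIV subset_UNIV])
  fix C assume "subspace C" "dim C + dim R = dim (UNIV :: 'b set)"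
    "\<And>w. w \<in> UNIV \<Longrightarrow> \<exists>c\<in>C. \<exists>r\<in>R. w = c + r"
  then show ?thesis by (intro exI[of _ C]) simp
qed

text \<open>One inequality is the general codimension bound. For the other, an element of
  \<open>S\<close> that pairs to 0 with a complement \<open>C\<close> of the annihilator pairs to 0
  with everything, so nondegeneracy gives \<open>dim S \<le> dim C\<close>.\<close>

lemma dim_symplectic_orthogonal:
  fixes S :: "'b::euclidean_space set"
  assumes \<Omega>: "symplectic_form \<Omega>" and S: "subspace S"
  shows "dim {w. \<forall>s\<in>S. \<Omega> w s = 0} + dim S = DIM('b)"
proof -
  let ?A = "{w. \<forall>s\<in>S. \<Omega> w s = 0}"
  note bil = symplectic_bilinear[OF \<Omega>]
  have A: "subspace ?A" using subspace_annihilator[OF bil subspace_UNIV, of S] by simp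
  have ge: "DIM('b) \<le> dim ?A + dim S" using dim_annihilator_ge[OF bil subspace_UNIV S] by simp
  obtain C where C: "subspace C" "dim C + dim ?A = DIM('b)"
    "\<forall>w. \<exists>c\<in>C. \<exists>r\<in>?A. w = c + r"
    using subspace_complement_UNIV[OF A] by blast
  have "{s \<in> S. \<forall>c\<in>C. \<Omega> s c = 0} \<subseteq> {0}"
  proof clarify
    fix s assume s: "s \<in> S" "\<forall>c\<in>C. \<Omega> s c = 0"
    have "\<Omega> s v = 0" for v
    proof -
      obtain c r where cr: "c \<in> C" "r \<in> ?A" "v = c + r" using C(3) by blast
      have "\<Omega> r s = 0" using cr s by blast
      then have "\<Omega> s r = 0" using symplectic_skew[OF \<Omega>, of s r] by linarith
      moreover have "\<Omega> s c = 0" using cr s by blast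
      ultimately show ?thesis unfolding cr by (simp add: bilinear_arith[OF bil])
    qed
    then show "s = 0" using symplectic_nondegenerate[OF \<Omega>] by blast
  qed
  then have "dim {s \<in> S. \<forall>c\<in>C. \<Omega> s c = 0} = 0" by (simp only: dim_eq_0)
  then have "dim S \<le> dim C" using dim_annihilator_ge[OF bil S C(1)] by linarith
  then show ?thesis using ge C(2) by linarith
qed

lemma lagrangian_subspace: "lagrangian \<Omega> L \<Longrightarrow> subspace L"
  by (simp add: lagrangian_def)

lemma lagrangian_isotropic: "lagrangian \<Omega> L \<Longrightarrow> u \<in> L \<Longrightarrow> v \<in> L \<Longrightarrow> \<Omega> u v = 0"
  by (simp add: lagrangian_def)

lemma lagrangian_maximal:
  assumes \<Omega>: "symplectic_form \<Omega>" and L: "lagrangian \<Omega> L" and x: "\<And>y. y \<in> L \<Longrightarrow> \<Omega> x y = 0"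
  shows "x \<in> L"
proof -
  let ?A = "{w. \<forall>s\<in>L. \<Omega> w s = 0}"
  note bil = symplectic_bilinear[OF \<Omega>]
  have A: "subspace ?A" using subspace_annihilator[OF bil subspace_UNIV, of L] by simp
  have "L = ?A"
  proof (rule subspace_dim_equal[OF lagrangian_subspace[OF L] A])
    show "L \<subseteq> ?A" using L by (auto simp: lagrangian_def)
    show "dim ?A \<le> dim L"
      using dim_symplectic_orthogonal[OF \<Omega> lagrangian_subspace[OF L]] L by (auto simp: lagrangian_def)
  qed
  then show ?thesis using x by blast
qed

text \<open>If \<open>v\<close> avoids the earlier subspaces but lies in \<open>S\<close>, move
  along the line \<open>v + t *\<^sub>R u\<close> with \<open>u\<close> outside \<open>S\<close>: it
  meets each earlier subspace for at most one \<open>t\<close>, and \<open>S\<close> only for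
  \<open>t = 0\<close>. Infinitely many scalars remain.\<close>

lemma not_subset_finite_Union_subspaces:
  fixes W :: "'b::real_vector set"
  assumes "finite F" "subspace W" "\<And>S. S \<in> F \<Longrightarrow> subspace S" "\<And>S. S \<in> F \<Longrightarrow> \<not> W \<subseteq> S"
  shows "\<exists>v\<in>W. \<forall>S\<in>F. v \<notin> S"
  using assms(1,3,4)
proof (induction F rule: finite_induct)
  case empty
  then show ?case using assms(2) subspace_0 by blast
next
  case (insert S F)
  obtain v where v: "v \<in> W" "\<forall>S\<in>F. v \<notin> S" using insert by blast
  obtain u where u: "u \<in> W" "u \<notin> S" using insert.prems(2)[of S] by blast
  show ?case
  proof (cases "v \<in> S")
    case False
    then show ?thesis using v by blast
  next
    case True
    let ?bad = "\<lambda>X. {t::real. v + t *\<^sub>R u \<in> X}"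
    have "finite (?bad X)" if X: "X \<in> F" for X
    proof -
      have sX: "subspace X" using X insert by blast
      have "t = t'" if t: "t \<in> ?bad X" "t' \<in> ?bad X" for t t'
      proof (rule ccontr)
        assume ne: "t \<noteq> t'"
        have "(v + t *\<^sub>R u) - (v + t' *\<^sub>R u) \<in> X" using t sX by (intro subspace_diff) auto
        then have "(t - t') *\<^sub>R u \<in> X" by (simp add: scaleR_left_diff_distrib)
        then have "inverse (t - t') *\<^sub>R ((t - t') *\<^sub>R u) \<in> X" using sX by (rule subspace_scale[rotated])
        then have "u \<in> X" using ne by simp
        then have "(v + t *\<^sub>R u) - t *\<^sub>R u \<in> X" using t sX by (intro subspace_diff subspace_scale) auto
        then show False using v X by simp
      qed
      then show ?thesis by (cases "?bad X = {}") (auto intro: finite_subset[of _ "{_}"])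
    qed
    then have "finite (insert 0 (\<Union>X\<in>F. ?bad X))" using insert by auto
    then obtain t where t: "t \<notin> insert 0 (\<Union>X\<in>F. ?bad X)" using ex_new_if_finite[OF infinite_UNIV_char_0] by blast
    have "v + t *\<^sub>R u \<notin> S"
    proof
      assume a: "v + t *\<^sub>R u \<in> S"
      have sS: "subspace S" using insert by blast
      have "(v + t *\<^sub>R u) - v \<in> S" using a True sS by (intro subspace_diff) auto
      then have "inverse t *\<^sub>R ((v + t *\<^sub>R u) - v) \<in> S" using sS by (rule subspace_scale[rotated])
      then show False using u t by simp
    qed
    moreover have "v + t *\<^sub>R u \<in> W" using u v assms(2) by (simp add: subspace_add subspace_scale)
    ultimately show ?thesis using t by blast
  qed
qed

text \<open>Take \<open>U\<close> isotropic, transversal to all of \<open>F\<close>, and of maximal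
  dimension. If \<open>U\<close> is not Lagrangian, a vector of its orthogonal \<open>?A\<close>
  outside every \<open>L + U\<close> can be adjoined. Such a vector exists because \<open>?A\<close>
  is in none of the finitely many \<open>L + U\<close>: otherwise
  \<open>L \<inter> ?A = {0}\<close>, although \<open>dim ?A\<close> exceeds half of the total
  dimension.\<close>

lemma common_transversal_lagrangian:
  fixes \<Omega> :: "'b::euclidean_space \<Rightarrow> 'b \<Rightarrow> real"
  assumes \<Omega>: "symplectic_form \<Omega>" and F: "finite F" "F \<noteq> {}" "\<And>L. L \<in> F \<Longrightarrow> lagrangian \<Omega> L"
  shows "\<exists>U. lagrangian \<Omega> U \<and> (\<forall>L\<in>F. U \<inter> L = {0})"
proof -
  note bil = symplectic_bilinear[OF \<Omega>]
  let ?P = "\<lambda>U. subspace U \<and> (\<forall>u\<in>U. \<forall>v\<in>U. \<Omega> u v = 0) \<and> (\<forall>L\<in>F. U \<inter> L = {0})"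
  have "?P {0}" using F(3) bil by (auto simp: bilinear_arith lagrangian_def subspace_0)
  moreover have "\<forall>U. ?P U \<longrightarrow> dim U < DIM('b) + 1" by (simp add: dim_subset_UNIV less_Suc_eq_le)
  ultimately have "\<exists>U. ?P U \<and> (\<forall>V. ?P V \<longrightarrow> dim V \<le> dim U)"
    by (rule ex_has_greatest_nat)
  then obtain U where UM: "?P U \<and> (\<forall>V. ?P V \<longrightarrow> dim V \<le> dim U)" by (elim exE)
  have U: "?P U" using UM by (rule conjunct1)
  have max: "dim V \<le> dim U" if "?P V" for V using UM that by blast
  have sU: "subspace U" using U by blast
  let ?A = "{w. \<forall>s\<in>U. \<Omega> w s = 0}"
  have A: "subspace ?A" using subspace_annihilator[OF bil subspace_UNIV, of U] by simp
  have dA: "dim ?A + dim U = DIM('b)" using dim_symplectic_orthogonal[OF \<Omega> sU] .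
  have "U \<subseteq> ?A" using U by blast
  then have "dim U \<le> dim ?A" by (rule dim_subset)
  then have le: "2 * dim U \<le> DIM('b)" using dA by linarith
  have "2 * dim U = DIM('b)"
  proof (rule ccontr)
    assume ne: "2 * dim U \<noteq> DIM('b)"
    let ?G = "(\<lambda>L. {x + y |x y. x \<in> L \<and> y \<in> U}) ` F"
    have "\<exists>v\<in>?A. \<forall>S\<in>?G. v \<notin> S"
    proof (rule not_subset_finite_Union_subspaces[OF _ A])
      show "finite ?G" using F by simp
      show "subspace S" if "S \<in> ?G" for S
        using that F(3) sU by (auto intro: subspace_sums dest: lagrangian_subspace)
      fix S assume "S \<in> ?G"
      then obtain L where L: "L \<in> F" "S = {x + y |x y. x \<in> L \<and> y \<in> U}" by blast
      have lL: "lagrangian \<Omega> L" using L F by blast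
      have sL: "subspace L" using lL by (rule lagrangian_subspace)
      show "\<not> ?A \<subseteq> S"
      proof
        assume sub: "?A \<subseteq> S"
        \<comment> \<open>An element of \<open>L \<inter> ?A\<close> pairs to 0 with
          \<open>L + U\<close>, hence with \<open>?A\<close> by the assumption \<open>sub\<close>,
          and the double orthogonal of \<open>U\<close> is \<open>U\<close>.\<close>
        have "L \<inter> ?A \<subseteq> U"
        proof
          fix x assume x: "x \<in> L \<inter> ?A"
          let ?B = "{w. \<forall>s\<in>?A. \<Omega> w s = 0}"
          have B: "subspace ?B" using subspace_annihilator[OF bil subspace_UNIV, of ?A] by simp
          have "U = ?B"
          proof (rule subspace_dim_equal[OF sU B])
            show "U \<subseteq> ?B"
            proof clarify
              fix u s assume "u \<in> U" "\<forall>x\<in>U. \<Omega> s x = 0"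
              then show "\<Omega> u s = 0" using symplectic_skew[OF \<Omega>, of u s] by simp
            qed
            show "dim ?B \<le> dim U" using dim_symplectic_orthogonal[OF \<Omega> A] dA by linarith
          qed
          moreover have "\<Omega> x s = 0" if s: "s \<in> ?A" for s
          proof -
            have "s \<in> {x + y |x y. x \<in> L \<and> y \<in> U}" using s sub unfolding L(2) by (rule subsetD[rotated])
            then obtain y u where "y \<in> L" "u \<in> U" "s = y + u" by auto
            moreover have "\<Omega> x y = 0" "\<Omega> x u = 0"
              using lagrangian_isotropic[OF lL] x \<open>y \<in> L\<close> \<open>u \<in> U\<close> by auto
            ultimately show ?thesis using bil by (simp add: bilinear_arith)
          qed
          ultimately show "x \<in> U" by blast
        qed
        then have "L \<inter> ?A \<subseteq> {0}" using U L by blast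
        then have "dim L + dim ?A \<le> DIM('b)"
          using dim_add_le_of_disjoint[OF sL A subspace_UNIV] by simp
        then show False using lL dA ne le unfolding lagrangian_def by linarith
      qed
    qed
    then obtain v where v0: "v \<in> ?A" "\<forall>S\<in>?G. v \<notin> S" by (elim bexE)
    have v: "v \<in> ?A" "\<And>L. L \<in> F \<Longrightarrow> v \<notin> {x + y |x y. x \<in> L \<and> y \<in> U}"
      using v0(1) bspec[OF v0(2) imageI] by auto
    obtain L where "L \<in> F" using F by blast
    have vU: "v \<notin> U"
    proof
      assume "v \<in> U"
      then have "0 + v \<in> {x + y |x y. x \<in> L \<and> y \<in> U}"
        using F(3)[OF \<open>L \<in> F\<close>] subspace_0 lagrangian_subspace by blast
      then show False using v(2)[OF \<open>L \<in> F\<close>] by simp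
    qed
    let ?V = "span (insert v U)"
    have V: "\<exists>k u. x = u + k *\<^sub>R v \<and> u \<in> U" if x: "x \<in> ?V" for x
    proof -
      obtain k where "x - k *\<^sub>R v \<in> span U" using x by (auto simp: span_insert)
      then have "x - k *\<^sub>R v \<in> U" using sU by (simp add: span_eq_iff[THEN iffD2])
      then show ?thesis by (metis diff_add_cancel)
    qed
    have "\<Omega> x y = 0" if xy: "x \<in> ?V" "y \<in> ?V" for x y
    proof -
      obtain k u k' u' where "x = u + k *\<^sub>R v" "u \<in> U" "y = u' + k' *\<^sub>R v" "u' \<in> U"
        using V[OF xy(1)] V[OF xy(2)] by metis
      moreover then have "\<Omega> u u' = 0" "\<Omega> v u' = 0" "\<Omega> u v = 0" "\<Omega> v v = 0"
        using U v symplectic_skew[OF \<Omega>, of u v] symplectic_self[OF \<Omega>] by auto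
      ultimately show ?thesis using bil by (simp add: bilinear_arith)
    qed
    moreover have "?V \<inter> L = {0}" if L: "L \<in> F" for L
    proof -
      have sL: "subspace L" using L F lagrangian_subspace by blast
      have "x = 0" if x: "x \<in> ?V" "x \<in> L" for x
      proof -
        obtain k u where ku: "x = u + k *\<^sub>R v" "u \<in> U" using V[OF x(1)] by blast
        have "k = 0"
        proof (rule ccontr)
          assume k: "k \<noteq> 0"
          have "v = inverse k *\<^sub>R x + (- inverse k) *\<^sub>R u" using ku k by (simp add: scaleR_add_right)
          moreover have "inverse k *\<^sub>R x \<in> L" "(- inverse k) *\<^sub>R u \<in> U"
            using subspace_scale[OF sL x(2)] subspace_scale[OF sU ku(2)] by blast+
          ultimately show False using v(2)[OF L] by blast
        qed
        then show ?thesis using ku x U L by auto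
      qed
      then show ?thesis using sL by (auto simp: span_zero subspace_0)
    qed
    ultimately have "dim ?V \<le> dim U" by (intro max) auto
    moreover have "dim ?V = dim U + 1" using vU sU by (simp add: dim_insert span_eq_iff[THEN iffD2])
    ultimately show False by simp
  qed
  then show ?thesis using U unfolding lagrangian_def by blast
qed

lemma transversal_lagrangian_exists:
  assumes "symplectic_form \<Omega>" "lagrangian \<Omega> L"
  shows "\<exists>U. lagrangian \<Omega> U \<and> L \<inter> U = {0}"
proof -
  have "\<exists>U. lagrangian \<Omega> U \<and> (\<forall>L'\<in>{L}. U \<inter> L' = {0})"
    by (rule common_transversal_lagrangian[OF assms(1)]) (use assms(2) in auto)
  then show ?thesis by (simp add: Int_commute)
qed

section \<open>Projections along a complement\<close>

definition complementary :: "'b::euclidean_space set \<Rightarrow> 'b set \<Rightarrow> bool" where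
  "complementary L U \<longleftrightarrow> subspace L \<and> subspace U \<and> L \<inter> U = {0} \<and> dim L + dim U = DIM('b)"

lemma lagrangian_complementary:
  "lagrangian \<Omega> L \<Longrightarrow> lagrangian \<Omega> U \<Longrightarrow> L \<inter> U = {0} \<Longrightarrow> complementary L U"
  by (auto simp: lagrangian_def complementary_def)

text \<open>The projection onto \<open>L\<close> along \<open>U\<close>. For a fixed
  \<open>U\<close> it is an affine coordinate on the Lagrangians transversal to \<open>U\<close>, in
  contrast to \<open>proj\<close>, whose kernel moves with \<open>L\<close>.\<close>

definition oblique :: "'b::euclidean_space set \<Rightarrow> 'b set \<Rightarrow> 'b \<Rightarrow> 'b" where
  "oblique L U x = (THE y. y \<in> L \<and> x - y \<in> U)"

lemma oblique_unique:
  assumes c: "complementary L U" and y: "y \<in> L" "x - y \<in> U"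
  shows "oblique L U x = y"
  unfolding oblique_def
proof (rule the_equality)
  fix z assume z: "z \<in> L \<and> x - z \<in> U"
  have "z - y \<in> L" using z y c by (simp add: complementary_def subspace_diff)
  moreover have "(x - y) - (x - z) \<in> U" using z y c unfolding complementary_def by (blast intro: subspace_diff)
  ultimately have "z - y \<in> L \<inter> U" by simp
  then have "z - y = 0" using c unfolding complementary_def by blast
  then show "z = y" by simp
qed (use y in auto)

lemma
  assumes c: "complementary L U"
  shows oblique_in: "oblique L U x \<in> L" and oblique_diff_in: "x - oblique L U x \<in> U"
proof -
  have "\<exists>s\<in>L. \<exists>t\<in>U. x = s + t"
    using c unfolding complementary_def by (intro subspace_sums_eq[of L U UNIV]) auto
  then obtain s t where "s \<in> L" "t \<in> U" "x = s + t" by blast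
  then have "oblique L U x = s" using c by (intro oblique_unique) auto
  then show "oblique L U x \<in> L" "x - oblique L U x \<in> U" using \<open>s \<in> L\<close> \<open>t \<in> U\<close> \<open>x = s + t\<close> by auto
qed

lemma oblique_id: "complementary L U \<Longrightarrow> x \<in> L \<Longrightarrow> oblique L U x = x"
  by (rule oblique_unique) (auto simp: complementary_def subspace_0)

lemma oblique_zero: "complementary L U \<Longrightarrow> x \<in> U \<Longrightarrow> oblique L U x = 0"
  by (rule oblique_unique) (auto simp: complementary_def subspace_0)

lemma oblique_eq_0_iff: "complementary L U \<Longrightarrow> oblique L U x = 0 \<longleftrightarrow> x \<in> U"
  using oblique_diff_in[of L U x] oblique_zero[of L U x] by auto

lemma linear_oblique:
  assumes c: "complementary L U"
  shows "linear (oblique L U)"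
proof (rule linearI)
  note s = c[unfolded complementary_def]
  note i = oblique_in[OF c] oblique_diff_in[OF c]
  fix x y and r :: real
  show "oblique L U (x + y) = oblique L U x + oblique L U y"
  proof (rule oblique_unique[OF c])
    show "oblique L U x + oblique L U y \<in> L" using s i by (blast intro: subspace_add)
    have "(x - oblique L U x) + (y - oblique L U y) \<in> U" using s i by (blast intro: subspace_add)
    then show "x + y - (oblique L U x + oblique L U y) \<in> U" by (simp add: algebra_simps)
  qed
  show "oblique L U (r *\<^sub>R x) = r *\<^sub>R oblique L U x"
  proof (rule oblique_unique[OF c])
    show "r *\<^sub>R oblique L U x \<in> L" using s i by (blast intro: subspace_scale)
    have "r *\<^sub>R (x - oblique L U x) \<in> U" using s i by (blast intro: subspace_scale)
    then show "r *\<^sub>R x - r *\<^sub>R oblique L U x \<in> U" by (simp add: algebra_simps)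
  qed
qed

lemma range_oblique: "complementary L U \<Longrightarrow> range (oblique L U) = L"
  using oblique_in[of L U] oblique_id[of L U] by (auto intro: range_eqI[OF sym])

lemma oblique_idem: "complementary L U \<Longrightarrow> oblique L U (oblique L U x) = oblique L U x"
  by (simp add: oblique_id oblique_in)

lemma complementary_image:
  fixes S :: "'b::euclidean_space \<Rightarrow> 'b"
  assumes S: "linear S" "bij S" and c: "complementary L U"
  shows "complementary (S ` L) (S ` U)"
proof -
  have inj: "inj_on S X" for X using S by (meson bij_is_inj inj_on_subset subset_UNIV)
  have "S ` L \<inter> S ` U = S ` (L \<inter> U)" using S by (simp add: bij_is_inj image_Int)
  then show ?thesis
    using c S dim_image_eq[OF S(1) inj, of L] dim_image_eq[OF S(1) inj, of U]
    unfolding complementary_def by (auto intro: linear_subspace_image simp: linear_0)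
qed

lemma oblique_image:
  fixes S :: "'b::euclidean_space \<Rightarrow> 'b"
  assumes S: "linear S" "bij S" and c: "complementary L U"
  shows "oblique (S ` L) (S ` U) (S x) = S (oblique L U x)"
  using oblique_in[OF c] oblique_diff_in[OF c, of x]
  by (intro oblique_unique[OF complementary_image[OF S c]]) (auto simp flip: linear_diff[OF S(1)])

lemma lagrangian_image:
  assumes S: "symplectic_map \<Omega> S" and L: "lagrangian \<Omega> L"
  shows "lagrangian \<Omega> (S ` L)"
proof -
  have "inj_on S (span L)" using S unfolding symplectic_map_def by (meson bij_is_inj inj_on_subset subset_UNIV)
  then show ?thesis
    using S L dim_image_eq[of S L] unfolding lagrangian_def symplectic_map_def
    by (auto intro: linear_subspace_image)
qed

text \<open>Over \<open>A\<close>, a Lagrangian \<open>B\<close> transversal to \<open>U\<close> is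
  the graph of a map into \<open>U\<close>, and this is the associated symmetric form. Pulling it
  back to the whole space puts all these forms on one domain, at the price of having
  \<open>U\<close> in every radical.\<close>

definition chart_form :: "('b::euclidean_space \<Rightarrow> 'b \<Rightarrow> real) \<Rightarrow> 'b set \<Rightarrow> 'b set \<Rightarrow> 'b set \<Rightarrow> 'b \<Rightarrow> 'b \<Rightarrow> real" where
  "chart_form \<Omega> U A B x y = \<Omega> (oblique A U x) (oblique B U y)"

lemma bilinear_chart_form:
  assumes "symplectic_form \<Omega>" "complementary A U" "complementary B U"
  shows "bilinear (chart_form \<Omega> U A B)"
  unfolding bilinear_def chart_form_def
  using symplectic_bilinear[OF assms(1)] linear_oblique[OF assms(2)] linear_oblique[OF assms(3)]
  by (intro conjI allI linearI) (simp_all add: bilinear_arith linear_add linear_cmul)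

lemma chart_form_commute:
  assumes \<Omega>: "symplectic_form \<Omega>" and "lagrangian \<Omega> A" "lagrangian \<Omega> B" "lagrangian \<Omega> U"
    and "A \<inter> U = {0}" "B \<inter> U = {0}"
  shows "chart_form \<Omega> U A B x y = chart_form \<Omega> U A B y x"
proof -
  note bil = symplectic_bilinear[OF \<Omega>]
  have c: "complementary A U" "complementary B U" using assms lagrangian_complementary by blast+
  let ?a = "oblique A U" and ?b = "oblique B U"
  define u where "u x = ?b x - ?a x" for x
  have u: "u z \<in> U" for z
  proof -
    have "(z - ?a z) - (z - ?b z) \<in> U"
      using oblique_diff_in[OF c(1)] oblique_diff_in[OF c(2)] lagrangian_subspace[OF assms(4)]
      by (blast intro: subspace_diff)
    then show ?thesis by (simp add: u_def)
  qed
  have b: "?b z = ?a z + u z" for z by (simp add: u_def)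
  have 0: "\<Omega> (?a x) (?a y) = 0" "\<Omega> (?a y) (?a x) = 0" "\<Omega> (u x) (u y) = 0" "\<Omega> (?b x) (?b y) = 0"
    using assms u oblique_in[OF c(1)] oblique_in[OF c(2)] by (auto intro: lagrangian_isotropic)
  \<comment> \<open>Isotropy of \<open>B\<close>, expanded through \<open>?b = ?a + u\<close>,
    leaves just the cross terms.\<close>
  then have "\<Omega> (?a x) (u y) + \<Omega> (u x) (?a y) = 0"
    unfolding b using bil by (simp add: bilinear_arith)
  moreover have "\<Omega> (u x) (?a y) = - \<Omega> (?a y) (u x)" using symplectic_skew[OF \<Omega>] .
  ultimately show ?thesis unfolding chart_form_def b using bil 0 by (simp add: bilinear_arith)
qed

lemma symmetric_bilinear_chart_form:
  assumes "symplectic_form \<Omega>" "lagrangian \<Omega> A" "lagrangian \<Omega> B" "lagrangian \<Omega> U"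
    "A \<inter> U = {0}" "B \<inter> U = {0}"
  shows "symmetric_bilinear (chart_form \<Omega> U A B)"
  unfolding symmetric_bilinear_def
  using bilinear_chart_form[OF assms(1)] chart_form_commute[OF assms] assms lagrangian_complementary by blast

lemma chart_form_swap:
  assumes "symplectic_form \<Omega>" "lagrangian \<Omega> A" "lagrangian \<Omega> B" "lagrangian \<Omega> U"
    "A \<inter> U = {0}" "B \<inter> U = {0}"
  shows "chart_form \<Omega> U B A x y = - chart_form \<Omega> U A B x y"
proof -
  have "chart_form \<Omega> U B A x y = - chart_form \<Omega> U A B y x"
    unfolding chart_form_def by (rule symplectic_skew[OF assms(1)])
  then show ?thesis using chart_form_commute[OF assms] by simp
qed

lemma oblique_diff_oblique_in:
  assumes "complementary A U" "complementary B U"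
  shows "oblique B U x - oblique A U x \<in> U"
proof -
  have "(x - oblique A U x) - (x - oblique B U x) \<in> U"
    using oblique_diff_in[OF assms(1)] oblique_diff_in[OF assms(2)] assms
    unfolding complementary_def by (blast intro: subspace_diff)
  then show ?thesis by simp
qed

lemma chart_form_add:
  assumes \<Omega>: "symplectic_form \<Omega>" and "lagrangian \<Omega> A" "lagrangian \<Omega> B" "lagrangian \<Omega> C" "lagrangian \<Omega> U"
    and "A \<inter> U = {0}" "B \<inter> U = {0}" "C \<inter> U = {0}"
  shows "chart_form \<Omega> U A B x y + chart_form \<Omega> U B C x y = chart_form \<Omega> U A C x y"
proof -
  note bil = symplectic_bilinear[OF \<Omega>]
  have c: "complementary A U" "complementary B U" "complementary C U"
    using assms lagrangian_complementary by blast+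
  let ?a = "oblique A U" and ?b = "oblique B U" and ?c = "oblique C U"
  have 0: "\<Omega> (?b x - ?a x) (?c y - ?b y) = 0" "\<Omega> (?b x) (?b y) = 0"
    using lagrangian_isotropic[OF assms(5) oblique_diff_oblique_in[OF c(1,2)] oblique_diff_oblique_in[OF c(2,3)]]
      lagrangian_isotropic[OF assms(3) oblique_in[OF c(2)] oblique_in[OF c(2)]] by blast+
  then show ?thesis unfolding chart_form_def using bil by (simp add: bilinear_arith)
qed

lemma radical_chart_form:
  assumes \<Omega>: "symplectic_form \<Omega>" and AB: "lagrangian \<Omega> A" "lagrangian \<Omega> B" "lagrangian \<Omega> U"
    "A \<inter> U = {0}" "B \<inter> U = {0}"
  shows "radical (chart_form \<Omega> U A B) UNIV = {x. oblique A U x \<in> B}"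
proof -
  have c: "complementary A U" "complementary B U" using assms lagrangian_complementary by blast+
  have "oblique A U x \<in> B" if "\<forall>y. \<Omega> (oblique A U x) (oblique B U y) = 0" for x
  proof (rule lagrangian_maximal[OF \<Omega> AB(2)])
    show "\<Omega> (oblique A U x) y = 0" if "y \<in> B" for y
      using \<open>\<forall>y. _\<close>[rule_format, of y] oblique_id[OF c(2) that] by simp
  qed
  then show ?thesis
    unfolding radical_def chart_form_def using AB(2) oblique_in[OF c(2)]
    by (auto intro: lagrangian_isotropic)
qed

text \<open>The radical is the preimage of \<open>A \<inter> B\<close> under a projection with
  kernel \<open>U\<close>. Together with \<open>sylvester\<close> this fixes the sum of the two
  indices as long as \<open>dim (A \<inter> B)\<close> does not change, the source of the local
  constancy results below.\<close>

lemma dim_radical_chart_form: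
  fixes \<Omega> :: "'b::euclidean_space \<Rightarrow> 'b \<Rightarrow> real"
  assumes \<Omega>: "symplectic_form \<Omega>" and AB: "lagrangian \<Omega> A" "lagrangian \<Omega> B" "lagrangian \<Omega> U"
    "A \<inter> U = {0}" "B \<inter> U = {0}"
  shows "dim (radical (chart_form \<Omega> U A B) UNIV) = dim U + dim (A \<inter> B)"
proof -
  have c: "complementary A U" "complementary B U" using assms lagrangian_complementary by blast+
  let ?R = "{x. oblique A U x \<in> B}"
  have R: "subspace ?R"
    using subspace_radical[OF symmetric_bilinear_chart_form[OF assms] subspace_UNIV] radical_chart_form[OF assms] by simp
  have "oblique A U ` ?R = A \<inter> B" using oblique_in[OF c(1)] oblique_id[OF c(1)] by (force intro: image_eqI[OF sym])
  moreover have "{x \<in> ?R. oblique A U x = 0} = U"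
  proof -
    have "x \<in> ?R" if "x \<in> U" for x
      using oblique_zero[OF c(1) that] subspace_0[OF lagrangian_subspace[OF AB(2)]] by simp
    then show ?thesis using oblique_eq_0_iff[OF c(1)] by blast
  qed
  ultimately show ?thesis
    using rank_nullity_on[OF linear_oblique[OF c(1)] R] radical_chart_form[OF assms] by simp
qed

section \<open>The Kashiwara index: cocycle identity and dimension bound\<close>

definition kashiwara_form :: "('b::euclidean_space \<Rightarrow> 'b \<Rightarrow> real) \<Rightarrow> 'b \<times> 'b \<times> 'b \<Rightarrow> real" where
  "kashiwara_form \<Omega> p = \<Omega> (fst p) (fst (snd p)) + \<Omega> (fst (snd p)) (snd (snd p)) + \<Omega> (snd (snd p)) (fst p)"

definition kashiwara :: "('b::euclidean_space \<Rightarrow> 'b \<Rightarrow> real) \<Rightarrow> 'b set \<Rightarrow> 'b set \<Rightarrow> 'b set \<Rightarrow> int" where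
  "kashiwara \<Omega> A B C = signature (kashiwara_form \<Omega>) (A \<times> B \<times> C)"

text \<open>Through the projections along \<open>U\<close> the Kashiwara form becomes \<open>a(x,y) + b(y,z) + c(z,x)\<close> with
  \<open>a + b + c = 0\<close>, and the linear substitution below diagonalizes it:
  \<open>4(a(x,y) + b(y,z) + c(z,x)) = a[x+y-z] + b[-x+y+z] + c[x-y+z]\<close>.\<close>
lemma kashiwara_eq_sum:
  fixes \<Omega> :: "'b::euclidean_space \<Rightarrow> 'b \<Rightarrow> real"
  assumes \<Omega>: "symplectic_form \<Omega>"
    and l: "lagrangian \<Omega> A" "lagrangian \<Omega> B" "lagrangian \<Omega> C" "lagrangian \<Omega> U"
    and t: "A \<inter> U = {0}" "B \<inter> U = {0}" "C \<inter> U = {0}"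
  shows "kashiwara \<Omega> A B C = signature (\<lambda>x. chart_form \<Omega> U A B x x) UNIV
     + signature (\<lambda>x. chart_form \<Omega> U B C x x) UNIV + signature (\<lambda>x. chart_form \<Omega> U C A x x) UNIV"
proof -
  note bil = symplectic_bilinear[OF \<Omega>]
  have c: "complementary A U" "complementary B U" "complementary C U"
    using l t lagrangian_complementary by blast+
  define f where "f p = (oblique A U (fst p), oblique B U (fst (snd p)), oblique C U (snd (snd p)))"
    for p :: "'b \<times> 'b \<times> 'b"
  have lf: "linear f" unfolding f_def
    using linear_oblique[OF c(1)] linear_oblique[OF c(2)] linear_oblique[OF c(3)]
    by (intro linearI) (simp_all add: linear_add linear_cmul)
  have rf: "range f = A \<times> B \<times> C"
  proof
    show "range f \<subseteq> A \<times> B \<times> C" by (auto simp: f_def oblique_in c)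
    show "A \<times> B \<times> C \<subseteq> range f"
    proof
      fix p assume "p \<in> A \<times> B \<times> C"
      then have "f p = p" by (auto simp: f_def oblique_id c)
      then show "p \<in> range f" by (metis rangeI)
    qed
  qed
  let ?a = "chart_form \<Omega> U A B" and ?b = "chart_form \<Omega> U B C" and ?c = "chart_form \<Omega> U C A"
  have sa: "symmetric_bilinear ?a" and sb: "symmetric_bilinear ?b" and sc: "symmetric_bilinear ?c"
    using symmetric_bilinear_chart_form \<Omega> l t by blast+
  have c_eq: "?c x y = - ?a x y - ?b x y" for x y
    using chart_form_add[OF \<Omega> l t, of x y] chart_form_swap[OF \<Omega> l(1,3,4) t(1,3), of x y] by simp
  define g where "g p = (fst p + fst (snd p) - snd (snd p), - fst p + fst (snd p) + snd (snd p), fst p - fst (snd p) + snd (snd p))"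
    for p :: "'b \<times> 'b \<times> 'b"
  have lg: "linear g" unfolding g_def
    by (intro linearI) (simp_all add: algebra_simps)
  have rg: "range g = UNIV"
  proof (rule surjI)
    fix p :: "'b \<times> 'b \<times> 'b"
    obtain u v w where p: "p = (u, v, w)" by (metis prod_cases3)
    \<comment> \<open>If \<open>g (x, y, z) = (u, v, w)\<close>, then \<open>u + w = 2 x\<close>,
      \<open>u + v = 2 y\<close> and \<open>v + w = 2 z\<close>.\<close>
    show "g ((1/2) *\<^sub>R (fst p + snd (snd p)), (1/2) *\<^sub>R (fst p + fst (snd p)), (1/2) *\<^sub>R (fst (snd p) + snd (snd p))) = p"
      unfolding g_def p by (simp add: algebra_simps flip: scaleR_add_left)
  qed
  let ?D = "direct_sum_form ?a (direct_sum_form ?b ?c)"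
  have bilD: "bilinear ?a" "bilinear ?b" and sym: "\<And>x y. ?a x y = ?a y x" "\<And>x y. ?b x y = ?b y x"
    using sa sb unfolding symmetric_bilinear_def by blast+
  have eq: "?D (g p) (g p) = 4 * kashiwara_form \<Omega> (f p)" for p
  proof -
    obtain x y z where p: "p = (x, y, z)" by (metis prod_cases3)
    have k: "kashiwara_form \<Omega> (f p) = ?a x y + ?b y z + ?c z x"
      by (simp add: p f_def kashiwara_form_def chart_form_def)
    show ?thesis
      unfolding k unfolding p g_def direct_sum_form_def fst_conv snd_conv c_eq
      by (simp add: bilinear_arith[OF bilD(1)] bilinear_arith[OF bilD(2)]
          sym(1)[of y x] sym(1)[of z x] sym(1)[of z y] sym(2)[of y x] sym(2)[of z x] sym(2)[of z y])
  qed
  have D0: "?D 0 0 = 0" using symmetric_bilinear_direct_sum[OF sa symmetric_bilinear_direct_sum[OF sb sc]]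
    unfolding symmetric_bilinear_def by (simp add: bilinear_arith)
  have "kashiwara \<Omega> A B C = signature (\<lambda>p. kashiwara_form \<Omega> (f p)) UNIV"
    unfolding kashiwara_def rf[symmetric]
    by (rule signature_pullback[symmetric, OF lf subspace_UNIV]) (simp add: kashiwara_form_def bilinear_arith[OF bil])
  also have "\<dots> = signature (\<lambda>p. ?D (g p) (g p)) UNIV"
    unfolding eq by (rule signature_scale[symmetric]) simp
  also have "\<dots> = signature (\<lambda>p. ?D p p) UNIV"
    using signature_pullback[OF lg subspace_UNIV, of "\<lambda>p. ?D p p"] D0 rg by simp
  also have "\<dots> = signature (\<lambda>x. ?a x x) UNIV + signature (\<lambda>x. direct_sum_form ?b ?c x x) UNIV"
    using signature_direct_sum[OF sa symmetric_bilinear_direct_sum[OF sb sc] subspace_UNIV subspace_UNIV] by simp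
  also have "signature (\<lambda>x. direct_sum_form ?b ?c x x) UNIV = signature (\<lambda>x. ?b x x) UNIV + signature (\<lambda>x. ?c x x) UNIV"
    using signature_direct_sum[OF sb sc subspace_UNIV subspace_UNIV] by simp
  finally show ?thesis by simp
qed

lemma signature_chart_form_swap:
  assumes "symplectic_form \<Omega>" "lagrangian \<Omega> A" "lagrangian \<Omega> B" "lagrangian \<Omega> U"
    "A \<inter> U = {0}" "B \<inter> U = {0}"
  shows "signature (\<lambda>x. chart_form \<Omega> U B A x x) UNIV = - signature (\<lambda>x. chart_form \<Omega> U A B x x) UNIV"
  by (simp only: chart_form_swap[OF assms] signature_uminus)

text \<open>In a chart along a common transversal \<open>U\<close>, \<open>kashiwara_eq_sum\<close>
  displays the index as the coboundary of the signature of \<open>chart_form\<close>, which is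
  antisymmetric in its two Lagrangians; and a coboundary is a cocycle.\<close>

lemma kashiwara_cocycle:
  assumes \<Omega>: "symplectic_form \<Omega>"
    and l: "lagrangian \<Omega> A" "lagrangian \<Omega> B" "lagrangian \<Omega> C" "lagrangian \<Omega> D"
  shows "kashiwara \<Omega> A B C - kashiwara \<Omega> A B D + kashiwara \<Omega> A C D - kashiwara \<Omega> B C D = 0"
proof -
  obtain U where U: "lagrangian \<Omega> U" "\<forall>L\<in>{A, B, C, D}. U \<inter> L = {0}"
    using common_transversal_lagrangian[OF \<Omega>, of "{A, B, C, D}"] l by (metis empty_iff finite.emptyI finite.insertI insert_iff insert_not_empty)
  have t: "A \<inter> U = {0}" "B \<inter> U = {0}" "C \<inter> U = {0}" "D \<inter> U = {0}" using U by auto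
  note k = kashiwara_eq_sum[OF \<Omega> _ _ _ U(1)] and s = signature_chart_form_swap[OF \<Omega> _ _ U(1)]
  show ?thesis
    using s[OF l(1,3) t(1,3)] s[OF l(1,4) t(1,4)] s[OF l(2,4) t(2,4)]
    by (simp add: k l t)
qed

lemma kashiwara_degenerate:
  assumes \<Omega>: "symplectic_form \<Omega>" and l: "lagrangian \<Omega> A" "lagrangian \<Omega> B"
  shows "kashiwara \<Omega> A B B = 0"
proof -
  obtain U where U: "lagrangian \<Omega> U" "\<forall>L\<in>{A, B}. U \<inter> L = {0}"
    using common_transversal_lagrangian[OF \<Omega>, of "{A, B}"] l by (metis empty_iff finite.emptyI finite.insertI insert_iff insert_not_empty)
  have t: "A \<inter> U = {0}" "B \<inter> U = {0}" using U by auto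
  note s = signature_chart_form_swap[OF \<Omega> _ _ U(1)]
  show ?thesis
    using s[OF l(1,2) t(1,2)] s[OF l(2,2) t(2,2)] by (simp add: kashiwara_eq_sum[OF \<Omega> l(1,2,2) U(1) t(1,2,2)])
qed

definition kashiwara_polar :: "('b::euclidean_space \<Rightarrow> 'b \<Rightarrow> real) \<Rightarrow> 'b \<times> 'b \<times> 'b \<Rightarrow> 'b \<times> 'b \<times> 'b \<Rightarrow> real" where
  "kashiwara_polar \<Omega> p q = (\<Omega> (fst p) (fst (snd q)) + \<Omega> (fst q) (fst (snd p))
     + \<Omega> (fst (snd p)) (snd (snd q)) + \<Omega> (fst (snd q)) (snd (snd p))
     + \<Omega> (snd (snd p)) (fst q) + \<Omega> (snd (snd q)) (fst p)) / 2"

lemma symmetric_bilinear_kashiwara_polar: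
  assumes "symplectic_form \<Omega>"
  shows "symmetric_bilinear (kashiwara_polar \<Omega>)"
proof -
  note bil = symplectic_bilinear[OF assms]
  have "bilinear (kashiwara_polar \<Omega>)" unfolding bilinear_def kashiwara_polar_def
    by (intro conjI allI linearI) (simp_all add: bilinear_arith[OF bil] field_simps)
  then show ?thesis by (simp add: symmetric_bilinear_def kashiwara_polar_def)
qed

lemma kashiwara_polar_same: "kashiwara_polar \<Omega> p p = kashiwara_form \<Omega> p"
  by (simp add: kashiwara_polar_def kashiwara_form_def)

text \<open>The subspace \<open>A \<times> {0} \<times> {0}\<close> is isotropic, and on its orthogonal complement the radical contains
  \<open>A \<times> {0} \<times> {0}\<close> together with the pairwise intersections of the three Lagrangians.\<close>
lemma abs_kashiwara_le:
  fixes \<Omega> :: "'b::euclidean_space \<Rightarrow> 'b \<Rightarrow> real"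
  assumes \<Omega>: "symplectic_form \<Omega>" and l: "lagrangian \<Omega> A" "lagrangian \<Omega> B" "lagrangian \<Omega> C"
  shows "\<bar>kashiwara \<Omega> A B C\<bar> \<le> int (dim A) - int (dim (A \<inter> B)) - int (dim (B \<inter> C)) - int (dim (A \<inter> C))
     + 2 * int (dim (A \<inter> B \<inter> C))"
proof -
  note bil = symplectic_bilinear[OF \<Omega>] and sb = symmetric_bilinear_kashiwara_polar[OF \<Omega>]
  have s: "subspace A" "subspace B" "subspace C" using l lagrangian_subspace by blast+
  have d: "dim B = dim A" "dim C = dim A" "DIM('b) = 2 * dim A" using l by (auto simp: lagrangian_def)
  let ?W = "A \<times> B \<times> C"
  have sW: "subspace ?W" using s by (simp add: subspace_Times)
  \<comment> \<open>The reduction discards equally many positive and negative directions; they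
    cancel in the signature but would weaken \<open>abs_signature_le\<close>.\<close>
  define I where "I = A \<times> {0::'b} \<times> {0::'b}"
  have sI: "subspace I" unfolding I_def using s(1) by (intro subspace_Times) (simp_all add: subspace_single_0)
  have IW: "I \<subseteq> ?W" unfolding I_def using s by (auto simp: subspace_0)
  define J where "J = {w \<in> ?W. \<forall>i\<in>I. kashiwara_polar \<Omega> w i = 0}"
  have J_iff: "p \<in> J \<longleftrightarrow> p \<in> ?W \<and> fst (snd p) - snd (snd p) \<in> A" for p
  proof -
    have "kashiwara_polar \<Omega> p (a, 0, 0) = - \<Omega> (fst (snd p) - snd (snd p)) a / 2" for a
      using symplectic_skew[OF \<Omega>, of a "fst (snd p)"]
      by (simp add: kashiwara_polar_def bilinear_arith[OF bil])
    then have "(\<forall>i\<in>I. kashiwara_polar \<Omega> p i = 0) \<longleftrightarrow> (\<forall>a\<in>A. \<Omega> (fst (snd p) - snd (snd p)) a = 0)"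
      unfolding I_def by simp
    also have "\<dots> \<longleftrightarrow> fst (snd p) - snd (snd p) \<in> A"
      using lagrangian_maximal[OF \<Omega> l(1)] lagrangian_isotropic[OF l(1)] by blast
    finally show ?thesis unfolding J_def by blast
  qed
  have sJ: "subspace J" unfolding J_def
    using sb sW by (intro subspace_annihilator) (auto simp: symmetric_bilinear_def)
  have k: "kashiwara \<Omega> A B C = signature (\<lambda>p. kashiwara_polar \<Omega> p p) J"
    unfolding kashiwara_def J_def kashiwara_polar_same[symmetric]
  proof (rule signature_reduction[OF sb sW sI IW])
    fix x y assume "x \<in> I" "y \<in> I"
    then show "kashiwara_polar \<Omega> x y = 0"
      unfolding I_def kashiwara_polar_def by (auto simp: bilinear_arith[OF bil])
  qed
  \<comment> \<open>Adds up \<open>(a, 0, 0)\<close>, \<open>(0, b, 0)\<close>,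
    \<open>(0, 0, c)\<close> and \<open>(0, d, d)\<close>, with \<open>b\<close>, \<open>c\<close>,
    \<open>d\<close> from the pairwise intersections. The only redundancy is
    \<open>b = c = - d\<close> in the triple intersection.\<close>
  define h where "h p = (fst p, fst (snd p) + snd (snd (snd p)), fst (snd (snd p)) + snd (snd (snd p)))"
    for p :: "'b \<times> 'b \<times> 'b \<times> 'b"
  let ?X = "A \<times> (A \<inter> B) \<times> (A \<inter> C) \<times> (B \<inter> C)"
  have lh: "linear h" unfolding h_def by (intro linearI) (simp_all add: algebra_simps)
  have sX: "subspace ?X" using s by (simp add: subspace_Times subspace_inter)
  have hJ: "h p \<in> J" if "p \<in> ?X" for p
    using that s unfolding J_iff h_def by (auto intro: subspace_add subspace_diff)
  have hR: "h ` ?X \<subseteq> radical (kashiwara_polar \<Omega>) J"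
  proof (clarsimp simp: radical_def)
    fix a b c d assume m: "a \<in> A" "b \<in> A" "b \<in> B" "c \<in> A" "c \<in> C" "d \<in> B" "d \<in> C"
    show "h (a, b, c, d) \<in> J \<and> (\<forall>q\<in>J. kashiwara_polar \<Omega> (h (a, b, c, d)) q = 0)"
    proof (intro conjI ballI)
      show "h (a, b, c, d) \<in> J" using m by (intro hJ) auto
      fix q assume "q \<in> J"
      then obtain x y z where q: "q = (x, y, z)" "x \<in> A" "y \<in> B" "z \<in> C" "y - z \<in> A"
        by (auto simp: J_iff)
      have 0: "\<Omega> a (y - z) = 0" "\<Omega> x b = 0" "\<Omega> x c = 0" "\<Omega> b (y - z) = 0" "\<Omega> c (y - z) = 0"
         "\<Omega> b y = 0" "\<Omega> c z = 0" "\<Omega> d z = 0" "\<Omega> d y = 0"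
        using l q m by (auto intro: lagrangian_isotropic)
      then have 1: "\<Omega> a y = \<Omega> a z" "\<Omega> b z = 0" "\<Omega> c y = 0" by (auto simp: bilinear_arith[OF bil])
      have 2: "\<Omega> z a = - \<Omega> a z" "\<Omega> c x = 0" "\<Omega> y c = 0" "\<Omega> y d = 0" "\<Omega> d x = - \<Omega> x d"
        using symplectic_skew[OF \<Omega>, of z a] symplectic_skew[OF \<Omega>, of c x] symplectic_skew[OF \<Omega>, of y c]
          symplectic_skew[OF \<Omega>, of y d] symplectic_skew[OF \<Omega>, of d x] 0 1 by linarith+
      show "kashiwara_polar \<Omega> (h (a, b, c, d)) q = 0"
        unfolding kashiwara_polar_def h_def q using 0 1 2 by (simp add: bilinear_arith[OF bil])
    qed
  qed
  have "{p \<in> ?X. h p = 0} = (\<lambda>d. (0, - d, - d, d)) ` (A \<inter> B \<inter> C)"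
  proof (auto simp: h_def zero_prod_def s subspace_0 subspace_neg add_eq_0_iff2 image_iff)
    fix b c d assume "- d \<in> A" then show "d \<in> A" using s(1) subspace_neg by fastforce
  qed
  moreover have "dim ((\<lambda>d. (0::'b, - d, - d, d)) ` (A \<inter> B \<inter> C)) = dim (A \<inter> B \<inter> C)"
    by (rule dim_image_eq) (auto intro!: linearI inj_onI)
  moreover have "dim ?X = dim A + dim (A \<inter> B) + dim (A \<inter> C) + dim (B \<inter> C)"
    using s by (simp add: dim_Times subspace_Times subspace_inter)
  ultimately have dX: "dim (h ` ?X) + dim (A \<inter> B \<inter> C) = dim A + dim (A \<inter> B) + dim (A \<inter> C) + dim (B \<inter> C)"
    using rank_nullity_on[OF lh sX] by simp
  \<comment> \<open>The image of \<open>?W\<close> is \<open>A + B + C\<close>, whose symplectic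
    orthogonal is contained in the triple intersection. This bounds the kernel of \<open>e\<close>
    from above.\<close>
  define e where "e p = fst p - fst (snd p) + snd (snd p)" for p :: "'b \<times> 'b \<times> 'b"
  have le: "linear e" unfolding e_def by (intro linearI) (simp_all add: algebra_simps)
  have sr: "subspace (e ` ?W)" using le sW by (rule linear_subspace_image)
  have "{w. \<forall>x\<in>e ` ?W. \<Omega> w x = 0} \<subseteq> A \<inter> B \<inter> C"
  proof
    fix w assume w: "w \<in> {w. \<forall>x\<in>e ` ?W. \<Omega> w x = 0}"
    have "\<Omega> w x = 0" if x: "x \<in> A" for x
    proof -
      have "e (x, 0, 0) \<in> e ` ?W" using x s by (intro imageI) (auto simp: subspace_0)
      then have "\<Omega> w (e (x, 0, 0)) = 0" using w by blast
      then show ?thesis by (simp add: e_def)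
    qed
    moreover have "\<Omega> w x = 0" if x: "x \<in> C" for x
    proof -
      have "e (0, 0, x) \<in> e ` ?W" using x s by (intro imageI) (auto simp: subspace_0)
      then have "\<Omega> w (e (0, 0, x)) = 0" using w by blast
      then show ?thesis by (simp add: e_def)
    qed
    moreover have "\<Omega> w x = 0" if x: "x \<in> B" for x
    proof -
      have "e (0, - x, 0) \<in> e ` ?W" using x s by (intro imageI) (auto simp: subspace_0 subspace_neg)
      then have "\<Omega> w (e (0, - x, 0)) = 0" using w by blast
      then show ?thesis by (simp add: e_def)
    qed
    ultimately show "w \<in> A \<inter> B \<inter> C" using lagrangian_maximal[OF \<Omega>] l by blast
  qed
  then have "dim {w. \<forall>x\<in>e ` ?W. \<Omega> w x = 0} \<le> dim (A \<inter> B \<inter> C)" by (rule dim_subset)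
  then have "2 * dim A \<le> dim (e ` ?W) + dim (A \<inter> B \<inter> C)"
    using dim_symplectic_orthogonal[OF \<Omega> sr] d by linarith
  moreover have "dim ?W = 3 * dim A" using s d by (simp add: dim_Times subspace_Times)
  ultimately have dK: "dim {p \<in> ?W. e p = 0} \<le> dim A + dim (A \<inter> B \<inter> C)"
    using rank_nullity_on[OF le sW] by linarith
  \<comment> \<open>Replaces the free first component by \<open>y - z\<close>, which lies in
    \<open>A\<close> on \<open>J\<close>. The image is in the kernel of \<open>e\<close> and the
    kernel in \<open>I\<close>, which bounds \<open>dim J\<close>.\<close>
  define r where "r p = (fst (snd p) - snd (snd p), fst (snd p), snd (snd p))" for p :: "'b \<times> 'b \<times> 'b"
  have lr: "linear r" unfolding r_def by (intro linearI) (simp_all add: algebra_simps prod_eq_iff)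
  have "r ` J \<subseteq> {p \<in> ?W. e p = 0}" by (auto simp: r_def e_def J_iff)
  then have "dim (r ` J) \<le> dim A + dim (A \<inter> B \<inter> C)" using dK dim_subset order_trans by blast
  moreover have "{p \<in> J. r p = 0} \<subseteq> I" by (auto simp: r_def J_iff I_def zero_prod_def)
  then have "dim {p \<in> J. r p = 0} \<le> dim I" by (rule dim_subset)
  moreover have "dim I = dim A"
  proof -
    have "I = (\<lambda>a. (a, 0, 0)) ` A" unfolding I_def by auto
    moreover have "dim ((\<lambda>a. (a, 0::'b, 0::'b)) ` A) = dim A"
      by (rule dim_image_eq) (auto intro!: linearI inj_onI)
    ultimately show ?thesis by simp
  qed
  ultimately have dJ: "dim J \<le> 2 * dim A + dim (A \<inter> B \<inter> C)"
    using rank_nullity_on[OF lr sJ] by linarith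
  show ?thesis unfolding k using abs_signature_le[OF sb sJ hR] dX dJ by linarith
qed

section \<open>Continuous families of projections\<close>

lemma linear_expansion:
  fixes A :: "'b::euclidean_space \<Rightarrow> 'c::real_vector"
  assumes "linear A"
  shows "A z = (\<Sum>b\<in>Basis. (z \<bullet> b) *\<^sub>R A b)"
proof -
  have "A z = A (\<Sum>b\<in>Basis. (z \<bullet> b) *\<^sub>R b)" by (simp add: euclidean_representation)
  then show ?thesis using assms by (simp add: linear_sum linear_cmul)
qed

text \<open>In finite dimension convergence on a basis suffices even when the argument moves along,
  since \<open>A t z\<close> is a finite combination of the vectors \<open>A t b\<close>.\<close>

lemma tendsto_linear_family:
  fixes A :: "'t \<Rightarrow> 'b::euclidean_space \<Rightarrow> 'c::real_normed_vector"
  assumes "\<forall>\<^sub>F t in F. linear (A t)" "linear A0" "\<And>x. ((\<lambda>t. A t x) \<longlongrightarrow> A0 x) F" "(z \<longlongrightarrow> z0) F"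
  shows "((\<lambda>t. A t (z t)) \<longlongrightarrow> A0 z0) F"
proof -
  have "((\<lambda>t. \<Sum>b\<in>Basis. (z t \<bullet> b) *\<^sub>R A t b) \<longlongrightarrow> (\<Sum>b\<in>Basis. (z0 \<bullet> b) *\<^sub>R A0 b)) F"
    by (intro tendsto_intros assms)
  moreover have "\<forall>\<^sub>F t in F. (\<Sum>b\<in>Basis. (z t \<bullet> b) *\<^sub>R A t b) = A t (z t)"
    using assms(1)
  proof eventually_elim
    fix t assume "linear (A t)"
    then show "(\<Sum>b\<in>Basis. (z t \<bullet> b) *\<^sub>R A t b) = A t (z t)" using linear_expansion[of "A t" "z t"] by simp
  qed
  ultimately show ?thesis
    using linear_expansion[OF assms(2), of z0] by (simp add: tendsto_cong)
qed

text \<open>The map \<open>?G (A t y)\<close> differs from \<open>y\<close> by at most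
  \<open>d t * norm y\<close> with \<open>d t\<close> tending to 0. Once \<open>d t < 1/2\<close>,
  this forces injectivity and gives \<open>norm (inv (A t) x) \<le> 2 * norm (?G x)\<close>, so the
  inverses differ at \<open>x\<close> by at most \<open>d t * (2 * norm (?G x))\<close>.\<close>

lemma
  fixes A :: "'t \<Rightarrow> 'b::euclidean_space \<Rightarrow> 'b"
  assumes lin: "\<forall>\<^sub>F t in F. linear (A t)" and A0: "linear A0" "bij A0"
    and lim: "\<And>x. ((\<lambda>t. A t x) \<longlongrightarrow> A0 x) F"
  shows eventually_bij_linear_family: "\<forall>\<^sub>F t in F. bij (A t)"
    and tendsto_inv_linear_family: "((\<lambda>t. inv (A t) x) \<longlongrightarrow> inv A0 x) F"
proof -
  let ?G = "inv A0"
  have lG: "linear ?G" using A0 inj_linear_imp_inv_linear bij_is_inj by blast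
  have GA: "?G (A0 y) = y" for y using A0(2) by (simp add: bij_is_inj)
  define d where "d t = (\<Sum>b\<in>Basis. norm (?G (A t b) - b))" for t
  have "((\<lambda>t. ?G (A t b)) \<longlongrightarrow> ?G (A0 b)) F" for b
    using linear_continuous_at[OF linear_conv_bounded_linear[THEN iffD1, OF lG]] lim
    by (rule isCont_tendsto_compose)
  then have "(d \<longlongrightarrow> (\<Sum>b\<in>(Basis::'b set). norm (b - b))) F"
    unfolding d_def GA by (intro tendsto_intros) auto
  then have d0: "(d \<longlongrightarrow> 0) F" by simp
  have "\<forall>\<^sub>F t in F. d t < 1/2" using order_tendstoD(2)[OF d0, of "1/2"] by simp
  then have ev: "\<forall>\<^sub>F t in F. linear (A t) \<and> bij (A t) \<and> d t < 1/2 \<and> (\<forall>y. norm (?G (A t y) - y) \<le> d t * norm y)"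
    using lin
  proof eventually_elim
    fix t assume t: "d t < 1/2" "linear (A t)"
    have bound: "norm (?G (A t y) - y) \<le> d t * norm y" for y
    proof -
      have lT: "linear (\<lambda>y. ?G (A t y) - y)"
        using linear_compose[OF t(2) lG] by (intro linear_compose_sub) (auto simp: comp_def linear_ident)
      have "norm (?G (A t y) - y) \<le> (\<Sum>b\<in>Basis. \<bar>y \<bullet> b\<bar> * norm (?G (A t b) - b))"
        using linear_expansion[OF lT, of y] norm_sum[of "\<lambda>b. (y \<bullet> b) *\<^sub>R (?G (A t b) - b)" Basis] by simp
      also have "\<dots> \<le> (\<Sum>b\<in>Basis. norm y * norm (?G (A t b) - b))"
        by (intro sum_mono mult_right_mono) (auto simp: Basis_le_norm)
      finally show ?thesis by (simp add: d_def sum_distrib_left mult.commute)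
    qed
    have "inj (A t)"
      unfolding linear_injective_0[OF t(2)]
    proof (intro allI impI)
      fix y assume "A t y = 0"
      then have "norm y \<le> d t * norm y" using bound[of y] lG by (simp add: linear_0)
      moreover have "d t * norm y \<le> (1/2) * norm y" using t(1) by (intro mult_right_mono) auto
      ultimately have "norm y \<le> 0" by linarith
      then show "y = 0" by simp
    qed
    then have "bij (A t)" using t(2) linear_injective_imp_surjective by (auto simp: bij_def)
    then show "linear (A t) \<and> bij (A t) \<and> d t < 1/2 \<and> (\<forall>y. norm (?G (A t y) - y) \<le> d t * norm y)"
      using t bound by blast
  qed
  then show "\<forall>\<^sub>F t in F. bij (A t)" by eventually_elim blast
  have "\<forall>\<^sub>F t in F. norm (inv (A t) x - ?G x) \<le> d t * (2 * norm (?G x))"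
    using ev
  proof eventually_elim
    fix t assume t: "linear (A t) \<and> bij (A t) \<and> d t < 1/2 \<and> (\<forall>y. norm (?G (A t y) - y) \<le> d t * norm y)"
    let ?y = "inv (A t) x"
    have "A t ?y = x" using t by (simp add: bij_is_surj surj_f_inv_f)
    then have b: "norm (?G x - ?y) \<le> d t * norm ?y" using t by metis
    have d0: "0 \<le> d t" unfolding d_def by (simp add: sum_nonneg)
    have "norm ?y \<le> norm (?G x) + norm (?G x - ?y)" by (metis norm_triangle_sub norm_minus_commute)
    also have "\<dots> \<le> norm (?G x) + (1/2) * norm ?y" using b t mult_right_mono[of "d t" "1/2" "norm ?y"] by simp
    finally have "norm ?y \<le> 2 * norm (?G x)" by simp
    then have "d t * norm ?y \<le> d t * (2 * norm (?G x))" using d0 by (rule mult_left_mono)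
    then show "norm (?y - ?G x) \<le> d t * (2 * norm (?G x))" using b by (simp add: norm_minus_commute)
  qed
  moreover have "((\<lambda>t. d t * (2 * norm (?G x))) \<longlongrightarrow> 0) F" using tendsto_mult_left_zero[OF d0] by simp
  ultimately have "((\<lambda>t. inv (A t) x - ?G x) \<longlongrightarrow> 0) F" by (rule Lim_null_comparison)
  then show "((\<lambda>t. inv (A t) x) \<longlongrightarrow> inv A0 x) F" by (simp add: LIM_zero_iff)
qed

text \<open>As a limit along a filter, a derivative is open to the limit rules for linear families,
  and it is vacuous when the filter is trivial.\<close>

lemma has_vector_derivative_iff_quotient:
  "(f has_vector_derivative f') (at x within S) \<longleftrightarrow>
     ((\<lambda>y. (1 / (y - x)) *\<^sub>R (f y - f x)) \<longlongrightarrow> f') (at x within S)"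
proof -
  have "norm (f y - f x - (y - x) *\<^sub>R f') / norm (y - x) = norm ((1 / (y - x)) *\<^sub>R (f y - f x) - f')"
    if "y \<noteq> x" for y
  proof -
    have "(1 / (y - x)) *\<^sub>R (f y - f x) - f' = (1 / (y - x)) *\<^sub>R (f y - f x - (y - x) *\<^sub>R f')"
      using that by (simp add: scaleR_diff_right)
    then show ?thesis by (simp add: divide_inverse_commute abs_inverse)
  qed
  then have "\<forall>\<^sub>F y in at x within S. norm (f y - f x - (y - x) *\<^sub>R f') / norm (y - x)
      = norm ((1 / (y - x)) *\<^sub>R (f y - f x) - f')"
    by (auto simp: eventually_at_filter)
  then have "((\<lambda>y. norm (f y - f x - (y - x) *\<^sub>R f') / norm (y - x)) \<longlongrightarrow> 0) (at x within S)
     \<longleftrightarrow> ((\<lambda>y. norm ((1 / (y - x)) *\<^sub>R (f y - f x) - f')) \<longlongrightarrow> 0) (at x within S)"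
    by (rule tendsto_cong)
  then show ?thesis
    unfolding has_vector_derivative_def has_derivative_iff_norm
    by (simp add: bounded_linear_scaleR_left tendsto_norm_zero_iff LIM_zero_iff)
qed

lemma tendsto_of_has_vector_derivative:
  "(f has_vector_derivative f') (at x within S) \<Longrightarrow> (f \<longlongrightarrow> f x) (at x within S)"
  using has_vector_derivative_continuous continuous_within by blast

lemma has_vector_derivative_linear_family:
  fixes A :: "real \<Rightarrow> 'b::euclidean_space \<Rightarrow> 'c::real_normed_vector"
  assumes lin: "\<forall>\<^sub>F s in at t within S. linear (A s)" "linear (A t)"
    and A: "\<And>x. ((\<lambda>s. A s x) has_vector_derivative A' x) (at t within S)"
    and z: "(z has_vector_derivative z') (at t within S)"
  shows "((\<lambda>s. A s (z s)) has_vector_derivative A t z' + A' (z t)) (at t within S)"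
proof -
  have "((\<lambda>s. A s ((1 / (s - t)) *\<^sub>R (z s - z t)) + (1 / (s - t)) *\<^sub>R (A s (z t) - A t (z t)))
     \<longlongrightarrow> A t z' + A' (z t)) (at t within S)"
    by (rule tendsto_add[OF tendsto_linear_family[OF lin tendsto_of_has_vector_derivative[OF A]
            z[unfolded has_vector_derivative_iff_quotient]] A[unfolded has_vector_derivative_iff_quotient]])
  moreover have "\<forall>\<^sub>F s in at t within S. A s ((1 / (s - t)) *\<^sub>R (z s - z t)) + (1 / (s - t)) *\<^sub>R (A s (z t) - A t (z t))
     = (1 / (s - t)) *\<^sub>R (A s (z s) - A t (z t))"
    using lin(1)
  proof eventually_elim
    fix s assume "linear (A s)"
    then show "A s ((1 / (s - t)) *\<^sub>R (z s - z t)) + (1 / (s - t)) *\<^sub>R (A s (z t) - A t (z t))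
     = (1 / (s - t)) *\<^sub>R (A s (z s) - A t (z t))"
      by (simp add: linear_cmul linear_diff scaleR_diff_right)
  qed
  ultimately show ?thesis unfolding has_vector_derivative_iff_quotient by (rule Lim_transform_eventually)
qed

text \<open>Divide \<open>inv (A s) - inv (A t) = - inv (A s) (A s - A t) (inv (A t))\<close> by
  \<open>s - t\<close>, read as an identity of compositions.\<close>

lemma has_vector_derivative_inv_linear_family:
  fixes A :: "real \<Rightarrow> 'b::euclidean_space \<Rightarrow> 'b"
  assumes lin: "\<forall>\<^sub>F s in at t within S. linear (A s)" "linear (A t)" "bij (A t)"
    and A: "\<And>x. ((\<lambda>s. A s x) has_vector_derivative A' x) (at t within S)"
  shows "((\<lambda>s. inv (A s) x) has_vector_derivative - inv (A t) (A' (inv (A t) x))) (at t within S)"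
proof -
  have lim: "\<And>x. ((\<lambda>s. A s x) \<longlongrightarrow> A t x) (at t within S)"
    using tendsto_of_has_vector_derivative[OF A] .
  have bij: "\<forall>\<^sub>F s in at t within S. bij (A s)" by (rule eventually_bij_linear_family[OF lin lim])
  have linv: "\<forall>\<^sub>F s in at t within S. linear (inv (A s))"
    using bij lin(1) by eventually_elim (meson bij_is_inj inj_linear_imp_inv_linear)
  have linv0: "linear (inv (A t))" using lin by (meson bij_is_inj inj_linear_imp_inv_linear)
  let ?y = "inv (A t) x"
  have "((\<lambda>s. - inv (A s) ((1 / (s - t)) *\<^sub>R (A s ?y - A t ?y))) \<longlongrightarrow> - inv (A t) (A' ?y)) (at t within S)"
    by (rule tendsto_minus[OF tendsto_linear_family[OF linv linv0 tendsto_inv_linear_family[OF lin lim]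
            A[unfolded has_vector_derivative_iff_quotient]]])
  moreover have "\<forall>\<^sub>F s in at t within S. - inv (A s) ((1 / (s - t)) *\<^sub>R (A s ?y - A t ?y))
      = (1 / (s - t)) *\<^sub>R (inv (A s) x - inv (A t) x)"
    using bij linv
  proof eventually_elim
    fix s assume s: "bij (A s)" "linear (inv (A s))"
    have "A t ?y = x" using lin(3) by (simp add: bij_is_surj surj_f_inv_f)
    moreover have "inv (A s) (A s ?y) = ?y" using s by (simp add: bij_is_inj)
    ultimately show "- inv (A s) ((1 / (s - t)) *\<^sub>R (A s ?y - A t ?y))
      = (1 / (s - t)) *\<^sub>R (inv (A s) x - inv (A t) x)"
      using s by (simp add: linear_cmul linear_diff scaleR_diff_right)
  qed
  ultimately show ?thesis unfolding has_vector_derivative_iff_quotient by (rule Lim_transform_eventually)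
qed

lemma linear_derivative_of_linear_family:
  fixes A :: "real \<Rightarrow> 'b::euclidean_space \<Rightarrow> 'c::real_normed_vector"
  assumes nb: "at t within S \<noteq> bot" and lin: "\<forall>\<^sub>F s in at t within S. linear (A s)" "linear (A t)"
    and A: "\<And>x. ((\<lambda>s. A s x) has_vector_derivative A' x) (at t within S)"
  shows "linear A'"
proof (rule linearI)
  fix x y and r :: real
  note q = A[unfolded has_vector_derivative_iff_quotient]
  show "A' (x + y) = A' x + A' y"
  proof (rule tendsto_unique[OF nb q])
    show "((\<lambda>s. (1 / (s - t)) *\<^sub>R (A s (x + y) - A t (x + y))) \<longlongrightarrow> A' x + A' y) (at t within S)"
    proof (rule Lim_transform_eventually[OF tendsto_add[OF q q]])
      show "\<forall>\<^sub>F s in at t within S. (1 / (s - t)) *\<^sub>R (A s x - A t x) + (1 / (s - t)) *\<^sub>R (A s y - A t y)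
         = (1 / (s - t)) *\<^sub>R (A s (x + y) - A t (x + y))"
        using lin(1) by eventually_elim (simp add: linear_add lin(2) algebra_simps)
    qed
  qed
  show "A' (r *\<^sub>R x) = r *\<^sub>R A' x"
  proof (rule tendsto_unique[OF nb q])
    show "((\<lambda>s. (1 / (s - t)) *\<^sub>R (A s (r *\<^sub>R x) - A t (r *\<^sub>R x))) \<longlongrightarrow> r *\<^sub>R A' x) (at t within S)"
    proof (rule Lim_transform_eventually[OF tendsto_scaleR[OF tendsto_const q]])
      show "\<forall>\<^sub>F s in at t within S. r *\<^sub>R ((1 / (s - t)) *\<^sub>R (A s x - A t x))
         = (1 / (s - t)) *\<^sub>R (A s (r *\<^sub>R x) - A t (r *\<^sub>R x))"
        using lin(1) by eventually_elim (simp add: linear_cmul lin(2) algebra_simps)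
    qed
  qed
qed

section \<open>Orthogonal projections expressed through idempotents\<close>

definition transposed :: "('b::euclidean_space \<Rightarrow> 'b) \<Rightarrow> 'b \<Rightarrow> 'b" where
  "transposed E x = (\<Sum>b\<in>Basis. (x \<bullet> E b) *\<^sub>R b)"

lemma inner_transposed: "linear E \<Longrightarrow> transposed E x \<bullet> y = x \<bullet> E y"
  using linear_expansion[of E y]
  by (simp add: transposed_def inner_sum_left inner_sum_right inner_commute mult.commute)

lemma linear_transposed: "linear (transposed E)"
  unfolding transposed_def
  by (intro linearI) (simp_all add: inner_add_left scaleR_add_left sum.distrib scaleR_sum_right)

lemma complementary_orthogonal:
  fixes L :: "'b::euclidean_space set"
  assumes "subspace L"
  shows "complementary L {y. \<forall>x\<in>L. orthogonal x y}"
proof -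
  have "subspace {y. \<forall>x\<in>L. orthogonal x y}" by (auto simp: subspace_def orthogonal_def inner_right_distrib)
  moreover have "L \<inter> {y. \<forall>x\<in>L. orthogonal x y} = {0}"
    using assms by (auto simp: orthogonal_def subspace_0)
  ultimately show ?thesis
    using dim_subspace_orthogonal_to_vectors[OF assms subspace_UNIV] assms
    by (simp add: complementary_def add.commute)
qed

lemma proj_eq_oblique: "proj L = oblique L {y. \<forall>x\<in>L. orthogonal x y}"
  by (rule ext) (simp add: proj_def oblique_def orthogonal_def inner_commute)

lemma
  assumes "subspace L"
  shows linear_proj: "linear (proj L)" and proj_in: "proj L x \<in> L"
    and proj_id: "x \<in> L \<Longrightarrow> proj L x = x"
    and proj_unique: "y \<in> L \<Longrightarrow> (\<And>z. z \<in> L \<Longrightarrow> (x - y) \<bullet> z = 0) \<Longrightarrow> proj L x = y"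
  unfolding proj_eq_oblique using complementary_orthogonal[OF assms]
  by (auto simp: linear_oblique oblique_in oblique_id orthogonal_def inner_commute intro!: oblique_unique)

definition idempotent :: "('b::euclidean_space \<Rightarrow> 'b) \<Rightarrow> bool" where
  "idempotent E \<longleftrightarrow> linear E \<and> (\<forall>x. E (E x) = E x)"

definition proj_corrector :: "('b::euclidean_space \<Rightarrow> 'b) \<Rightarrow> 'b \<Rightarrow> 'b" where
  "proj_corrector E x = x + E x - transposed E x"

text \<open>The orthogonal projection onto the range of an idempotent \<open>E\<close> is \<open>E (1 + E - E\<^sup>T)\<^sup>-\<^sup>1\<close>; the
  inverse exists because \<open>E - E\<^sup>T\<close> is skew.\<close>
lemma
  assumes E: "linear E"
  shows linear_proj_corrector: "linear (proj_corrector E)" and bij_proj_corrector: "bij (proj_corrector E)"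
proof -
  show l: "linear (proj_corrector E)" unfolding proj_corrector_def
    by (intro linear_compose_sub linear_compose_add linear_transposed E) (simp add: linear_ident)
  have "x = 0" if "proj_corrector E x = 0" for x
  proof -
    have "proj_corrector E x \<bullet> x = x \<bullet> x"
      unfolding proj_corrector_def using inner_transposed[OF E, of x x]
      by (simp add: inner_add_left inner_diff_left inner_commute[of "E x"])
    then show ?thesis using that by simp
  qed
  then have "inj (proj_corrector E)" using linear_injective_0[OF l] by blast
  then show "bij (proj_corrector E)" using l linear_injective_imp_surjective by (auto simp: bij_def)
qed

lemma proj_range_idempotent:
  assumes E: "idempotent E"
  shows "proj (range E) x = E (inv (proj_corrector E) x)"
proof -
  have lE: "linear E" using E by (simp add: idempotent_def)
  let ?y = "inv (proj_corrector E) x"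
  have x: "x = proj_corrector E ?y" using bij_proj_corrector[OF lE] by (simp add: bij_is_surj surj_f_inv_f)
  have s: "subspace (range E)" using linear_subspace_image[OF lE subspace_UNIV] .
  show ?thesis
  proof (rule proj_unique[OF s])
    fix z assume "z \<in> range E"
    then obtain w where w: "z = E w" by blast
    have "(x - E ?y) \<bullet> z = (?y - transposed E ?y) \<bullet> E w"
      unfolding w by (subst x) (simp add: proj_corrector_def)
    also have "\<dots> = 0"
      using inner_transposed[OF lE, of ?y "E w"] E by (simp add: inner_diff_left idempotent_def)
    finally show "(x - E ?y) \<bullet> z = 0" .
  qed simp
qed

lemma tendsto_transposed:
  assumes "\<And>x. ((\<lambda>t. E t x) \<longlongrightarrow> E0 x) F"
  shows "((\<lambda>t. transposed (E t) x) \<longlongrightarrow> transposed E0 x) F"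
  unfolding transposed_def by (intro tendsto_intros assms)

lemma tendsto_proj_corrector:
  assumes "\<And>x. ((\<lambda>t. E t x) \<longlongrightarrow> E0 x) F"
  shows "((\<lambda>t. proj_corrector (E t) x) \<longlongrightarrow> proj_corrector E0 x) F"
  unfolding proj_corrector_def by (intro tendsto_intros tendsto_transposed assms)

lemma tendsto_inv_proj_corrector:
  assumes E: "\<forall>\<^sub>F t in F. linear (E t)" "linear E0" and lim: "\<And>x. ((\<lambda>t. E t x) \<longlongrightarrow> E0 x) F"
  shows "((\<lambda>t. inv (proj_corrector (E t)) x) \<longlongrightarrow> inv (proj_corrector E0) x) F"
proof (rule tendsto_inv_linear_family)
  show "\<forall>\<^sub>F t in F. linear (proj_corrector (E t))" using E(1) by eventually_elim (rule linear_proj_corrector)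
qed (use E linear_proj_corrector bij_proj_corrector tendsto_proj_corrector[OF lim] in auto)

lemma tendsto_proj_range:
  assumes E: "\<forall>\<^sub>F t in F. idempotent (E t)" "idempotent E0" and lim: "\<And>x. ((\<lambda>t. E t x) \<longlongrightarrow> E0 x) F"
  shows "((\<lambda>t. proj (range (E t)) x) \<longlongrightarrow> proj (range E0) x) F"
proof -
  have lin: "\<forall>\<^sub>F t in F. linear (E t)" "linear E0"
    using E by (auto simp: idempotent_def elim: eventually_mono)
  have "((\<lambda>t. E t (inv (proj_corrector (E t)) x)) \<longlongrightarrow> E0 (inv (proj_corrector E0) x)) F"
    by (rule tendsto_linear_family[OF lin lim tendsto_inv_proj_corrector[OF lin lim]])
  then show ?thesis
    unfolding proj_range_idempotent[OF E(2)]
    by (rule Lim_transform_eventually) (use E(1) in \<open>auto simp: proj_range_idempotent elim: eventually_mono\<close>)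
qed

text \<open>Product and inverse rule applied to \<open>E (inv (proj_corrector E) x)\<close>. The
  closed form shows continuity in \<open>E\<close> and \<open>E'\<close>, and that a vanishing
  \<open>E'\<close> gives velocity 0, which is what allows paths to be joined.\<close>

definition proj_derivative :: "('b::euclidean_space \<Rightarrow> 'b) \<Rightarrow> ('b \<Rightarrow> 'b) \<Rightarrow> 'b \<Rightarrow> 'b" where
  "proj_derivative E E' x =
     E (- inv (proj_corrector E) (E' (inv (proj_corrector E) x) - transposed E' (inv (proj_corrector E) x)))
     + E' (inv (proj_corrector E) x)"

lemma has_vector_derivative_proj_range:
  assumes E: "\<And>s. s \<in> S \<Longrightarrow> idempotent (E s)" and t: "t \<in> S"
    and D: "\<And>x. ((\<lambda>s. E s x) has_vector_derivative E' x) (at t within S)"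
  shows "((\<lambda>s. proj (range (E s)) x) has_vector_derivative proj_derivative (E t) E' x) (at t within S)"
proof -
  have lE: "linear (E s)" if "s \<in> S" for s using E[OF that] by (simp add: idempotent_def)
  have ev: "\<forall>\<^sub>F s in at t within S. linear (E s)" using lE by (auto simp: eventually_at_filter)
  have ev': "\<forall>\<^sub>F s in at t within S. linear (proj_corrector (E s))"
    using ev by eventually_elim (rule linear_proj_corrector)
  have "((\<lambda>s. x \<bullet> E s b) has_vector_derivative x \<bullet> E' b) (at t within S)" for x b
    using bounded_linear.has_vector_derivative[OF bounded_linear_inner_right D] .
  then have "((\<lambda>s. transposed (E s) x) has_vector_derivative transposed E' x) (at t within S)" for x
    unfolding transposed_def
    by (intro has_vector_derivative_sum bounded_linear.has_vector_derivative[OF bounded_linear_scaleR_left]) auto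
  then have "((\<lambda>s. proj_corrector (E s) x) has_vector_derivative E' x - transposed E' x) (at t within S)" for x
    unfolding proj_corrector_def using D by (auto intro!: derivative_eq_intros)
  then have "((\<lambda>s. inv (proj_corrector (E s)) x) has_vector_derivative
      - inv (proj_corrector (E t)) (E' (inv (proj_corrector (E t)) x) - transposed E' (inv (proj_corrector (E t)) x)))
      (at t within S)"
    by (intro has_vector_derivative_inv_linear_family[OF ev' linear_proj_corrector[OF lE[OF t]] bij_proj_corrector[OF lE[OF t]]])
  then have "((\<lambda>s. E s (inv (proj_corrector (E s)) x)) has_vector_derivative proj_derivative (E t) E' x) (at t within S)"
    unfolding proj_derivative_def by (rule has_vector_derivative_linear_family[OF ev lE[OF t] D])
  then show ?thesis
    by (rule has_vector_derivative_transform[rotated 2]) (use E t in \<open>auto simp: proj_range_idempotent\<close>)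
qed

lemma continuous_on_proj_derivative:
  assumes E: "\<And>s. s \<in> S \<Longrightarrow> linear (E s)" "\<And>s. s \<in> S \<Longrightarrow> linear (E' s)"
    and c: "\<And>x. continuous_on S (\<lambda>s. E s x)" "\<And>x. continuous_on S (\<lambda>s. E' s x)"
  shows "continuous_on S (\<lambda>s. proj_derivative (E s) (E' s) x)"
  unfolding continuous_on_def
proof
  fix t assume t: "t \<in> S"
  have lim: "\<And>x. ((\<lambda>s. E s x) \<longlongrightarrow> E t x) (at t within S)" "\<And>x. ((\<lambda>s. E' s x) \<longlongrightarrow> E' t x) (at t within S)"
    using c t by (auto simp: continuous_on_def)
  have ev: "\<forall>\<^sub>F s in at t within S. linear (E s)" "\<forall>\<^sub>F s in at t within S. linear (E' s)"
    using E by (auto simp: eventually_at_filter)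
  have evM: "\<forall>\<^sub>F s in at t within S. linear (inv (proj_corrector (E s)))"
    using ev(1) by eventually_elim (meson bij_is_inj bij_proj_corrector inj_linear_imp_inv_linear linear_proj_corrector)
  have lM: "linear (inv (proj_corrector (E t)))"
    using E(1)[OF t] by (meson bij_is_inj bij_proj_corrector inj_linear_imp_inv_linear linear_proj_corrector)
  note M = tendsto_inv_proj_corrector[OF ev(1) E(1)[OF t] lim(1)]
  note f = tendsto_linear_family
  show "((\<lambda>s. proj_derivative (E s) (E' s) x) \<longlongrightarrow> proj_derivative (E t) (E' t) x) (at t within S)"
    unfolding proj_derivative_def
    by (rule tendsto_add[OF f[OF ev(1) E(1)[OF t] lim(1) tendsto_minus[OF f[OF evM lM M
          tendsto_diff[OF f[OF ev(2) E(2)[OF t] lim(2) M]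
            f[OF always_eventually[OF allI[OF linear_transposed]] linear_transposed tendsto_transposed[OF lim(2)] M]]]]]
          f[OF ev(2) E(2)[OF t] lim(2) M]])
qed

text \<open>If \<open>P\<^sub>t\<close>, \<open>Q\<^sub>t\<close> are the orthogonal projections onto \<open>L\<^sub>t\<close>, \<open>U\<^sub>t\<close> and \<open>\<pi>\<close> is the oblique projection at
  the base point, then \<open>T = P \<pi> + Q (1 - \<pi>)\<close> is close to the identity and moves \<open>(L, U)\<close> to
  \<open>(L\<^sub>t, U\<^sub>t)\<close>, so the oblique projections are conjugate by \<open>T\<close>.\<close>
definition chart_mover :: "('b::euclidean_space \<Rightarrow> 'b) \<Rightarrow> 'b set \<Rightarrow> 'b set \<Rightarrow> 'b \<Rightarrow> 'b" where
  "chart_mover \<pi> L U x = proj L (\<pi> x) + proj U (x - \<pi> x)"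

lemma linear_chart_mover: "linear \<pi> \<Longrightarrow> subspace L \<Longrightarrow> subspace U \<Longrightarrow> linear (chart_mover \<pi> L U)"
  unfolding chart_mover_def
  by (intro linearI) (simp_all add: linear_add linear_cmul linear_diff linear_proj algebra_simps)

lemma chart_mover_id:
  assumes "complementary L U" shows "chart_mover (oblique L U) L U x = x"
  using assms oblique_in[OF assms] oblique_diff_in[OF assms]
  by (simp add: chart_mover_def proj_id complementary_def)

lemma
  assumes c: "complementary L0 U0" and L: "subspace L" "dim L = dim L0" and U: "subspace U" "dim U = dim U0"
    and b: "bij (chart_mover (oblique L0 U0) L U)"
  shows complementary_of_bij_chart_mover: "complementary L U"
    and oblique_chart_mover: "oblique L U x
      = chart_mover (oblique L0 U0) L U (oblique L0 U0 (inv (chart_mover (oblique L0 U0) L U) x))"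
proof -
  let ?T = "chart_mover (oblique L0 U0) L U"
  have lT: "linear ?T" using linear_chart_mover[OF linear_oblique[OF c] L(1) U(1)] .
  have inj: "inj_on ?T X" for X using b by (meson bij_is_inj inj_on_subset subset_UNIV)
  have s: "subspace L0" "subspace U0" using c by (auto simp: complementary_def)
  have "?T ` L0 = L"
  proof (rule subspace_dim_equal[OF linear_subspace_image[OF lT s(1)] L(1)])
    show "?T ` L0 \<subseteq> L"
      using c L U by (auto simp: chart_mover_def oblique_id proj_in linear_0 linear_proj)
    show "dim L \<le> dim (?T ` L0)" using dim_image_eq[OF lT inj, of L0] L by simp
  qed
  moreover have "?T ` U0 = U"
  proof (rule subspace_dim_equal[OF linear_subspace_image[OF lT s(2)] U(1)])
    show "?T ` U0 \<subseteq> U"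
      using c L U by (auto simp: chart_mover_def oblique_zero proj_in linear_0 linear_proj)
    show "dim U \<le> dim (?T ` U0)" using dim_image_eq[OF lT inj, of U0] U by simp
  qed
  ultimately show "complementary L U" "oblique L U x = ?T (oblique L0 U0 (inv ?T x))"
    using complementary_image[OF lT b c] oblique_image[OF lT b c, of "inv ?T x"] b
    by (simp_all add: bij_is_surj surj_f_inv_f)
qed

lemma
  fixes L U :: "'t \<Rightarrow> 'b::euclidean_space set"
  assumes c: "complementary L0 U0"
    and L: "\<forall>\<^sub>F t in F. subspace (L t) \<and> dim (L t) = dim L0" and U: "\<forall>\<^sub>F t in F. subspace (U t) \<and> dim (U t) = dim U0"
    and lim: "\<And>x. ((\<lambda>t. proj (L t) x) \<longlongrightarrow> proj L0 x) F" "\<And>x. ((\<lambda>t. proj (U t) x) \<longlongrightarrow> proj U0 x) F"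
  shows eventually_complementary: "\<forall>\<^sub>F t in F. complementary (L t) (U t)"
    and tendsto_oblique: "((\<lambda>t. oblique (L t) (U t) x) \<longlongrightarrow> oblique L0 U0 x) F"
proof -
  let ?p = "oblique L0 U0"
  let ?T = "\<lambda>t. chart_mover ?p (L t) (U t)"
  have lp: "linear ?p" using linear_oblique[OF c] .
  have s: "subspace L0" "subspace U0" using c by (auto simp: complementary_def)
  have lin: "\<forall>\<^sub>F t in F. linear (?T t)"
    using L U by eventually_elim (auto intro: linear_chart_mover lp)
  have limT: "((\<lambda>t. ?T t x) \<longlongrightarrow> x) F" for x
  proof -
    have "((\<lambda>t. ?T t x) \<longlongrightarrow> chart_mover ?p L0 U0 x) F"
      unfolding chart_mover_def by (intro tendsto_add lim)
    then show ?thesis using chart_mover_id[OF c] by simp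
  qed
  have idl: "linear (\<lambda>x::'b. x)" by (simp add: linear_ident)
  have idb: "bij (\<lambda>x::'b. x)" by (simp add: bij_id[unfolded id_def])
  have bij: "\<forall>\<^sub>F t in F. bij (?T t)" by (rule eventually_bij_linear_family[OF lin idl idb limT])
  show "\<forall>\<^sub>F t in F. complementary (L t) (U t)"
    using bij L U by eventually_elim (auto intro: complementary_of_bij_chart_mover[OF c])
  have "((\<lambda>t. inv (?T t) x) \<longlongrightarrow> inv (\<lambda>x. x) x) F" by (rule tendsto_inv_linear_family[OF lin idl idb limT])
  then have i: "((\<lambda>t. inv (?T t) x) \<longlongrightarrow> x) F" by (simp add: inv_id[unfolded id_def])
  have "((\<lambda>t. ?p (inv (?T t) x)) \<longlongrightarrow> ?p x) F"
    using linear_continuous_at[OF linear_conv_bounded_linear[THEN iffD1, OF lp]] i by (rule isCont_tendsto_compose)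
  then have "((\<lambda>t. ?T t (?p (inv (?T t) x))) \<longlongrightarrow> ?p x) F" by (rule tendsto_linear_family[OF lin idl limT])
  then show "((\<lambda>t. oblique (L t) (U t) x) \<longlongrightarrow> oblique L0 U0 x) F"
  proof (rule Lim_transform_eventually)
    show "\<forall>\<^sub>F t in F. ?T t (?p (inv (?T t) x)) = oblique (L t) (U t) x"
      using bij L U
    proof eventually_elim
      fix t assume "bij (?T t)" "subspace (L t) \<and> dim (L t) = dim L0" "subspace (U t) \<and> dim (U t) = dim U0"
      then show "?T t (?p (inv (?T t) x)) = oblique (L t) (U t) x"
        using oblique_chart_mover[OF c, of "L t" "U t" x] by simp
    qed
  qed
qed

text \<open>Carries differentiability from \<open>proj\<close>, by which continuously differentiable
  paths are defined, to the chart coordinate \<open>oblique\<close>, in which crossings are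
  computed: differentiate the conjugation formula \<open>oblique_chart_mover\<close>, whose mover is
  the identity at \<open>t\<close>.\<close>

lemma has_vector_derivative_oblique:
  fixes L :: "real \<Rightarrow> 'b::euclidean_space set"
  assumes c: "complementary (L t) U" and t: "t \<in> S"
    and L: "\<And>s. s \<in> S \<Longrightarrow> subspace (L s) \<and> dim (L s) = dim (L t)"
    and D: "\<And>x. ((\<lambda>s. proj (L s) x) has_vector_derivative P' x) (at t within S)"
  shows "\<exists>E'. \<forall>x. ((\<lambda>s. oblique (L s) U x) has_vector_derivative E' x) (at t within S)"
proof -
  let ?p = "oblique (L t) U"
  let ?T = "\<lambda>s. chart_mover ?p (L s) U"
  have lp: "linear ?p" using linear_oblique[OF c] .
  have sU: "subspace U" using c by (auto simp: complementary_def)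
  have ev: "\<forall>\<^sub>F s in at t within S. s \<in> S" by (auto simp: eventually_at_filter)
  have lin: "\<forall>\<^sub>F s in at t within S. linear (?T s)"
    using ev by eventually_elim (use L in \<open>auto intro: linear_chart_mover lp sU\<close>)
  have Tt: "?T t = (\<lambda>x. x)" using chart_mover_id[OF c] by (simp add: fun_eq_iff)
  have lTt: "linear (?T t)" "bij (?T t)" unfolding Tt by (simp_all add: linear_ident bij_id[unfolded id_def])
  have DT: "((\<lambda>s. ?T s x) has_vector_derivative P' (?p x) + 0) (at t within S)" for x
    unfolding chart_mover_def by (intro has_vector_derivative_add D has_vector_derivative_const)
  have limT: "((\<lambda>s. ?T s x) \<longlongrightarrow> ?T t x) (at t within S)" for x using tendsto_of_has_vector_derivative[OF DT] .
  have bij: "\<forall>\<^sub>F s in at t within S. bij (?T s)" by (rule eventually_bij_linear_family[OF lin lTt limT])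
  have "\<exists>v. ((\<lambda>s. oblique (L s) U x) has_vector_derivative v) (at t within S)" for x
  proof -
    obtain g where g: "((\<lambda>s. inv (?T s) x) has_vector_derivative g) (at t within S)"
      using has_vector_derivative_inv_linear_family[OF lin lTt DT] by blast
    have "((\<lambda>s. ?p (inv (?T s) x)) has_vector_derivative ?p g) (at t within S)"
      using bounded_linear.has_vector_derivative[OF linear_conv_bounded_linear[THEN iffD1, OF lp] g] .
    from has_vector_derivative_linear_family[OF lin lTt(1) DT this]
    obtain v where v: "((\<lambda>s. ?T s (?p (inv (?T s) x))) has_vector_derivative v) (at t within S)" by blast
    have "\<forall>\<^sub>F s in at t within S. ?T s (?p (inv (?T s) x)) = oblique (L s) U x"
      using bij ev
    proof eventually_elim
      fix s assume "bij (?T s)" "s \<in> S"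
      then show "?T s (?p (inv (?T s) x)) = oblique (L s) U x"
        using oblique_chart_mover[OF c, of "L s" U x] L sU by simp
    qed
    moreover have "?T t (?p (inv (?T t) x)) = oblique (L t) U x"
      unfolding Tt by (simp add: inv_id[unfolded id_def])
    ultimately have "((\<lambda>s. oblique (L s) U x) has_vector_derivative v) (at t within S)"
      using v unfolding has_vector_derivative_iff_quotient
      by (elim Lim_transform_eventually) (auto elim: eventually_mono)
    then show ?thesis by blast
  qed
  then show ?thesis by metis
qed

section \<open>Maslov potentials\<close>

text \<open>The notion \<open>lagr_path\<close> over an arbitrary parameter space, so that
  homotopies over a rectangle are covered as well.\<close>

definition lagrangian_family ::
  "('b::euclidean_space \<Rightarrow> 'b \<Rightarrow> real) \<Rightarrow> 't::topological_space set \<Rightarrow> ('t \<Rightarrow> 'b set) \<Rightarrow> bool" where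
  "lagrangian_family \<Omega> K l \<longleftrightarrow> (\<forall>x\<in>K. lagrangian \<Omega> (l x)) \<and> (\<forall>v. continuous_on K (\<lambda>x. proj (l x) v))"

lemma lagrangian_family_subset: "lagrangian_family \<Omega> K l \<Longrightarrow> C \<subseteq> K \<Longrightarrow> lagrangian_family \<Omega> C l"
  unfolding lagrangian_family_def by (meson continuous_on_subset subsetD)

lemma
  fixes \<Omega> :: "'b::euclidean_space \<Rightarrow> 'b \<Rightarrow> real"
  assumes l: "lagrangian_family \<Omega> K l" and x: "x \<in> K" and V: "lagrangian \<Omega> V" "l x \<inter> V = {0}"
  shows eventually_transversal: "\<forall>\<^sub>F y in at x within K. l y \<inter> V = {0}"
    and tendsto_oblique_family: "((\<lambda>y. oblique (l y) V u) \<longlongrightarrow> oblique (l x) V u) (at x within K)"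
    and eventually_lagrangian: "\<forall>\<^sub>F y in at x within K. lagrangian \<Omega> (l y)"
proof -
  have lag: "\<And>y. y \<in> K \<Longrightarrow> lagrangian \<Omega> (l y)" using l by (simp add: lagrangian_family_def)
  have c: "complementary (l x) V" using lagrangian_complementary[OF lag[OF x] V] .
  have L: "\<forall>\<^sub>F y in at x within K. subspace (l y) \<and> dim (l y) = dim (l x)"
  proof -
    have "subspace (l y) \<and> dim (l y) = dim (l x)" if "y \<in> K" for y
      using lag[OF that] lag[OF x] unfolding lagrangian_def by simp
    then show ?thesis by (simp add: eventually_at_filter always_eventually)
  qed
  have U: "\<forall>\<^sub>F y in at x within K. subspace V \<and> dim V = dim V"
    using V by (simp add: lagrangian_def)
  have lim: "\<And>v. ((\<lambda>y. proj (l y) v) \<longlongrightarrow> proj (l x) v) (at x within K)"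
    using l x by (simp add: lagrangian_family_def continuous_on_def)
  show "\<forall>\<^sub>F y in at x within K. l y \<inter> V = {0}"
    using eventually_complementary[OF c L U lim tendsto_const] by eventually_elim (simp add: complementary_def)
  show "((\<lambda>y. oblique (l y) V u) \<longlongrightarrow> oblique (l x) V u) (at x within K)"
    using tendsto_oblique[OF c L U lim tendsto_const] .
  show "\<forall>\<^sub>F y in at x within K. lagrangian \<Omega> (l y)"
    using lag by (auto simp: eventually_at_filter intro!: always_eventually)
qed

text \<open>Both indices are lower semicontinuous. Transversality of \<open>l y\<close> and
  \<open>B\<close> persists near \<open>x\<close> and fixes their sum at
  \<open>DIM('b) - dim V\<close>, so neither can grow.\<close>

lemma eventually_signature_chart_form:
  fixes \<Omega> :: "'b::euclidean_space \<Rightarrow> 'b \<Rightarrow> real"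
  assumes \<Omega>: "symplectic_form \<Omega>" and l: "lagrangian_family \<Omega> K l" and x: "x \<in> K"
    and V: "lagrangian \<Omega> V" "l x \<inter> V = {0}" and B: "lagrangian \<Omega> B" "B \<inter> V = {0}" "l x \<inter> B = {0}"
  shows "\<forall>\<^sub>F y in at x within K. signature (\<lambda>u. chart_form \<Omega> V (l y) B u u) UNIV
     = signature (\<lambda>u. chart_form \<Omega> V (l x) B u u) UNIV"
proof -
  have lx: "lagrangian \<Omega> (l x)" using l x by (simp add: lagrangian_family_def)
  note ev = eventually_lagrangian[OF l x V] eventually_transversal[OF l x V] eventually_transversal[OF l x B(1,3)]
  have bil: "\<forall>\<^sub>F y in at x within K. bilinear (chart_form \<Omega> V (l y) B)"
    using ev(1,2)
    by eventually_elim (rule bilinear_chart_form[OF \<Omega> lagrangian_complementary[OF _ V(1)] lagrangian_complementary[OF B(1) V(1) B(2)]])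
  have bil0: "bilinear (chart_form \<Omega> V (l x) B)"
    by (intro bilinear_chart_form[OF \<Omega>] lagrangian_complementary[of \<Omega>] lx V B)
  have lim: "((\<lambda>y. chart_form \<Omega> V (l y) B u v) \<longlongrightarrow> chart_form \<Omega> V (l x) B u v) (at x within K)" for u v
    unfolding chart_form_def
    by (rule tendsto_bilinear_euclidean[OF symplectic_bilinear[OF \<Omega>] tendsto_oblique_family[OF l x V] tendsto_const])
  have "\<forall>\<^sub>F y in at x within K. n_plus (\<lambda>u. chart_form \<Omega> V (l x) B u u) UNIV \<le> n_plus (\<lambda>u. chart_form \<Omega> V (l y) B u u) UNIV"
    by (rule eventually_n_plus_ge[OF lim bil bil0 subspace_UNIV])
  moreover have "\<forall>\<^sub>F y in at x within K. n_minus (\<lambda>u. chart_form \<Omega> V (l x) B u u) UNIV \<le> n_minus (\<lambda>u. chart_form \<Omega> V (l y) B u u) UNIV"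
    by (rule eventually_n_minus_ge[OF lim bil bil0 subspace_UNIV])
  ultimately show ?thesis using ev
  proof eventually_elim
    case (elim y)
    have "n_plus (\<lambda>u. chart_form \<Omega> V (l z) B u u) UNIV + n_minus (\<lambda>u. chart_form \<Omega> V (l z) B u u) UNIV + dim V = DIM('b)"
      if z: "lagrangian \<Omega> (l z)" "l z \<inter> V = {0}" "l z \<inter> B = {0}" for z
      using sylvester[OF symmetric_bilinear_chart_form[OF \<Omega> z(1) B(1) V(1) z(2) B(2)] subspace_UNIV]
        dim_radical_chart_form[OF \<Omega> z(1) B(1) V(1) z(2) B(2)] z(3) by simp
    from this[of y] this[of x] show ?case
      using elim lx V(2) B(3) unfolding signature_def by linarith
  qed
qed

text \<open>In a chart along a \<open>V\<close> transversal to \<open>l x\<close>, \<open>U\<close>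
  and \<open>U'\<close>, the two summands that involve the moving Lagrangian pair it with
  \<open>U\<close> and \<open>U'\<close>, to which it is transversal; these signatures are locally
  constant.\<close>

lemma eventually_kashiwara_const:
  assumes \<Omega>: "symplectic_form \<Omega>" and l: "lagrangian_family \<Omega> K l" and x: "x \<in> K"
    and U: "lagrangian \<Omega> U" "l x \<inter> U = {0}" and U': "lagrangian \<Omega> U'" "l x \<inter> U' = {0}"
  shows "\<forall>\<^sub>F y in at x within K. kashiwara \<Omega> (l y) U U' = kashiwara \<Omega> (l x) U U'"
proof -
  have lx: "lagrangian \<Omega> (l x)" using l x by (simp add: lagrangian_family_def)
  have "\<exists>V. lagrangian \<Omega> V \<and> (\<forall>L\<in>{l x, U, U'}. V \<inter> L = {0})"
    by (rule common_transversal_lagrangian[OF \<Omega>]) (use lx U U' in auto)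
  then obtain V where V: "lagrangian \<Omega> V" "l x \<inter> V = {0}" "U \<inter> V = {0}" "U' \<inter> V = {0}" by blast
  show ?thesis
    using eventually_signature_chart_form[OF \<Omega> l x V(1,2) U(1) V(3) U(2)]
      eventually_signature_chart_form[OF \<Omega> l x V(1,2) U'(1) V(4) U'(2)]
      eventually_lagrangian[OF l x V(1,2)] eventually_transversal[OF l x V(1,2)]
  proof eventually_elim
    case (elim y)
    have "kashiwara \<Omega> (l z) U U' = signature (\<lambda>u. chart_form \<Omega> V (l z) U u u) UNIV
       + signature (\<lambda>u. chart_form \<Omega> V U U' u u) UNIV - signature (\<lambda>u. chart_form \<Omega> V (l z) U' u u) UNIV"
      if z: "lagrangian \<Omega> (l z)" "l z \<inter> V = {0}" for z
      using kashiwara_eq_sum[OF \<Omega> z(1) U(1) U'(1) V(1) z(2) V(3,4)]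
        signature_chart_form_swap[OF \<Omega> z(1) U'(1) V(1) z(2) V(4)] by simp
    then show ?case using elim lx V(2) by simp
  qed
qed

text \<open>By the cocycle identity the difference is
  \<open>\<tau>(l y, U, U') - \<tau>(L0, U, U')\<close>. The moving Lagrangian now occurs only with
  Lagrangians transversal to it, so crossings with \<open>L0\<close> have dropped out.\<close>

lemma eventually_kashiwara_diff_const:
  assumes \<Omega>: "symplectic_form \<Omega>" and L0: "lagrangian \<Omega> L0" and l: "lagrangian_family \<Omega> K l" and x: "x \<in> K"
    and U: "lagrangian \<Omega> U" "l x \<inter> U = {0}" and U': "lagrangian \<Omega> U'" "l x \<inter> U' = {0}"
  shows "\<forall>\<^sub>F y in at x within K. kashiwara \<Omega> L0 (l y) U - kashiwara \<Omega> L0 (l y) U'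
     = kashiwara \<Omega> L0 (l x) U - kashiwara \<Omega> L0 (l x) U'"
  using eventually_kashiwara_const[OF \<Omega> l x U U'] eventually_lagrangian[OF l x U]
proof eventually_elim
  case (elim y)
  have "lagrangian \<Omega> (l x)" using l x by (simp add: lagrangian_family_def)
  from kashiwara_cocycle[OF \<Omega> L0 this U(1) U'(1)] kashiwara_cocycle[OF \<Omega> L0 elim(2) U(1) U'(1)] elim(1)
  show ?case by linarith
qed

text \<open>A Maslov potential \<open>m\<close> of a family \<open>l\<close> is locally a Kashiwara index \<open>\<tau>(L\<^sub>0, l, U)\<close> up to a constant,
  with \<open>U\<close> transversal to \<open>l\<close>. Its increments are twice the Maslov index (up to endpoint terms).\<close>
definition maslov_potential ::
  "('b::euclidean_space \<Rightarrow> 'b \<Rightarrow> real) \<Rightarrow> 'b set \<Rightarrow> 't::topological_space set \<Rightarrow> ('t \<Rightarrow> 'b set) \<Rightarrow> ('t \<Rightarrow> int) \<Rightarrow> bool" where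
  "maslov_potential \<Omega> L0 K l m \<longleftrightarrow> (\<forall>x\<in>K. \<exists>U. lagrangian \<Omega> U \<and> l x \<inter> U = {0} \<and>
     (\<forall>\<^sub>F y in at x within K. m y - m x = kashiwara \<Omega> L0 (l y) U - kashiwara \<Omega> L0 (l x) U))"

lemma maslov_potential_any:
  assumes \<Omega>: "symplectic_form \<Omega>" and L0: "lagrangian \<Omega> L0" and l: "lagrangian_family \<Omega> K l"
    and m: "maslov_potential \<Omega> L0 K l m" and x: "x \<in> K" and U: "lagrangian \<Omega> U" "l x \<inter> U = {0}"
  shows "\<forall>\<^sub>F y in at x within K. m y - m x = kashiwara \<Omega> L0 (l y) U - kashiwara \<Omega> L0 (l x) U"
proof -
  obtain U' where U': "lagrangian \<Omega> U'" "l x \<inter> U' = {0}"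
    and e: "\<forall>\<^sub>F y in at x within K. m y - m x = kashiwara \<Omega> L0 (l y) U' - kashiwara \<Omega> L0 (l x) U'"
    using m x unfolding maslov_potential_def by blast
  show ?thesis
    using e eventually_kashiwara_diff_const[OF \<Omega> L0 l x U U'] by eventually_elim linarith
qed

lemma maslov_potential_unique:
  assumes \<Omega>: "symplectic_form \<Omega>" and L0: "lagrangian \<Omega> L0" and l: "lagrangian_family \<Omega> K l"
    and m: "maslov_potential \<Omega> L0 K l m" "maslov_potential \<Omega> L0 K l m'" and K: "connected K" "x \<in> K" "y \<in> K"
  shows "m y - m x = m' y - m' x"
proof -
  have "(\<lambda>z. m z - m' z) x = (\<lambda>z. m z - m' z) y"
  proof (rule connected_local_const[OF K], intro ballI)
    fix z assume z: "z \<in> K"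
    then obtain U where U: "lagrangian \<Omega> U" "l z \<inter> U = {0}" using m(1) unfolding maslov_potential_def by blast
    show "\<forall>\<^sub>F w in at z within K. m z - m' z = m w - m' w"
      using maslov_potential_any[OF \<Omega> L0 l m(1) z U] maslov_potential_any[OF \<Omega> L0 l m(2) z U]
      by eventually_elim linarith
  qed
  then show ?thesis by simp
qed

text \<open>The primitive at \<open>x\<close> is the sum of \<open>d\<close> over small steps on the
  straight segment from a base point. For nearby \<open>x\<close> and \<open>y\<close> the two
  segments bound a strip of small quadrilaterals, over which the cocycle rule telescopes. Convexity
  keeps the strip in \<open>K\<close>, and boundedness lets one number of steps serve all
  points.\<close>

lemma local_cocycle_primitive:
  fixes K :: "'a::real_normed_vector set" and d :: "'a \<Rightarrow> 'a \<Rightarrow> int"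
  assumes K: "convex K" "bounded K" and \<delta>: "\<delta> > 0"
    and d: "\<And>x y z. x \<in> K \<Longrightarrow> y \<in> K \<Longrightarrow> z \<in> K \<Longrightarrow> dist x y < \<delta> \<Longrightarrow> dist y z < \<delta> \<Longrightarrow> dist x z < \<delta> \<Longrightarrow>
      d x y + d y z = d x z"
  shows "\<exists>m. \<forall>x\<in>K. \<forall>y\<in>K. dist x y < \<delta>/2 \<longrightarrow> m y - m x = d x y"
proof (cases "K = {}")
  case False
  then obtain x0 where x0: "x0 \<in> K" by blast
  obtain R where R: "\<And>x. x \<in> K \<Longrightarrow> norm (x - x0) \<le> R"
    using K(2) unfolding bounded_any_center[where a=x0] by (metis dist_commute dist_norm)
  \<comment> \<open>Makes each step shorter than \<open>\<delta> / 2\<close>, so that for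
    \<open>dist x y < \<delta> / 2\<close> the diagonals of the quadrilaterals stay below
    \<open>\<delta>\<close>.\<close>
  obtain N :: nat where N: "real N > max 1 (2 * R / \<delta>)" using reals_Archimedean2 by blast
  have N0: "real N > 0" "N > 0" using N by auto
  define p where "p x k = x0 + (real k / real N) *\<^sub>R (x - x0)" for x k
  have pK: "p x k \<in> K" if "x \<in> K" "k \<le> N" for x k
  proof -
    have "p x k = (1 - real k / real N) *\<^sub>R x0 + (real k / real N) *\<^sub>R x"
      by (simp add: p_def algebra_simps)
    moreover have "real k / real N \<le> 1" using that N0 by simp
    ultimately show ?thesis using K(1) x0 that N0 by (auto intro!: convexD)
  qed
  have p1: "dist (p x k) (p x (Suc k)) < \<delta>/2" if "x \<in> K" for x k
  proof -
    have "p x (Suc k) - p x k = (1 / real N) *\<^sub>R (x - x0)"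
      by (simp add: p_def add_divide_distrib algebra_simps)
    then have "dist (p x k) (p x (Suc k)) = norm (x - x0) / real N"
      by (metis dist_commute dist_norm norm_scaleR abs_of_nonneg divide_inverse mult.commute mult_1 inverse_eq_divide of_nat_0_le_iff zero_le_divide_1_iff)
    also have "\<dots> \<le> R / real N" using R[OF that] N0 by (simp add: divide_right_mono)
    also have "\<dots> < \<delta>/2" using N N0 \<delta> by (simp add: field_simps)
    finally show ?thesis .
  qed
  have p2: "dist (p x k) (p y k) \<le> dist x y" if "k \<le> N" for x y k
  proof -
    have "p x k - p y k = (real k / real N) *\<^sub>R (x - y)" by (simp add: p_def algebra_simps)
    then have "dist (p x k) (p y k) = (real k / real N) * dist x y" by (simp add: dist_norm)
    moreover have "real k / real N \<le> 1" using that N0 by simp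
    ultimately show ?thesis using mult_right_mono[of "real k / real N" 1 "dist x y"] by simp
  qed
  define m where "m x = (\<Sum>k<N. d (p x k) (p x (Suc k)))" for x
  have "m y - m x = d x y" if xy: "x \<in> K" "y \<in> K" "dist x y < \<delta>/2" for x y
  proof -
    have step: "d (p y k) (p y (Suc k)) - d (p x k) (p x (Suc k))
       = d (p x (Suc k)) (p y (Suc k)) - d (p x k) (p y k)" if k: "k < N" for k
    proof -
      have a: "dist (p x k) (p x (Suc k)) < \<delta>/2" "dist (p y k) (p y (Suc k)) < \<delta>/2" using p1 xy by auto
      have b: "dist (p x k) (p y k) < \<delta>/2" "dist (p x (Suc k)) (p y (Suc k)) < \<delta>/2"
        using p2[of k x y] p2[of "Suc k" x y] k xy by auto
      have lt: "dist (p x k) (p x (Suc k)) < \<delta>" "dist (p y k) (p y (Suc k)) < \<delta>" "dist (p x k) (p y k) < \<delta>"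
          "dist (p x (Suc k)) (p y (Suc k)) < \<delta>" using a b \<delta> by linarith+
      have c: "dist (p x k) (p y (Suc k)) < \<delta>"
        using dist_triangle[of "p x k" "p y (Suc k)" "p x (Suc k)"] a b by linarith
      have "d (p x k) (p x (Suc k)) + d (p x (Suc k)) (p y (Suc k)) = d (p x k) (p y (Suc k))"
        using lt c k xy(1,2) pK by (intro d) auto
      moreover have "d (p x k) (p y k) + d (p y k) (p y (Suc k)) = d (p x k) (p y (Suc k))"
        using lt c k xy(1,2) pK by (intro d) auto
      ultimately show ?thesis by linarith
    qed
    have "m y - m x = (\<Sum>k<N. d (p x (Suc k)) (p y (Suc k)) - d (p x k) (p y k))"
      unfolding m_def sum_subtractf[symmetric] by (intro sum.cong) (use step in auto)
    also have "\<dots> = d (p x N) (p y N) - d (p x 0) (p y 0)" by (rule sum_lessThan_telescope)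
    also have "\<dots> = d x y - d x0 x0" using N0 by (simp add: p_def)
    also have "d x0 x0 = 0" using d[OF x0 x0 x0] \<delta> by simp
    finally show ?thesis by simp
  qed
  then show ?thesis by blast
qed auto

text \<open>A Lebesgue number provides transversals \<open>W x\<close> that work on balls of one
  radius \<open>e\<close>. The increments \<open>d x y\<close>, measured with \<open>W x\<close>,
  form a cocycle near the diagonal, and \<open>local_cocycle_primitive\<close> integrates
  them.\<close>

lemma maslov_potential_exists:
  fixes K :: "'a::real_normed_vector set"
  assumes \<Omega>: "symplectic_form \<Omega>" and L0: "lagrangian \<Omega> L0" and l: "lagrangian_family \<Omega> K l"
    and K: "compact K" "convex K"
  shows "\<exists>m. maslov_potential \<Omega> L0 K l m"
proof (cases "K = {}")
  case True
  then show ?thesis by (simp add: maslov_potential_def)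
next
  case False
  have lag: "\<And>x. x \<in> K \<Longrightarrow> lagrangian \<Omega> (l x)" using l by (simp add: lagrangian_family_def)
  have "\<exists>U r. r > 0 \<and> lagrangian \<Omega> U \<and> (\<forall>y\<in>K. dist y x < r \<longrightarrow> l y \<inter> U = {0})" if x: "x \<in> K" for x
  proof -
    obtain U where U: "lagrangian \<Omega> U" "l x \<inter> U = {0}"
      using transversal_lagrangian_exists[OF \<Omega> lag[OF x]] by blast
    have "\<forall>\<^sub>F y in at x within K. l y \<inter> U = {0}" by (rule eventually_transversal[OF l x U])
    then obtain r where "r > 0" "\<forall>y\<in>K. y \<noteq> x \<and> dist y x < r \<longrightarrow> l y \<inter> U = {0}"
      unfolding eventually_at by blast
    then show ?thesis using U by metis
  qed
  then obtain U r where r: "\<And>x. x \<in> K \<Longrightarrow> r x > 0" and U: "\<And>x. x \<in> K \<Longrightarrow> lagrangian \<Omega> (U x)"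
    and Ur: "\<And>x y. x \<in> K \<Longrightarrow> y \<in> K \<Longrightarrow> dist y x < r x \<Longrightarrow> l y \<inter> U x = {0}" by metis
  have "(\<lambda>x. ball x (r x)) ` K \<noteq> {}" "K \<subseteq> \<Union> ((\<lambda>x. ball x (r x)) ` K)" using False r by auto
  then obtain \<delta> where \<delta>: "\<delta> > 0" "\<And>T. T \<subseteq> K \<Longrightarrow> diameter T < \<delta> \<Longrightarrow> \<exists>B\<in>(\<lambda>x. ball x (r x)) ` K. T \<subseteq> B"
    by (rule Lebesgue_number_lemma[OF K(1)]) auto
  \<comment> \<open>A ball of radius \<open>e\<close> has diameter at most \<open>2 * e\<close>,
    below the Lebesgue number.\<close>
  define e where "e = \<delta> / 3"
  have e: "e > 0" using \<delta> by (simp add: e_def)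
  have "\<exists>W. lagrangian \<Omega> W \<and> (\<forall>y\<in>K. dist x y < e \<longrightarrow> l y \<inter> W = {0})" if x: "x \<in> K" for x
  proof -
    have "diameter (K \<inter> ball x e) \<le> 2 * e"
    proof (rule diameter_le)
      show "K \<inter> ball x e \<noteq> {} \<or> 0 \<le> 2 * e" using e by simp
      fix y z assume "y \<in> K \<inter> ball x e" "z \<in> K \<inter> ball x e"
      then show "norm (y - z) \<le> 2 * e" using dist_triangle3[of y z x] by (simp add: dist_norm)
    qed
    then have "diameter (K \<inter> ball x e) < \<delta>" using \<delta>(1) by (simp add: e_def)
    then obtain c where c: "c \<in> K" "K \<inter> ball x e \<subseteq> ball c (r c)" using \<delta>(2)[of "K \<inter> ball x e"] by auto
    show ?thesis
    proof (intro exI[of _ "U c"] conjI ballI impI)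
      fix y assume "y \<in> K" "dist x y < e"
      then have "y \<in> ball c (r c)" using c by auto
      then show "l y \<inter> U c = {0}" using Ur[OF c(1) \<open>y \<in> K\<close>] by (simp add: dist_commute)
    qed (use U c in auto)
  qed
  then obtain W where W: "\<And>x. x \<in> K \<Longrightarrow> lagrangian \<Omega> (W x)"
    and Wt: "\<And>x y. x \<in> K \<Longrightarrow> y \<in> K \<Longrightarrow> dist x y < e \<Longrightarrow> l y \<inter> W x = {0}" by metis
  define d where "d x y = kashiwara \<Omega> L0 (l y) (W x) - kashiwara \<Omega> L0 (l x) (W x)" for x y
  have "\<exists>m. \<forall>x\<in>K. \<forall>y\<in>K. dist x y < e/2 \<longrightarrow> m y - m x = d x y"
  proof (rule local_cocycle_primitive[OF K(2) compact_imp_bounded[OF K(1)] e])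
    fix x y z assume xyz: "x \<in> K" "y \<in> K" "z \<in> K" "dist x y < e" "dist y z < e" "dist x z < e"
    \<comment> \<open>Convex, hence connected, and the family is transversal to both
      \<open>W x\<close> and \<open>W y\<close> on it. So the index measured with the one minus that
      measured with the other is constant, and its equality at \<open>y\<close> and \<open>z\<close>
      is the cocycle rule.\<close>
    let ?C = "K \<inter> ball x e \<inter> ball y e"
    have conn: "connected ?C" using K by (intro convex_connected convex_Int convex_ball)
    have yz: "y \<in> ?C" "z \<in> ?C" using xyz e by auto
    have lC: "lagrangian_family \<Omega> ?C l" using l by (rule lagrangian_family_subset) auto
    have "(\<lambda>w. kashiwara \<Omega> L0 (l w) (W y) - kashiwara \<Omega> L0 (l w) (W x)) y
      = (\<lambda>w. kashiwara \<Omega> L0 (l w) (W y) - kashiwara \<Omega> L0 (l w) (W x)) z"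
    proof (rule connected_local_const[OF conn yz], intro ballI)
      fix w assume w: "w \<in> ?C"
      have "\<forall>\<^sub>F v in at w within ?C. kashiwara \<Omega> L0 (l v) (W y) - kashiwara \<Omega> L0 (l v) (W x)
         = kashiwara \<Omega> L0 (l w) (W y) - kashiwara \<Omega> L0 (l w) (W x)"
        using w xyz W Wt by (intro eventually_kashiwara_diff_const[OF \<Omega> L0 lC w]) auto
      then show "\<forall>\<^sub>F v in at w within ?C. kashiwara \<Omega> L0 (l w) (W y) - kashiwara \<Omega> L0 (l w) (W x)
         = kashiwara \<Omega> L0 (l v) (W y) - kashiwara \<Omega> L0 (l v) (W x)"
        by eventually_elim simp
    qed
    then show "d x y + d y z = d x z" by (simp add: d_def)
  qed
  then obtain m where m: "\<And>x y. x \<in> K \<Longrightarrow> y \<in> K \<Longrightarrow> dist x y < e/2 \<Longrightarrow> m y - m x = d x y" by blast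
  have "maslov_potential \<Omega> L0 K l m"
    unfolding maslov_potential_def
  proof (intro ballI exI conjI)
    fix x assume x: "x \<in> K"
    show "lagrangian \<Omega> (W x)" using W[OF x] .
    show "l x \<inter> W x = {0}" using Wt[OF x x] e by simp
    show "\<forall>\<^sub>F y in at x within K. m y - m x = kashiwara \<Omega> L0 (l y) (W x) - kashiwara \<Omega> L0 (l x) (W x)"
      unfolding eventually_at using m[OF x] e
      by (intro exI[of _ "e/2"]) (auto simp: d_def dist_commute)
  qed
  then show ?thesis by blast
qed

text \<open>A potential over the whole rectangle restricts to potentials on the sides
  \<open>s = 0\<close> and \<open>s = 1\<close>, where increments are unique. Along the other two
  sides the Lagrangian is fixed, so the potential is constant there.\<close>

lemma maslov_potential_homotopy_invariant:
  fixes \<Omega> :: "'b::euclidean_space \<Rightarrow> 'b \<Rightarrow> real"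
  assumes \<Omega>: "symplectic_form \<Omega>" and L0: "lagrangian \<Omega> L0" and ab: "a \<le> b"
    and h: "fe_homotopic \<Omega> a b l l'"
    and l: "lagrangian_family \<Omega> {a..b} l" "lagrangian_family \<Omega> {a..b} l'"
    and m: "maslov_potential \<Omega> L0 {a..b} l m" "maslov_potential \<Omega> L0 {a..b} l' m'"
  shows "m b - m a = m' b - m' a"
proof -
  obtain H :: "real \<Rightarrow> real \<Rightarrow> 'b set" where "(\<forall>s\<in>{0..1}. \<forall>t\<in>{a..b}. lagrangian \<Omega> (H s t)) \<and>
     (\<forall>x. continuous_on ({0..1} \<times> {a..b}) (\<lambda>(s, t). proj (H s t) x)) \<and>
     (\<forall>t\<in>{a..b}. H 0 t = l t \<and> H 1 t = l' t) \<and> (\<forall>s\<in>{0..1}. H s a = l a \<and> H s b = l b)"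
    using h unfolding fe_homotopic_def by blast
  then have H: "\<And>s t. s \<in> {0..1} \<Longrightarrow> t \<in> {a..b} \<Longrightarrow> lagrangian \<Omega> (H s t)"
    "\<And>x. continuous_on ({0..1} \<times> {a..b}) (\<lambda>(s, t). proj (H s t) x)"
    "\<And>t. t \<in> {a..b} \<Longrightarrow> H 0 t = l t" "\<And>t. t \<in> {a..b} \<Longrightarrow> H 1 t = l' t"
    "\<And>s. s \<in> {0..1} \<Longrightarrow> H s a = l a" "\<And>s. s \<in> {0..1} \<Longrightarrow> H s b = l b"
    by blast+
  let ?K = "{0..1::real} \<times> {a..b}"
  define h where "h p = H (fst p) (snd p)" for p
  have fam: "lagrangian_family \<Omega> ?K h"
    unfolding lagrangian_family_def h_def using H(1,2) by (auto simp: case_prod_unfold)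
  obtain M where M: "maslov_potential \<Omega> L0 ?K h M"
    using maslov_potential_exists[OF \<Omega> L0 fam] by (auto simp: compact_Times convex_Times)
  have slice: "maslov_potential \<Omega> L0 {a..b} k (\<lambda>t. M (s, t))"
    if s: "s \<in> {0..1}" and k: "\<And>t. t \<in> {a..b} \<Longrightarrow> H s t = k t" for s k
    unfolding maslov_potential_def
  proof
    fix t assume t: "t \<in> {a..b}"
    then have "(s, t) \<in> ?K" using s by simp
    then obtain U where U: "lagrangian \<Omega> U" "h (s, t) \<inter> U = {0}"
      and ev: "\<forall>\<^sub>F y in at (s, t) within ?K. M y - M (s, t) = kashiwara \<Omega> L0 (h y) U - kashiwara \<Omega> L0 (h (s, t)) U"
      using M unfolding maslov_potential_def by blast
    obtain d where d: "d > 0" "\<And>y. y \<in> ?K \<Longrightarrow> y \<noteq> (s, t) \<Longrightarrow> dist y (s, t) < d \<Longrightarrow>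
        M y - M (s, t) = kashiwara \<Omega> L0 (h y) U - kashiwara \<Omega> L0 (h (s, t)) U"
      using ev unfolding eventually_at by blast
    have "\<forall>\<^sub>F t' in at t within {a..b}. M (s, t') - M (s, t) = kashiwara \<Omega> L0 (k t') U - kashiwara \<Omega> L0 (k t) U"
      unfolding eventually_at
    proof (intro exI[of _ d] conjI ballI impI)
      fix t' assume "t' \<in> {a..b}" "t' \<noteq> t \<and> dist t' t < d"
      then show "M (s, t') - M (s, t) = kashiwara \<Omega> L0 (k t') U - kashiwara \<Omega> L0 (k t) U"
        using d(2)[of "(s, t')"] s t k by (simp add: dist_Pair_Pair h_def)
    qed (use d in auto)
    then show "\<exists>U. lagrangian \<Omega> U \<and> k t \<inter> U = {0} \<and>
        (\<forall>\<^sub>F t' in at t within {a..b}. M (s, t') - M (s, t) = kashiwara \<Omega> L0 (k t') U - kashiwara \<Omega> L0 (k t) U)"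
      using U k[OF t] by (auto simp: h_def)
  qed
  have edge: "M (0, c) = M (1, c)" if c: "c \<in> {a..b}" and Hc: "\<And>s. s \<in> {0..1} \<Longrightarrow> H s c = l c" for c
  proof -
    have "(\<lambda>s. M (s, c)) 0 = (\<lambda>s. M (s, c)) 1"
    proof (rule connected_local_const[of "{0..1::real}"])
      show "\<forall>s\<in>{0..1}. \<forall>\<^sub>F s' in at s within {0..1}. M (s, c) = M (s', c)"
      proof
        fix s :: real assume s: "s \<in> {0..1}"
        then have "(s, c) \<in> ?K" using c by simp
        then obtain U where ev: "\<forall>\<^sub>F y in at (s, c) within ?K. M y - M (s, c) = kashiwara \<Omega> L0 (h y) U - kashiwara \<Omega> L0 (h (s, c)) U"
          using M unfolding maslov_potential_def by blast
        obtain d where d: "d > 0" "\<And>y. y \<in> ?K \<Longrightarrow> y \<noteq> (s, c) \<Longrightarrow> dist y (s, c) < d \<Longrightarrow>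
            M y - M (s, c) = kashiwara \<Omega> L0 (h y) U - kashiwara \<Omega> L0 (h (s, c)) U"
          using ev unfolding eventually_at by blast
        show "\<forall>\<^sub>F s' in at s within {0..1}. M (s, c) = M (s', c)"
          unfolding eventually_at
        proof (intro exI[of _ d] conjI ballI impI)
          fix s' :: real assume "s' \<in> {0..1}" "s' \<noteq> s \<and> dist s' s < d"
          then show "M (s, c) = M (s', c)"
            using d(2)[of "(s', c)"] s c Hc by (simp add: dist_Pair_Pair h_def)
        qed (use d in auto)
      qed
    qed auto
    then show ?thesis by simp
  qed
  have "m b - m a = M (0, b) - M (0, a)"
    using maslov_potential_unique[OF \<Omega> L0 l(1) m(1) slice[of 0 l] connected_Icc] H(3) ab by simp
  moreover have "m' b - m' a = M (1, b) - M (1, a)"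
    using maslov_potential_unique[OF \<Omega> L0 l(2) m(2) slice[of 1 l'] connected_Icc] H(4) ab by simp
  ultimately show ?thesis using edge[of a] edge[of b] H(5,6) ab by simp
qed

section \<open>Crossing forms\<close>

lemma lagr_path_eq_family: "lagr_path \<Omega> a b l \<longleftrightarrow> lagrangian_family \<Omega> {a..b} l"
  by (simp add: lagr_path_def lagrangian_family_def)

lemma at_within_Icc_nontrivial: "a < b \<Longrightarrow> t \<in> {a..b} \<Longrightarrow> at t within {a..b::real} \<noteq> bot"
  by (simp add: trivial_limit_within islimpt_Icc)

text \<open>\<open>crossing_form\<close> uses a chosen transversal; this allows any other. If
  \<open>p\<close> and \<open>q\<close> are the projections of \<open>v\<close> into
  \<open>l s\<close> along the two transversals, isotropy of \<open>l s\<close> gives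
  \<open>\<Omega> v (q - v) - \<Omega> v (p - v) = - \<Omega> (p - v) (q - v)\<close>, a term of
  second order.\<close>

lemma crossing_form_eq:
  assumes \<Omega>: "symplectic_form \<Omega>" and ab: "a < b" and t: "t \<in> {a..b}"
    and l: "lagrangian_family \<Omega> {a..b} l"
    and D: "\<And>x. ((\<lambda>s. proj (l s) x) has_vector_derivative P' x) (at t within {a..b})"
    and U: "lagrangian \<Omega> U" "l t \<inter> U = {0}" and v: "v \<in> l t"
    and w: "((\<lambda>s. oblique (l s) U v) has_vector_derivative w) (at t within {a..b})"
  shows "crossing_form \<Omega> a b l t v = \<Omega> v w"
proof -
  note bil = symplectic_bilinear[OF \<Omega>]
  have lag: "\<And>s. s \<in> {a..b} \<Longrightarrow> lagrangian \<Omega> (l s)" using l by (simp add: lagrangian_family_def)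
  define U0 where "U0 = transversal_lagr \<Omega> (l t)"
  have "\<exists>V. lagrangian \<Omega> V \<and> V \<inter> l t = {0}"
    using transversal_lagrangian_exists[OF \<Omega> lag[OF t]] by (simp add: Int_commute)
  then have "lagrangian \<Omega> U0 \<and> U0 \<inter> l t = {0}" unfolding U0_def transversal_lagr_def by (rule someI_ex)
  then have U0: "lagrangian \<Omega> U0" "l t \<inter> U0 = {0}" by auto
  let ?F = "at t within {a..b}"
  have nb: "?F \<noteq> bot" using at_within_Icc_nontrivial[OF ab t] .
  let ?p = "\<lambda>s. oblique (l s) U0 v" and ?q = "\<lambda>s. oblique (l s) U v"
  have c0: "complementary (l t) U0" and c: "complementary (l t) U"
    using lagrangian_complementary lag[OF t] U0 U by blast+
  have pt: "?p t = v" "?q t = v" using oblique_id v c0 c by blast+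
  have dims: "subspace (l s) \<and> dim (l s) = dim (l t)" if "s \<in> {a..b}" for s
    using lag[OF that] lag[OF t] unfolding lagrangian_def by simp
  obtain w0 where w0: "(?p has_vector_derivative w0) ?F"
    using has_vector_derivative_oblique[OF c0 t dims D] by blast
  have ev: "\<forall>\<^sub>F s in ?F. complementary (l s) U0 \<and> complementary (l s) U \<and> lagrangian \<Omega> (l s)"
    using eventually_lagrangian[OF l t U0] eventually_transversal[OF l t U0] eventually_transversal[OF l t U]
    by eventually_elim (use U0(1) U(1) in \<open>auto intro: lagrangian_complementary\<close>)
  have wv: "wvec U0 l v s = ?p s - v" if cs: "complementary (l s) U0" for s
    unfolding wvec_def
  proof (rule the_equality)
    have "- (v - ?p s) \<in> U0" using oblique_diff_in[OF cs] lagrangian_subspace[OF U0(1)] by (blast intro: subspace_neg)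
    then show "?p s - v \<in> U0 \<and> v + (?p s - v) \<in> l s" using oblique_in[OF cs] by simp
    fix u assume u: "u \<in> U0 \<and> v + u \<in> l s"
    have "v - (v + u) \<in> U0" using subspace_neg[OF lagrangian_subspace[OF U0(1)]] u by simp
    then show "u = ?p s - v" using oblique_unique[OF cs, of "v + u" v] u by simp
  qed
  have q: "((\<lambda>s. (1 / (s - t)) *\<^sub>R (?p s - v)) \<longlongrightarrow> w0) ?F" "((\<lambda>s. (1 / (s - t)) *\<^sub>R (?q s - v)) \<longlongrightarrow> w) ?F"
    using w0 w unfolding has_vector_derivative_iff_quotient pt by auto
  have eq: "\<Omega> v w - \<Omega> v w0 = 0"
  proof (rule tendsto_unique[OF nb])
    show "((\<lambda>s. \<Omega> v ((1 / (s - t)) *\<^sub>R (?q s - v)) - \<Omega> v ((1 / (s - t)) *\<^sub>R (?p s - v))) \<longlongrightarrow> \<Omega> v w - \<Omega> v w0) ?F"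
      by (intro tendsto_diff tendsto_bilinear_euclidean[OF bil] tendsto_const q)
    have "((\<lambda>s. - \<Omega> ((1 / (s - t)) *\<^sub>R (?p s - v)) (?q s - v)) \<longlongrightarrow> - \<Omega> w0 (?q t - v)) ?F"
      by (intro tendsto_minus tendsto_bilinear_euclidean[OF bil] q tendsto_diff tendsto_const
          tendsto_of_has_vector_derivative[OF w])
    then have "((\<lambda>s. - \<Omega> ((1 / (s - t)) *\<^sub>R (?p s - v)) (?q s - v)) \<longlongrightarrow> 0) ?F"
      using pt bil by (simp add: bilinear_arith)
    then show "((\<lambda>s. \<Omega> v ((1 / (s - t)) *\<^sub>R (?q s - v)) - \<Omega> v ((1 / (s - t)) *\<^sub>R (?p s - v))) \<longlongrightarrow> 0) ?F"
    proof (rule Lim_transform_eventually)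
      show "\<forall>\<^sub>F s in ?F. - \<Omega> ((1 / (s - t)) *\<^sub>R (?p s - v)) (?q s - v)
        = \<Omega> v ((1 / (s - t)) *\<^sub>R (?q s - v)) - \<Omega> v ((1 / (s - t)) *\<^sub>R (?p s - v))"
        using ev
      proof eventually_elim
        case (elim s)
        have "\<Omega> (?p s) (?q s) = 0"
          using lagrangian_isotropic oblique_in elim by blast
        moreover have "\<Omega> (?p s) v = - \<Omega> v (?p s)" "\<Omega> v v = 0"
          using symplectic_skew[OF \<Omega>] symplectic_self[OF \<Omega>] by blast+
        ultimately have e: "- \<Omega> (?p s - v) (?q s - v) = \<Omega> v (?q s - v) - \<Omega> v (?p s - v)"
          by (simp add: bilinear_arith[OF bil])
        show ?case
          unfolding bilinear_lmul[OF bil] bilinear_rmul[OF bil] real_scaleR_def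
          using arg_cong[OF e, of "\<lambda>x. (1 / (s - t)) * x"] by (simp add: right_diff_distrib diff_divide_distrib)
      qed
    qed
  qed
  have "((\<lambda>s. \<Omega> v (wvec U0 l v s)) has_real_derivative d) ?F \<longleftrightarrow> d = \<Omega> v w" for d
  proof -
    have "((\<lambda>s. \<Omega> v ((1 / (s - t)) *\<^sub>R (?p s - v))) \<longlongrightarrow> \<Omega> v w0) ?F"
      by (intro tendsto_bilinear_euclidean[OF bil] tendsto_const q)
    then have "((\<lambda>s. (1 / (s - t)) *\<^sub>R (\<Omega> v (wvec U0 l v s) - \<Omega> v (wvec U0 l v t))) \<longlongrightarrow> \<Omega> v w0) ?F"
    proof (rule Lim_transform_eventually)
      show "\<forall>\<^sub>F s in ?F. \<Omega> v ((1 / (s - t)) *\<^sub>R (?p s - v)) = (1 / (s - t)) *\<^sub>R (\<Omega> v (wvec U0 l v s) - \<Omega> v (wvec U0 l v t))"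
        using ev by eventually_elim (simp add: wv c0 pt bilinear_arith[OF bil])
    qed
    then have lim: "((\<lambda>s. (1 / (s - t)) *\<^sub>R (\<Omega> v (wvec U0 l v s) - \<Omega> v (wvec U0 l v t))) \<longlongrightarrow> \<Omega> v w) ?F"
      using eq by simp
    show ?thesis
      unfolding has_real_derivative_iff_has_vector_derivative has_vector_derivative_iff_quotient
      using lim tendsto_unique[OF nb] by blast
  qed
  then show ?thesis unfolding crossing_form_def U0_def[symmetric] by simp
qed

lemma n_plus_trivial: "n_plus q {0} = 0" for q :: "'b::euclidean_space \<Rightarrow> real"
proof -
  have "\<exists>S. subspace S \<and> S \<subseteq> {0} \<and> (\<forall>v\<in>S. v \<noteq> 0 \<longrightarrow> q v > 0) \<and> dim S = n_plus q {0}"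
    by (rule n_plus_attained[OF subspace_single_0])
  then obtain S :: "'b set" where S: "S \<subseteq> {0}" "dim S = n_plus q {0}" by (elim exE conjE) simp
  have "dim S \<le> dim {0 :: 'b}" using S(1) by (rule dim_subset)
  then show ?thesis using S(2) by simp
qed

lemma signature_trivial: "signature q {0} = 0"
  by (simp add: signature_def n_minus_eq_n_plus n_plus_trivial)

text \<open>The rescaling \<open>(x, k) \<mapsto> x + k/\<surd>h\<close> turns the perturbed form at distance \<open>h\<close> from a crossing into one
  that converges to the direct sum of the form at the crossing and the crossing form.\<close>
lemma chart_form_one_sided:
  fixes \<Omega> :: "'b::euclidean_space \<Rightarrow> 'b \<Rightarrow> real" and \<epsilon> :: real
  assumes \<Omega>: "symplectic_form \<Omega>" and L0: "lagrangian \<Omega> L0" and t: "t \<in> S"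
    and l: "lagrangian_family \<Omega> S l"
    and V: "lagrangian \<Omega> V" "L0 \<inter> V = {0}" "l t \<inter> V = {0}"
    and E': "linear E'" "\<And>x. ((\<lambda>s. oblique (l s) V x) has_vector_derivative E' x) (at t within S)"
    and \<epsilon>: "\<epsilon> = 1 \<or> \<epsilon> = - 1"
    and C: "symmetric_bilinear C" "\<And>u v. C u v = \<Omega> (oblique L0 V u) (E' v)"
    and nd: "radical C (l t \<inter> L0) = {0}"
  shows "\<forall>\<^sub>F s in at t within {s \<in> S. \<epsilon> * (s - t) > 0}.
     signature (\<lambda>x. chart_form \<Omega> V L0 (l s) x x) UNIV
       = signature (\<lambda>x. chart_form \<Omega> V L0 (l t) x x) UNIV + signature (\<lambda>x. \<epsilon> * C x x) (l t \<inter> L0)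
     \<and> l s \<inter> L0 = {0}"
proof -
  note bil = symplectic_bilinear[OF \<Omega>]
  let ?K = "l t \<inter> L0" and ?f = "\<lambda>s. chart_form \<Omega> V L0 (l s)" and ?S = "{s \<in> S. \<epsilon> * (s - t) > 0}"
  let ?F = "at t within ?S"
  have lt: "lagrangian \<Omega> (l t)" using l t by (simp add: lagrangian_family_def)
  have sK: "subspace ?K" using lt L0 by (auto intro: subspace_inter lagrangian_subspace)
  have le: "?F \<le> at t within S" by (rule at_le) auto
  have ev: "\<forall>\<^sub>F s in ?F. lagrangian \<Omega> (l s)" "\<forall>\<^sub>F s in ?F. l s \<inter> V = {0}" "\<forall>\<^sub>F s in ?F. \<epsilon> * (s - t) > 0"
    using filter_leD[OF le eventually_lagrangian[OF l t V(1,3)]] filter_leD[OF le eventually_transversal[OF l t V(1,3)]]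
    by (auto simp: eventually_at_filter always_eventually)
  have c0: "complementary L0 V" "complementary (l t) V" using lagrangian_complementary L0 lt V by blast+
  have sb: "\<forall>\<^sub>F s in ?F. symmetric_bilinear (?f s)"
    using ev(1,2) by eventually_elim (rule symmetric_bilinear_chart_form[OF \<Omega> L0 _ V(1,2)])
  have sbt: "symmetric_bilinear (?f t)" by (rule symmetric_bilinear_chart_form[OF \<Omega> L0 lt V(1,2,3)])
  have quot: "((\<lambda>s. (?f s u v - ?f t u v) / (s - t)) \<longlongrightarrow> C u v) ?F" for u v
  proof -
    have "((\<lambda>s. \<Omega> (oblique L0 V u) ((1 / (s - t)) *\<^sub>R (oblique (l s) V v - oblique (l t) V v))) \<longlongrightarrow> C u v) ?F"
      unfolding C(2)
      by (intro tendsto_bilinear_euclidean[OF bil] tendsto_const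
           tendsto_mono[OF le E'(2)[unfolded has_vector_derivative_iff_quotient]])
    then show ?thesis by (simp add: chart_form_def bilinear_arith[OF bil])
  qed
  have lim0: "((\<lambda>s. ?f s u v) \<longlongrightarrow> ?f t u v) ?F" for u v
    unfolding chart_form_def
    by (intro tendsto_bilinear_euclidean[OF bil] tendsto_const tendsto_mono[OF le tendsto_oblique_family[OF l t V(1,3)]])
  have h0: "((\<lambda>s. sqrt (\<epsilon> * (s - t))) \<longlongrightarrow> 0) ?F"
  proof -
    have "((\<lambda>s. sqrt (\<epsilon> * (s - t))) \<longlongrightarrow> sqrt (\<epsilon> * (t - t))) ?F" by (intro tendsto_intros)
    then show ?thesis by simp
  qed
  \<comment> \<open>Composing with \<open>\<kappa>\<close> yields a form on the whole second factor
    that agrees with the crossing form on \<open>?K\<close>.\<close>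
  define \<kappa> where "\<kappa> = proj ?K"
  have l\<kappa>: "linear \<kappa>" and \<kappa>K: "\<And>k. \<kappa> k \<in> ?K" and \<kappa>id: "\<And>k. k \<in> ?K \<Longrightarrow> \<kappa> k = k"
    unfolding \<kappa>_def using linear_proj[OF sK] proj_in[OF sK] proj_id[OF sK] by auto
  \<comment> \<open>\<open>\<epsilon> * (s - t)\<close> is the distance from the crossing on the
    chosen side. Values of \<open>?f s\<close> with an argument in \<open>?K\<close> vanish at
    \<open>t\<close>, hence are of first order in it. Scaling by the inverse square root keeps those
    with both arguments in \<open>?K\<close> finite and sends the mixed ones to 0.\<close>
  define g where "g s p = fst p + (1 / sqrt (\<epsilon> * (s - t))) *\<^sub>R \<kappa> (snd p)" for s and p :: "'b \<times> 'b"
  have lg: "linear (g s)" for s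
    unfolding g_def using l\<kappa> by (intro linearI) (simp_all add: linear_add linear_cmul algebra_simps)
  define G where "G s p q = ?f s (g s p) (g s q)" for s p q
  define C' where "C' u v = \<epsilon> * C (\<kappa> u) (\<kappa> v)" for u v
  have bilC: "bilinear C" "\<And>u v. C u v = C v u" using C(1) by (auto simp: symmetric_bilinear_def)
  have sbC': "symmetric_bilinear C'"
    unfolding symmetric_bilinear_def bilinear_def C'_def using l\<kappa> bilC(2)
    by (auto intro!: linearI simp: linear_add linear_cmul bilinear_arith[OF bilC(1)] algebra_simps)
  define G0 where "G0 = direct_sum_form (?f t) C'"
  have sbG0: "symmetric_bilinear G0" unfolding G0_def by (rule symmetric_bilinear_direct_sum[OF sbt sbC'])
  have z1: "?f t x k = 0" if "k \<in> ?K" for x k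
    using that lagrangian_isotropic[OF L0 oblique_in[OF c0(1)], of k x] oblique_id[OF c0(2), of k]
    by (simp add: chart_form_def)
  have z2: "?f t k x = 0" if "k \<in> ?K" for x k
    using that lagrangian_isotropic[OF lt _ oblique_in[OF c0(2)], of k x] oblique_id[OF c0(1), of k]
    by (simp add: chart_form_def)
  have limG: "((\<lambda>s. G s p q) \<longlongrightarrow> G0 p q) ?F" for p q
  proof -
    obtain x k y j where pq: "p = (x, k)" "q = (y, j)" by (metis surj_pair)
    let ?h = "\<lambda>s. sqrt (\<epsilon> * (s - t))" and ?Q = "\<lambda>u v s. (?f s u v - ?f t u v) / (s - t)"
    have "((\<lambda>s. ?f s x y + ?h s * (\<epsilon> * ?Q x (\<kappa> j) s) + ?h s * (\<epsilon> * ?Q (\<kappa> k) y s) + \<epsilon> * ?Q (\<kappa> k) (\<kappa> j) s)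
       \<longlongrightarrow> ?f t x y + 0 * (\<epsilon> * C x (\<kappa> j)) + 0 * (\<epsilon> * C (\<kappa> k) y) + \<epsilon> * C (\<kappa> k) (\<kappa> j)) ?F"
      by (intro tendsto_add tendsto_mult tendsto_const lim0 h0 quot)
    then have "((\<lambda>s. ?f s x y + ?h s * (\<epsilon> * ?Q x (\<kappa> j) s) + ?h s * (\<epsilon> * ?Q (\<kappa> k) y s) + \<epsilon> * ?Q (\<kappa> k) (\<kappa> j) s)
       \<longlongrightarrow> G0 p q) ?F"
      by (simp add: G0_def direct_sum_form_def C'_def pq)
    then show ?thesis
    proof (rule Lim_transform_eventually)
      show "\<forall>\<^sub>F s in ?F. ?f s x y + ?h s * (\<epsilon> * ?Q x (\<kappa> j) s) + ?h s * (\<epsilon> * ?Q (\<kappa> k) y s) + \<epsilon> * ?Q (\<kappa> k) (\<kappa> j) s = G s p q"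
        using sb ev(3)
      proof eventually_elim
        case (elim s)
        have b: "bilinear (?f s)" using elim by (simp add: symmetric_bilinear_def)
        define h where "h = ?h s"
        have h: "h > 0" "h * h = \<epsilon> * (s - t)" using elim by (auto simp: h_def)
        have e: "\<epsilon> / (s - t) = 1 / (h * h)" using \<epsilon> elim by (auto simp: h(2) minus_divide_right)
        have "G s p q = ?f s x y + (1 / h) * ?f s x (\<kappa> j) + (1 / h) * ?f s (\<kappa> k) y + (1 / (h * h)) * ?f s (\<kappa> k) (\<kappa> j)"
          unfolding G_def g_def pq fst_conv snd_conv h_def[symmetric] by (simp add: bilinear_arith[OF b] algebra_simps)
        moreover have "\<epsilon> * ?Q u v s = (1 / (h * h)) * ?f s u v" if "?f t u v = 0" for u v
          using that e[symmetric] by simp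
        ultimately show ?case
          using z1[OF \<kappa>K, of x] z2[OF \<kappa>K, of k] z1[OF \<kappa>K, of "\<kappa> k"] h(1) unfolding h_def[symmetric] by simp
      qed
    qed
  qed
  have bG: "\<forall>\<^sub>F s in ?F. bilinear (G s)"
    using sb
  proof eventually_elim
    case (elim s)
    then have b: "bilinear (?f s)" by (simp add: symmetric_bilinear_def)
    show "bilinear (G s)" unfolding bilinear_def G_def
      by (intro conjI allI linearI) (simp_all add: bilinear_arith[OF b] linear_add[OF lg] linear_cmul[OF lg])
  qed
  have bG0: "bilinear G0" using sbG0 by (simp add: symmetric_bilinear_def)
  have sW: "subspace (UNIV \<times> ?K)" using subspace_Times[OF subspace_UNIV sK] .
  have im: "g s ` (UNIV \<times> ?K) = UNIV" for s
  proof -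
    have "x = g s (x, 0)" for x unfolding g_def using l\<kappa> by (simp add: linear_0)
    moreover have "(x, 0) \<in> UNIV \<times> ?K" for x :: 'b using subspace_0[OF sK] by simp
    ultimately show ?thesis by blast
  qed
  have CK: "C' x x = \<epsilon> * C x x" if "x \<in> ?K" for x using \<kappa>id[OF that] by (simp add: C'_def)
  have np: "n_plus (\<lambda>x. G0 x x) (UNIV \<times> ?K) = n_plus (\<lambda>x. ?f t x x) UNIV + n_plus (\<lambda>x. \<epsilon> * C x x) ?K"
    unfolding G0_def n_plus_direct_sum[OF sbt sbC' subspace_UNIV sK] using n_plus_cong[of ?K "\<lambda>x. C' x x" "\<lambda>x. \<epsilon> * C x x"] CK by simp
  have nm: "n_minus (\<lambda>x. G0 x x) (UNIV \<times> ?K) = n_minus (\<lambda>x. ?f t x x) UNIV + n_minus (\<lambda>x. \<epsilon> * C x x) ?K"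
    unfolding G0_def n_minus_direct_sum[OF sbt sbC' subspace_UNIV sK] using n_minus_cong[of ?K "\<lambda>x. C' x x" "\<lambda>x. \<epsilon> * C x x"] CK by simp
  have sbeC: "symmetric_bilinear (\<lambda>u v. \<epsilon> * C u v)"
    using C(1) symmetric_bilinear_uminus[OF C(1)] \<epsilon> by auto
  have "radical (\<lambda>u v. \<epsilon> * C u v) ?K = {0}" using nd \<epsilon> unfolding radical_def by auto
  then have syC: "n_plus (\<lambda>x. \<epsilon> * C x x) ?K + n_minus (\<lambda>x. \<epsilon> * C x x) ?K = dim ?K"
    using sylvester[OF sbeC sK] by simp
  have syt: "n_plus (\<lambda>x. ?f t x x) UNIV + n_minus (\<lambda>x. ?f t x x) UNIV + dim V + dim ?K = DIM('b)"
    using sylvester[OF sbt subspace_UNIV] dim_radical_chart_form[OF \<Omega> L0 lt V(1,2,3)] by (simp add: Int_commute)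
  \<comment> \<open>Semicontinuity bounds both indices of \<open>?f s\<close> below by those of
    \<open>G0\<close>, whose sum is already the largest possible value
    \<open>DIM('b) - dim V\<close>. Hence both bounds are equalities, and no dimension is left for
    \<open>L0 \<inter> l s\<close>.\<close>
  show ?thesis
    using eventually_n_plus_ge[OF limG bG bG0 sW] eventually_n_minus_ge[OF limG bG bG0 sW] ev(1,2) sb
  proof eventually_elim
    case (elim s)
    have q0: "?f s 0 0 = 0" using elim(5) by (simp add: symmetric_bilinear_def bilinear_arith)
    have "n_plus (\<lambda>p. G s p p) (UNIV \<times> ?K) = n_plus (\<lambda>x. ?f s x x) UNIV"
      unfolding G_def using n_plus_pullback[OF lg sW, where q="\<lambda>x. ?f s x x"] im q0 by simp
    moreover have "n_minus (\<lambda>p. G s p p) (UNIV \<times> ?K) = n_minus (\<lambda>x. ?f s x x) UNIV"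
      unfolding G_def n_minus_eq_n_plus using n_plus_pullback[OF lg sW, where q="\<lambda>x. - ?f s x x"] im q0 by simp
    moreover have "n_plus (\<lambda>x. ?f s x x) UNIV + n_minus (\<lambda>x. ?f s x x) UNIV + dim V + dim (L0 \<inter> l s) = DIM('b)"
      using sylvester[OF elim(5) subspace_UNIV] dim_radical_chart_form[OF \<Omega> L0 elim(3) V(1,2) elim(4)] by simp
    ultimately have r: "n_plus (\<lambda>x. ?f s x x) UNIV = n_plus (\<lambda>x. ?f t x x) UNIV + n_plus (\<lambda>x. \<epsilon> * C x x) ?K"
      "n_minus (\<lambda>x. ?f s x x) UNIV = n_minus (\<lambda>x. ?f t x x) UNIV + n_minus (\<lambda>x. \<epsilon> * C x x) ?K" "dim (L0 \<inter> l s) = 0"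
      using elim(1,2) np nm syC syt by linarith+
    have "subspace (l s \<inter> L0)" using elim(3) L0 by (auto intro: subspace_inter lagrangian_subspace)
    then have "l s \<inter> L0 = {0}" using r(3) subspace_0 by (fastforce simp: dim_eq_0 Int_commute)
    then show ?case using r(1,2) by (simp add: signature_def)
  qed
qed

definition crossing_signature ::
  "('b::euclidean_space \<Rightarrow> 'b \<Rightarrow> real) \<Rightarrow> 'b set \<Rightarrow> real \<Rightarrow> real \<Rightarrow> (real \<Rightarrow> 'b set) \<Rightarrow> real \<Rightarrow> int" where
  "crossing_signature \<Omega> L0 a b l t = signature (crossing_form \<Omega> a b l t) (l t \<inter> L0)"

text \<open>\<open>C\<close> is the derivative of \<open>chart_form \<Omega> V L0 (l s)\<close> at
  \<open>s = t\<close>, so it inherits symmetry from the difference quotients. It is defined on the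
  whole space and induces the crossing form on \<open>l t \<inter> L0\<close>.\<close>

lemma crossing_form_bilinear:
  fixes \<Omega> :: "'b::euclidean_space \<Rightarrow> 'b \<Rightarrow> real"
  assumes \<Omega>: "symplectic_form \<Omega>" and L0: "lagrangian \<Omega> L0" and ab: "a < b" and t: "t \<in> {a..b}"
    and l: "C1_lagr_path \<Omega> a b l" and V: "lagrangian \<Omega> V" "L0 \<inter> V = {0}" "l t \<inter> V = {0}"
  obtains E' C where "linear E'" "\<And>x. ((\<lambda>s. oblique (l s) V x) has_vector_derivative E' x) (at t within {a..b})"
    "symmetric_bilinear C" "\<And>u v. C u v = \<Omega> (oblique L0 V u) (E' v)"
    "\<And>v. v \<in> l t \<inter> L0 \<Longrightarrow> crossing_form \<Omega> a b l t v = C v v"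
proof -
  note bil = symplectic_bilinear[OF \<Omega>]
  have fam: "lagrangian_family \<Omega> {a..b} l" using l by (simp add: C1_lagr_path_def lagr_path_eq_family)
  have lag: "\<And>s. s \<in> {a..b} \<Longrightarrow> lagrangian \<Omega> (l s)" using fam by (simp add: lagrangian_family_def)
  have c0: "complementary L0 V" "complementary (l t) V" using lagrangian_complementary L0 lag[OF t] V by blast+
  have "\<exists>v. ((\<lambda>s. proj (l s) x) has_vector_derivative v) (at t within {a..b})" for x
    using l t unfolding C1_lagr_path_def by blast
  then obtain P' where P': "\<And>x. ((\<lambda>s. proj (l s) x) has_vector_derivative P' x) (at t within {a..b})" by metis
  have dims: "subspace (l s) \<and> dim (l s) = dim (l t)" if "s \<in> {a..b}" for s
    using lag[OF that] lag[OF t] unfolding lagrangian_def by simp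
  obtain E' where E': "\<And>x. ((\<lambda>s. oblique (l s) V x) has_vector_derivative E' x) (at t within {a..b})"
    using has_vector_derivative_oblique[OF c0(2) t dims P'] by blast
  let ?F = "at t within {a..b}"
  have nb: "?F \<noteq> bot" using at_within_Icc_nontrivial[OF ab t] .
  have evc: "\<forall>\<^sub>F s in ?F. lagrangian \<Omega> (l s) \<and> l s \<inter> V = {0}"
    using eventually_lagrangian[OF fam t V(1,3)] eventually_transversal[OF fam t V(1,3)] by eventually_elim simp
  have "\<forall>\<^sub>F s in ?F. linear (oblique (l s) V)"
    using evc by eventually_elim (use V(1) in \<open>blast intro: linear_oblique lagrangian_complementary\<close>)
  then have lE': "linear E'" using linear_derivative_of_linear_family[OF nb _ linear_oblique[OF c0(2)] E'] by blast
  define C where "C u v = \<Omega> (oblique L0 V u) (E' v)" for u v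
  have bC: "bilinear C" unfolding bilinear_def C_def
    by (intro conjI allI linearI)
      (simp_all add: bilinear_arith[OF bil] linear_add[OF lE'] linear_cmul[OF lE']
        linear_add[OF linear_oblique[OF c0(1)]] linear_cmul[OF linear_oblique[OF c0(1)]])
  have quot: "((\<lambda>s. (chart_form \<Omega> V L0 (l s) u v - chart_form \<Omega> V L0 (l t) u v) / (s - t)) \<longlongrightarrow> C u v) ?F" for u v
  proof -
    have "((\<lambda>s. \<Omega> (oblique L0 V u) ((1 / (s - t)) *\<^sub>R (oblique (l s) V v - oblique (l t) V v))) \<longlongrightarrow> C u v) ?F"
      unfolding C_def
      by (intro tendsto_bilinear_euclidean[OF bil] tendsto_const E'[unfolded has_vector_derivative_iff_quotient])
    then show ?thesis by (simp add: chart_form_def bilinear_arith[OF bil])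
  qed
  have sym: "C u v = C v u" for u v
  proof (rule tendsto_unique[OF nb quot])
    have "\<forall>\<^sub>F s in ?F. (chart_form \<Omega> V L0 (l s) v u - chart_form \<Omega> V L0 (l t) v u) / (s - t)
       = (chart_form \<Omega> V L0 (l s) u v - chart_form \<Omega> V L0 (l t) u v) / (s - t)"
      using evc
    proof eventually_elim
      case (elim s)
      then show ?case
        using chart_form_commute[OF \<Omega> L0 _ V(1,2), of "l s" u v] chart_form_commute[OF \<Omega> L0 lag[OF t] V(1,2,3), of u v] by simp
    qed
    then show "((\<lambda>s. (chart_form \<Omega> V L0 (l s) u v - chart_form \<Omega> V L0 (l t) u v) / (s - t)) \<longlongrightarrow> C v u) ?F"
      by (rule Lim_transform_eventually[OF quot])
  qed
  have "crossing_form \<Omega> a b l t v = C v v" if v: "v \<in> l t \<inter> L0" for v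
    using crossing_form_eq[OF \<Omega> ab t fam P' V(1,3) _ E', of v] v oblique_id[OF c0(1), of v] by (simp add: C_def)
  then show thesis using that[OF lE' E', of C] bC sym by (auto simp: symmetric_bilinear_def C_def)
qed

lemma radical_trivial_of_nondegenerate_on:
  assumes nd: "nondegenerate_on q W" and W: "subspace W" and C: "symmetric_bilinear C"
    and q: "\<And>v. v \<in> W \<Longrightarrow> q v = C v v"
  shows "radical C W = {0}"
proof -
  have bil: "bilinear C" "\<And>x y. C x y = C y x" using C by (auto simp: symmetric_bilinear_def)
  have "v = 0" if v: "v \<in> W" "\<forall>u\<in>W. C v u = 0" for v
  proof (rule ccontr)
    assume "v \<noteq> 0"
    then obtain u where u: "u \<in> W" "polar q v u \<noteq> 0" using nd v unfolding nondegenerate_on_def by blast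
    have "polar q v u = C v u"
      unfolding polar_def using q[OF v(1)] q[OF u(1)] q[OF subspace_add[OF W v(1) u(1)]] bil(2)[of u v]
      by (simp add: bilinear_arith[OF bil(1)])
    then show False using u v by simp
  qed
  then show ?thesis using subspace_0[OF W] bil(1) unfolding radical_def by (auto simp: bilinear_arith)
qed

text \<open>In a chart along a \<open>V\<close> transversal to \<open>L0\<close>, \<open>l t\<close>
  and \<open>U\<close>, the index \<open>\<tau>(L0, l s, U)\<close> differs from the signature of
  \<open>chart_form \<Omega> V L0 (l s)\<close> by a locally constant amount, and
  \<open>chart_form_one_sided\<close> gives the change of that signature on either side. A crossing
  counts twice when passed through and once when the path starts or ends there.\<close>

lemma maslov_potential_near_crossing:
  fixes \<Omega> :: "'b::euclidean_space \<Rightarrow> 'b \<Rightarrow> real"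
  assumes \<Omega>: "symplectic_form \<Omega>" and L0: "lagrangian \<Omega> L0" and ab: "a < b" and t: "t \<in> {a..b}"
    and l: "C1_lagr_path \<Omega> a b l" and r: "regular_crossings \<Omega> L0 a b l"
    and m: "maslov_potential \<Omega> L0 {a..b} l m"
  shows "\<forall>\<^sub>F s in at t within {a..b}. l s \<inter> L0 = {0}
      \<and> (t < s \<longrightarrow> m s = m t + crossing_signature \<Omega> L0 a b l t)
      \<and> (s < t \<longrightarrow> m s = m t - crossing_signature \<Omega> L0 a b l t)" (is ?A)
    and "n_plus (crossing_form \<Omega> a b l t) (l t \<inter> L0) + n_minus (crossing_form \<Omega> a b l t) (l t \<inter> L0) = dim (l t \<inter> L0)" (is ?B)
proof -
  have fam: "lagrangian_family \<Omega> {a..b} l" using l by (simp add: C1_lagr_path_def lagr_path_eq_family)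
  have lt: "lagrangian \<Omega> (l t)" using fam t by (simp add: lagrangian_family_def)
  obtain U where U: "lagrangian \<Omega> U" "l t \<inter> U = {0}"
    using transversal_lagrangian_exists[OF \<Omega> lt] by blast
  have "\<exists>V. lagrangian \<Omega> V \<and> (\<forall>L\<in>{L0, l t, U}. V \<inter> L = {0})"
    by (rule common_transversal_lagrangian[OF \<Omega>]) (use lt L0 U in auto)
  then obtain V where V: "lagrangian \<Omega> V" "L0 \<inter> V = {0}" "l t \<inter> V = {0}" "U \<inter> V = {0}" by blast
  obtain E' C where E': "linear E'" "\<And>x. ((\<lambda>s. oblique (l s) V x) has_vector_derivative E' x) (at t within {a..b})"
    and C: "symmetric_bilinear C" "\<And>u v. C u v = \<Omega> (oblique L0 V u) (E' v)"
    and cf: "\<And>v. v \<in> l t \<inter> L0 \<Longrightarrow> crossing_form \<Omega> a b l t v = C v v"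
    by (rule crossing_form_bilinear[OF \<Omega> L0 ab t l V(1,2,3)]) blast
  have sK: "subspace (l t \<inter> L0)" using lt L0 by (auto intro: subspace_inter lagrangian_subspace)
  have "nondegenerate_on (crossing_form \<Omega> a b l t) (l t \<inter> L0)"
    using r t unfolding regular_crossings_def crossing_def by (cases "l t \<inter> L0 = {0}") (auto simp: nondegenerate_on_def)
  then have nd: "radical C (l t \<inter> L0) = {0}" using radical_trivial_of_nondegenerate_on[OF _ sK C(1) cf] by blast
  show ?B
    using n_plus_cong[of "l t \<inter> L0" "crossing_form \<Omega> a b l t" "\<lambda>v. C v v"]
      n_minus_cong[of "l t \<inter> L0" "crossing_form \<Omega> a b l t" "\<lambda>v. C v v"] cf sylvester[OF C(1) sK] nd by simp
  let ?f = "\<lambda>s. signature (\<lambda>x. chart_form \<Omega> V L0 (l s) x x) UNIV"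
  have sg: "signature (\<lambda>x. C x x) (l t \<inter> L0) = crossing_signature \<Omega> L0 a b l t"
    unfolding crossing_signature_def using signature_cong[of "l t \<inter> L0" "crossing_form \<Omega> a b l t" "\<lambda>v. C v v"] cf by simp
  have ms: "\<forall>\<^sub>F s in at t within {a..b}. m s - m t = ?f s - ?f t"
    using maslov_potential_any[OF \<Omega> L0 fam m t U] eventually_signature_chart_form[OF \<Omega> fam t V(1,3) U(1) V(4) U(2)]
      eventually_lagrangian[OF fam t U] eventually_transversal[OF fam t V(1,3)]
  proof eventually_elim
    case (elim s)
    then show ?case
      using kashiwara_eq_sum[OF \<Omega> L0 elim(3) U(1) V(1,2) elim(4) V(4)] kashiwara_eq_sum[OF \<Omega> L0 lt U(1) V(1,2,3,4)] by simp
  qed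
  have "\<forall>\<^sub>F s in at t within {s \<in> {a..b}. 1 * (s - t) > 0}. ?f s = ?f t + signature (\<lambda>x. 1 * C x x) (l t \<inter> L0) \<and> l s \<inter> L0 = {0}"
    by (rule chart_form_one_sided[OF \<Omega> L0 t fam V(1,2,3) E' _ C nd]) simp
  moreover have "\<forall>\<^sub>F s in at t within {s \<in> {a..b}. - 1 * (s - t) > 0}. ?f s = ?f t + signature (\<lambda>x. - 1 * C x x) (l t \<inter> L0) \<and> l s \<inter> L0 = {0}"
    by (rule chart_form_one_sided[OF \<Omega> L0 t fam V(1,2,3) E' _ C nd]) simp
  ultimately show ?A
    using ms unfolding eventually_at_filter
  proof eventually_elim
    case (elim s)
    have sg': "signature (\<lambda>x. - 1 * C x x) (l t \<inter> L0) = - crossing_signature \<Omega> L0 a b l t"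
      "signature (\<lambda>x. 1 * C x x) (l t \<inter> L0) = crossing_signature \<Omega> L0 a b l t"
      using sg signature_uminus[of "\<lambda>x. C x x" "l t \<inter> L0"] by simp_all
    show ?case
    proof (intro impI)
      assume s: "s \<noteq> t" "s \<in> {a..b}"
      have ms: "m s - m t = ?f s - ?f t" using elim(3) s by blast
      show "l s \<inter> L0 = {0} \<and> (t < s \<longrightarrow> m s = m t + crossing_signature \<Omega> L0 a b l t)
         \<and> (s < t \<longrightarrow> m s = m t - crossing_signature \<Omega> L0 a b l t)"
      proof (cases "t < s")
        case True
        then have "?f s = ?f t + crossing_signature \<Omega> L0 a b l t \<and> l s \<inter> L0 = {0}"
          using elim(1) s unfolding sg' by simp
        then show ?thesis using ms True by simp
      next
        case False
        then have "?f s = ?f t + - crossing_signature \<Omega> L0 a b l t \<and> l s \<inter> L0 = {0}"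
          using elim(2) s unfolding sg' by simp
        then show ?thesis using ms False by simp
      qed
    qed
  qed
qed

text \<open>The preceding lemma isolates each crossing, and the interval is compact.\<close>

lemma finite_regular_crossings:
  fixes \<Omega> :: "'b::euclidean_space \<Rightarrow> 'b \<Rightarrow> real"
  assumes \<Omega>: "symplectic_form \<Omega>" and L0: "lagrangian \<Omega> L0" and ab: "a < b"
    and l: "C1_lagr_path \<Omega> a b l" and r: "regular_crossings \<Omega> L0 a b l"
  shows "finite {t \<in> {a..b}. crossing L0 l t}"
proof -
  have fam: "lagrangian_family \<Omega> {a..b} l" using l by (simp add: C1_lagr_path_def lagr_path_eq_family)
  obtain m where m: "maslov_potential \<Omega> L0 {a..b} l m"
    using maslov_potential_exists[OF \<Omega> L0 fam] by auto
  have "finite ({a..b} \<inter> {t \<in> {a..b}. crossing L0 l t})"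
  proof (rule finite_not_islimpt_in_compact)
    fix t assume t: "t \<in> {a..b}"
    have "\<forall>\<^sub>F s in at t within {a..b}. \<not> crossing L0 l s"
      using maslov_potential_near_crossing(1)[OF \<Omega> L0 ab t l r m] by eventually_elim (simp add: crossing_def)
    then have "\<forall>\<^sub>F s in at t. s \<notin> {t \<in> {a..b}. crossing L0 l t}"
      unfolding eventually_at_filter by eventually_elim auto
    then show "\<not> t islimpt {t \<in> {a..b}. crossing L0 l t}"
      by (simp add: islimpt_iff_eventually)
  qed simp
  moreover have "{a..b} \<inter> {t \<in> {a..b}. crossing L0 l t} = {t \<in> {a..b}. crossing L0 l t}" by blast
  ultimately show ?thesis by simp
qed

text \<open>Since \<open>n_plus + n_minus\<close> is the dimension of the intersection, the endpoint
  signatures are \<open>2 * n_plus - dim\<close> at \<open>a\<close> and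
  \<open>dim - 2 * n_minus\<close> at \<open>b\<close>. So the asymmetric endpoint convention of
  \<open>crossing_sum\<close> turns into the two dimension terms.\<close>

lemma maslov_potential_crossing_sum:
  fixes \<Omega> :: "'b::euclidean_space \<Rightarrow> 'b \<Rightarrow> real"
  assumes \<Omega>: "symplectic_form \<Omega>" and L0: "lagrangian \<Omega> L0" and ab: "a < b"
    and l: "C1_lagr_path \<Omega> a b l" and r: "regular_crossings \<Omega> L0 a b l"
    and m: "maslov_potential \<Omega> L0 {a..b} l m"
  shows "m b - m a = 2 * crossing_sum \<Omega> L0 a b l + int (dim (l b \<inter> L0)) - int (dim (l a \<inter> L0))"
proof -
  define C where "C = {t \<in> {a..b}. crossing L0 l t}"
  have fin: "finite C" unfolding C_def by (rule finite_regular_crossings[OF \<Omega> L0 ab l r])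
  let ?\<sigma> = "crossing_signature \<Omega> L0 a b l"
  have \<sigma>0: "?\<sigma> t = 0" if "l t \<inter> L0 = {0}" for t
    using that by (simp add: crossing_signature_def signature_trivial)
  \<comment> \<open>Counts crossings strictly before \<open>t\<close> with both of their sides. In
    \<open>m - S - ?\<sigma>\<close> the term \<open>?\<sigma> t\<close> accounts for the first side
    when \<open>t\<close> itself is a crossing, which makes this function locally constant.\<close>
  define S where "S t = (\<Sum>c\<in>C. if c < t then 2 * ?\<sigma> c else 0)" for t
  have "(\<lambda>t. m t - S t - ?\<sigma> t) a = (\<lambda>t. m t - S t - ?\<sigma> t) b"
  proof (rule connected_local_const[of "{a..b}"])
    show "connected {a..b}" "a \<in> {a..b}" "b \<in> {a..b}" using ab by auto
    show "\<forall>t\<in>{a..b}. \<forall>\<^sub>F s in at t within {a..b}. m t - S t - ?\<sigma> t = m s - S s - ?\<sigma> s"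
    proof
      fix t assume t: "t \<in> {a..b}"
      obtain d where d: "d > 0" "\<And>s. s \<in> {a..b} \<Longrightarrow> s \<noteq> t \<Longrightarrow> dist s t < d \<Longrightarrow> l s \<inter> L0 = {0}
        \<and> (t < s \<longrightarrow> m s = m t + ?\<sigma> t) \<and> (s < t \<longrightarrow> m s = m t - ?\<sigma> t)"
        using maslov_potential_near_crossing(1)[OF \<Omega> L0 ab t l r m] unfolding eventually_at by blast
      have noC: "s \<notin> C" if "s \<noteq> t" "dist s t < d" for s
        using d(2)[of s] that by (auto simp: C_def crossing_def)
      show "\<forall>\<^sub>F s in at t within {a..b}. m t - S t - ?\<sigma> t = m s - S s - ?\<sigma> s"
        unfolding eventually_at
      proof (intro exI[of _ d] conjI ballI impI)
        fix s assume s: "s \<in> {a..b}" "s \<noteq> t \<and> dist s t < d"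
        note ds = d(2)[OF s(1)] 
        have \<sigma>s: "?\<sigma> s = 0" using ds s \<sigma>0 by blast
        show "m t - S t - ?\<sigma> t = m s - S s - ?\<sigma> s"
        proof (cases "t < s")
          case True
          have "S s = (\<Sum>c\<in>C. (if c < t then 2 * ?\<sigma> c else 0) + (if c = t then 2 * ?\<sigma> t else 0))"
            unfolding S_def
          proof (rule sum.cong[OF refl])
            fix c assume c: "c \<in> C"
            have "\<not> (t < c \<and> c < s)" using noC[of c] c s True by (auto simp: dist_real_def)
            then show "(if c < s then 2 * ?\<sigma> c else 0) = (if c < t then 2 * ?\<sigma> c else 0) + (if c = t then 2 * ?\<sigma> t else 0)"
              using True by auto
          qed
          also have "\<dots> = S t + (if t \<in> C then 2 * ?\<sigma> t else 0)"
            by (simp add: sum.distrib S_def sum.delta[OF fin])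
          also have "(if t \<in> C then 2 * ?\<sigma> t else 0) = 2 * ?\<sigma> t"
            using \<sigma>0[of t] t by (auto simp: C_def crossing_def)
          finally show ?thesis using ds s True \<sigma>s by simp
        next
          case False
          then have "s < t" using s by simp
          have "S s = S t" unfolding S_def
          proof (rule sum.cong[OF refl])
            fix c assume c: "c \<in> C"
            have "\<not> (s \<le> c \<and> c < t)" using noC[of c] c s \<open>s < t\<close> by (auto simp: dist_real_def)
            then show "(if c < s then 2 * ?\<sigma> c else 0) = (if c < t then 2 * ?\<sigma> c else 0)"
              using \<open>s < t\<close> by auto
          qed
          then show ?thesis using ds s \<open>s < t\<close> \<sigma>s by simp
        qed
      qed (use d in auto)
    qed
  qed
  then have e: "m a - S a - ?\<sigma> a = m b - S b - ?\<sigma> b" by simp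
  have Sa: "S a = 0" unfolding S_def by (rule sum.neutral) (auto simp: C_def)
  let ?I = "{t. a < t \<and> t < b \<and> crossing L0 l t}"
  have finI: "finite ?I" by (rule finite_subset[OF _ fin]) (auto simp: C_def)
  have "S b = (\<Sum>c\<in>{c \<in> C. c < b}. 2 * ?\<sigma> c)" unfolding S_def by (simp add: sum.inter_filter[OF fin])
  \<comment> \<open>\<open>a\<close> may be added even if it is no crossing, since
    \<open>?\<sigma>\<close> is 0 there.\<close>
  also have "\<dots> = (\<Sum>c\<in>insert a ?I. 2 * ?\<sigma> c)"
  proof (rule sum.mono_neutral_left)
    show "finite (insert a ?I)" using finI by simp
    show "{c \<in> C. c < b} \<subseteq> insert a ?I" by (auto simp: C_def)
    show "\<forall>i\<in>insert a ?I - {c \<in> C. c < b}. 2 * ?\<sigma> i = 0"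
      using ab \<sigma>0 by (auto simp: C_def crossing_def)
  qed
  also have "\<dots> = 2 * ?\<sigma> a + 2 * (\<Sum>c\<in>?I. ?\<sigma> c)"
    using finI by (simp add: sum_distrib_left)
  finally have Sb: "S b = 2 * ?\<sigma> a + 2 * (\<Sum>c\<in>?I. ?\<sigma> c)" .
  have na: "n_plus (crossing_form \<Omega> a b l a) (l a \<inter> L0) + n_minus (crossing_form \<Omega> a b l a) (l a \<inter> L0) = dim (l a \<inter> L0)"
    using maslov_potential_near_crossing(2)[OF \<Omega> L0 ab _ l r m, of a] ab by simp
  have nb: "n_plus (crossing_form \<Omega> a b l b) (l b \<inter> L0) + n_minus (crossing_form \<Omega> a b l b) (l b \<inter> L0) = dim (l b \<inter> L0)"
    using maslov_potential_near_crossing(2)[OF \<Omega> L0 ab _ l r m, of b] ab by simp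
  have "m b - m a = ?\<sigma> a + ?\<sigma> b + 2 * (\<Sum>c\<in>?I. ?\<sigma> c)" using e Sa Sb by linarith
  moreover have "crossing_sum \<Omega> L0 a b l = int (n_plus (crossing_form \<Omega> a b l a) (l a \<inter> L0)) + (\<Sum>c\<in>?I. ?\<sigma> c)
      - int (n_minus (crossing_form \<Omega> a b l b) (l b \<inter> L0))"
    unfolding crossing_sum_def crossing_signature_def by simp
  moreover have "?\<sigma> a = 2 * int (n_plus (crossing_form \<Omega> a b l a) (l a \<inter> L0)) - int (dim (l a \<inter> L0))"
    unfolding crossing_signature_def signature_def using na by linarith
  moreover have "?\<sigma> b = int (dim (l b \<inter> L0)) - 2 * int (n_minus (crossing_form \<Omega> a b l b) (l b \<inter> L0))"
    unfolding crossing_signature_def signature_def using nb by linarith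
  ultimately show ?thesis by linarith
qed

section \<open>Paths with definite crossings\<close>

text \<open>Definiteness is easier to arrange than nondegeneracy and implies it. The sign may change
  from one crossing to the next, as it does on the detours below; by \<open>crossing_form_eq\<close>
  it can be read off in any chart.\<close>

definition definite_crossing_at ::
  "('b::euclidean_space \<Rightarrow> 'b \<Rightarrow> real) \<Rightarrow> 'b set \<Rightarrow> real set \<Rightarrow> (real \<Rightarrow> 'b set) \<Rightarrow> real \<Rightarrow> bool" where
  "definite_crossing_at \<Omega> L0 S l t \<longleftrightarrow> (\<exists>U E'. lagrangian \<Omega> U \<and> l t \<inter> U = {0} \<and>
     (\<forall>x. ((\<lambda>s. oblique (l s) U x) has_vector_derivative E' x) (at t within S)) \<and>
     ((\<forall>v\<in>l t \<inter> L0. v \<noteq> 0 \<longrightarrow> \<Omega> v (E' v) > 0) \<or> (\<forall>v\<in>l t \<inter> L0. v \<noteq> 0 \<longrightarrow> \<Omega> v (E' v) < 0)))"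

text \<open>The flags \<open>fa\<close>, \<open>fb\<close> record that the path has zero velocity at the endpoint, so that it can be
  continued in a continuously differentiable way.\<close>
definition path_velocity ::
  "real \<Rightarrow> real \<Rightarrow> (real \<Rightarrow> 'b::euclidean_space set) \<Rightarrow> bool \<Rightarrow> bool \<Rightarrow> (real \<Rightarrow> 'b \<Rightarrow> 'b) \<Rightarrow> bool" where
  "path_velocity a b l fa fb D \<longleftrightarrow> (\<forall>x. continuous_on {a..b} (\<lambda>t. D t x)) \<and>
     (\<forall>t\<in>{a..b}. \<forall>x. ((\<lambda>s. proj (l s) x) has_vector_derivative D t x) (at t within {a..b})) \<and>
     (fa \<longrightarrow> (\<forall>x. D a x = 0)) \<and> (fb \<longrightarrow> (\<forall>x. D b x = 0))"

definition definite_path ::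
  "('b::euclidean_space \<Rightarrow> 'b \<Rightarrow> real) \<Rightarrow> 'b set \<Rightarrow> real \<Rightarrow> real \<Rightarrow> (real \<Rightarrow> 'b set) \<Rightarrow> bool \<Rightarrow> bool \<Rightarrow> bool" where
  "definite_path \<Omega> L0 a b l fa fb \<longleftrightarrow> (\<forall>t\<in>{a..b}. lagrangian \<Omega> (l t)) \<and> (\<exists>D. path_velocity a b l fa fb D) \<and>
     (\<forall>t\<in>{a..b}. l t \<inter> L0 = {0} \<or> definite_crossing_at \<Omega> L0 {a..b} l t)"

lemma definite_path_C1:
  assumes "definite_path \<Omega> L0 a b l fa fb"
  shows "C1_lagr_path \<Omega> a b l"
proof -
  obtain D where "path_velocity a b l fa fb D" using assms unfolding definite_path_def by blast
  then have D: "\<And>x. continuous_on {a..b} (\<lambda>t. D t x)"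
    "\<And>t x. t \<in> {a..b} \<Longrightarrow> ((\<lambda>s. proj (l s) x) has_vector_derivative D t x) (at t within {a..b})"
    unfolding path_velocity_def by blast+
  have "continuous_on {a..b} (\<lambda>t. proj (l t) x)" for x
    unfolding continuous_on_def using tendsto_of_has_vector_derivative[OF D(2)] by blast
  moreover have "\<forall>t\<in>{a..b}. lagrangian \<Omega> (l t)" using assms unfolding definite_path_def by (rule conjunct1)
  moreover have "\<exists>D'. continuous_on {a..b} D' \<and>
      (\<forall>t\<in>{a..b}. ((\<lambda>s. proj (l s) x) has_vector_derivative D' t) (at t within {a..b}))" for x
    using D by (intro exI[of _ "\<lambda>t. D t x"]) blast
  ultimately show ?thesis unfolding C1_lagr_path_def lagr_path_def by blast
qed

lemma definite_path_regular:
  fixes \<Omega> :: "'b::euclidean_space \<Rightarrow> 'b \<Rightarrow> real"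
  assumes \<Omega>: "symplectic_form \<Omega>" and L0: "lagrangian \<Omega> L0" and ab: "a < b"
    and g: "definite_path \<Omega> L0 a b l fa fb"
  shows "regular_crossings \<Omega> L0 a b l"
  unfolding regular_crossings_def
proof (intro ballI impI)
  note bil = symplectic_bilinear[OF \<Omega>]
  fix t assume t: "t \<in> {a..b}" and cr: "crossing L0 l t"
  have fam: "lagrangian_family \<Omega> {a..b} l"
    using definite_path_C1[OF g] by (simp add: C1_lagr_path_def lagr_path_eq_family)
  have lag: "\<And>s. s \<in> {a..b} \<Longrightarrow> lagrangian \<Omega> (l s)" using fam by (simp add: lagrangian_family_def)
  obtain D where "path_velocity a b l fa fb D" using g unfolding definite_path_def by blast
  then have D: "\<And>t x. t \<in> {a..b} \<Longrightarrow> ((\<lambda>s. proj (l s) x) has_vector_derivative D t x) (at t within {a..b})"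
    unfolding path_velocity_def by blast
  have "definite_crossing_at \<Omega> L0 {a..b} l t" using g t cr unfolding definite_path_def crossing_def by blast
  then obtain U E' where U: "lagrangian \<Omega> U" "l t \<inter> U = {0}"
    and E': "\<And>x. ((\<lambda>s. oblique (l s) U x) has_vector_derivative E' x) (at t within {a..b})"
    and sgn: "(\<forall>v\<in>l t \<inter> L0. v \<noteq> 0 \<longrightarrow> \<Omega> v (E' v) > 0) \<or> (\<forall>v\<in>l t \<inter> L0. v \<noteq> 0 \<longrightarrow> \<Omega> v (E' v) < 0)"
    unfolding definite_crossing_at_def by blast
  have cf: "crossing_form \<Omega> a b l t v = \<Omega> v (E' v)" if "v \<in> l t" for v
    using crossing_form_eq[OF \<Omega> ab t fam D[OF t] U that E'] .
  have "\<forall>\<^sub>F s in at t within {a..b}. linear (oblique (l s) U)"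
    using eventually_lagrangian[OF fam t U] eventually_transversal[OF fam t U]
    by eventually_elim (use U(1) in \<open>blast intro: linear_oblique lagrangian_complementary\<close>)
  then have lE': "linear E'"
    using linear_derivative_of_linear_family[OF at_within_Icc_nontrivial[OF ab t] _ linear_oblique E']
      lagrangian_complementary[OF lag[OF t] U] by blast
  show "nondegenerate_on (crossing_form \<Omega> a b l t) (l t \<inter> L0)"
    unfolding nondegenerate_on_def
  proof (intro ballI impI)
    fix v assume v: "v \<in> l t \<inter> L0" "v \<noteq> 0"
    have vv: "v + v \<in> l t" using v lagrangian_subspace[OF lag[OF t]] by (blast intro: subspace_add)
    have "polar (crossing_form \<Omega> a b l t) v v = \<Omega> v (E' v)"
      unfolding polar_def using cf[OF vv] cf[of v] v
      by (simp add: linear_add[OF lE'] bilinear_arith[OF bil])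
    moreover have "\<Omega> v (E' v) \<noteq> 0" using sgn v by fastforce
    ultimately show "\<exists>u\<in>l t \<inter> L0. polar (crossing_form \<Omega> a b l t) v u \<noteq> 0" using v by metis
  qed
qed

lemma has_vector_derivative_glue:
  fixes f :: "real \<Rightarrow> 'c::real_normed_vector"
  assumes t: "t \<in> {a..b}" and c: "a \<le> c" "c \<le> b"
    and f: "\<And>s. s \<in> {a..c} \<Longrightarrow> f s = f1 s" "\<And>s. s \<in> {c..b} \<Longrightarrow> f s = f2 s"
    and d: "t \<in> {a..c} \<Longrightarrow> (f1 has_vector_derivative d) (at t within {a..c})"
      "t \<in> {c..b} \<Longrightarrow> (f2 has_vector_derivative d) (at t within {c..b})"
  shows "(f has_vector_derivative d) (at t within {a..b})"
proof -
  have 1: "(f has_vector_derivative d) (at t within {a..c})"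
  proof (cases "t \<in> {a..c}")
    case True
    then show ?thesis using has_vector_derivative_transform[OF True _ d(1)[OF True]] f(1) by blast
  next
    case False
    \<comment> \<open>At a point outside a closed interval the filter is trivial, so every
      derivative statement holds.\<close>
    then have "at t within {a..c} = bot"
      using at_within_eq_bot_iff[of t "{a..c}"] by (metis Diff_empty Diff_insert0 atLeastAtMost_iff closed_atLeastAtMost closure_closed)
    then show ?thesis unfolding has_vector_derivative_iff_quotient by simp
  qed
  have 2: "(f has_vector_derivative d) (at t within {c..b})"
  proof (cases "t \<in> {c..b}")
    case True
    then show ?thesis using has_vector_derivative_transform[OF True _ d(2)[OF True]] f(2) by blast
  next
    case False
    then have "at t within {c..b} = bot"
      using at_within_eq_bot_iff[of t "{c..b}"] by (metis Diff_empty Diff_insert0 atLeastAtMost_iff closed_atLeastAtMost closure_closed)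
    then show ?thesis unfolding has_vector_derivative_iff_quotient by simp
  qed
  have "{a..b} = {a..c} \<union> {c..b}" using c by auto
  then have "at t within {a..b} = sup (at t within {a..c}) (at t within {c..b})" by (simp add: at_within_union)
  then show ?thesis
    using 1 2 unfolding has_vector_derivative_iff_quotient by (simp add: filterlim_sup)
qed

text \<open>Both velocities vanish at \<open>c\<close>, so they fit together. As \<open>c\<close> is
  no crossing, definiteness, witnessed by different charts on the two sides, need not be checked
  there.\<close>

lemma definite_path_glue:
  fixes \<Omega> :: "'b::euclidean_space \<Rightarrow> 'b \<Rightarrow> real"
  assumes g1: "definite_path \<Omega> L0 a c l1 fa True" and g2: "definite_path \<Omega> L0 c b l2 True fb"
    and e: "l1 c = l2 c" and c: "a < c" "c < b" and nc: "l1 c \<inter> L0 = {0}"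
  shows "definite_path \<Omega> L0 a b (\<lambda>t. if t \<le> c then l1 t else l2 t) fa fb"
proof -
  let ?l = "\<lambda>t. if t \<le> c then l1 t else l2 t"
  have l1: "?l t = l1 t" if "t \<in> {a..c}" for t using that by auto
  have l2: "?l t = l2 t" if "t \<in> {c..b}" for t using that e by (cases "t = c") auto
  obtain D1 where "path_velocity a c l1 fa True D1" using g1 unfolding definite_path_def by blast
  then have D1: "\<And>x. continuous_on {a..c} (\<lambda>t. D1 t x)"
    "\<And>t x. t \<in> {a..c} \<Longrightarrow> ((\<lambda>s. proj (l1 s) x) has_vector_derivative D1 t x) (at t within {a..c})"
    "fa \<Longrightarrow> \<forall>x. D1 a x = 0" "\<And>x. D1 c x = 0"
    unfolding path_velocity_def by blast+
  obtain D2 where "path_velocity c b l2 True fb D2" using g2 unfolding definite_path_def by blast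
  then have D2: "\<And>x. continuous_on {c..b} (\<lambda>t. D2 t x)"
    "\<And>t x. t \<in> {c..b} \<Longrightarrow> ((\<lambda>s. proj (l2 s) x) has_vector_derivative D2 t x) (at t within {c..b})"
    "\<And>x. D2 c x = 0" "fb \<Longrightarrow> \<forall>x. D2 b x = 0"
    unfolding path_velocity_def by blast+
  define D where "D t = (if t \<le> c then D1 t else D2 t)" for t
  have Dc: "D t = D2 t" if "c \<le> t" for t using that D1(4) D2(3) by (cases "t = c") (auto simp: D_def)
  have lag1: "\<And>t. t \<in> {a..c} \<Longrightarrow> lagrangian \<Omega> (l1 t)" and lag2: "\<And>t. t \<in> {c..b} \<Longrightarrow> lagrangian \<Omega> (l2 t)"
    using g1 g2 unfolding definite_path_def by blast+
  have "\<forall>t\<in>{a..b}. lagrangian \<Omega> (?l t)" using lag1 lag2 by auto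
  moreover have "continuous_on {a..b} (\<lambda>t. D t x)" for x
  proof -
    have "continuous_on ({a..c} \<union> {c..b}) (\<lambda>t. if t \<le> c then D1 t x else D2 t x)"
      by (rule continuous_on_cases) (use D1 D2 in auto)
    moreover have "{a..b} = {a..c} \<union> {c..b}" using c by auto
    ultimately show ?thesis by (simp add: D_def if_distrib[of "\<lambda>f. f x"] cong: if_cong)
  qed
  moreover have "((\<lambda>s. proj (?l s) x) has_vector_derivative D t x) (at t within {a..b})" if t: "t \<in> {a..b}" for x t
  proof (rule has_vector_derivative_glue[OF t, of c])
    show "a \<le> c" "c \<le> b" using c by auto
    show "proj (?l s) x = proj (l1 s) x" if "s \<in> {a..c}" for s using l1[OF that] by simp
    show "proj (?l s) x = proj (l2 s) x" if "s \<in> {c..b}" for s using l2[OF that] by simp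
    show "((\<lambda>s. proj (l1 s) x) has_vector_derivative D t x) (at t within {a..c})" if "t \<in> {a..c}"
      using D1(2)[OF that] that by (simp add: D_def)
    show "((\<lambda>s. proj (l2 s) x) has_vector_derivative D t x) (at t within {c..b})" if "t \<in> {c..b}"
      using D2(2)[OF that] that Dc by simp
  qed
  moreover have "fa \<longrightarrow> (\<forall>x. D a x = 0)" "fb \<longrightarrow> (\<forall>x. D b x = 0)"
    using D1(3) D2(4) c by (auto simp: D_def)
  moreover have "?l t \<inter> L0 = {0} \<or> definite_crossing_at \<Omega> L0 {a..b} ?l t" if t: "t \<in> {a..b}" for t
  proof (cases "t = c")
    case True
    then show ?thesis using nc by simp
  next
    case False
    show ?thesis
    proof (cases "t < c")
      case True
      then have tt: "t \<in> {a..c}" using t by auto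
      have "l1 t \<inter> L0 = {0} \<or> definite_crossing_at \<Omega> L0 {a..c} l1 t" using g1 tt unfolding definite_path_def by blast
      moreover have "definite_crossing_at \<Omega> L0 {a..b} ?l t" if d: "definite_crossing_at \<Omega> L0 {a..c} l1 t"
      proof -
        have "((\<lambda>s. oblique (?l s) U x) has_vector_derivative v) (at t within {a..b})"
          if h: "((\<lambda>s. oblique (l1 s) U x) has_vector_derivative v) (at t within {a..c})" for U x v
          by (rule has_vector_derivative_glue[OF t, of c _ "\<lambda>s. oblique (l1 s) U x" "\<lambda>s. oblique (l2 s) U x"])
            (use l1 l2 c True h in auto)
        moreover obtain U E' where "lagrangian \<Omega> U" "l1 t \<inter> U = {0}"
          "\<forall>x. ((\<lambda>s. oblique (l1 s) U x) has_vector_derivative E' x) (at t within {a..c})"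
          "(\<forall>v\<in>l1 t \<inter> L0. v \<noteq> 0 \<longrightarrow> \<Omega> v (E' v) > 0) \<or> (\<forall>v\<in>l1 t \<inter> L0. v \<noteq> 0 \<longrightarrow> \<Omega> v (E' v) < 0)"
          using d unfolding definite_crossing_at_def by blast
        ultimately show ?thesis
          unfolding definite_crossing_at_def l1[OF tt] by (intro exI[of _ U] exI[of _ E'] conjI allI) auto
      qed
      ultimately show ?thesis using l1[OF tt] by auto
    next
      case F: False
      then have tt: "t \<in> {c..b}" using t by auto
      have "l2 t \<inter> L0 = {0} \<or> definite_crossing_at \<Omega> L0 {c..b} l2 t" using g2 tt unfolding definite_path_def by blast
      moreover have "definite_crossing_at \<Omega> L0 {a..b} ?l t" if d: "definite_crossing_at \<Omega> L0 {c..b} l2 t"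
      proof -
        have "((\<lambda>s. oblique (?l s) U x) has_vector_derivative v) (at t within {a..b})"
          if h: "((\<lambda>s. oblique (l2 s) U x) has_vector_derivative v) (at t within {c..b})" for U x v
          by (rule has_vector_derivative_glue[OF t, of c _ "\<lambda>s. oblique (l1 s) U x" "\<lambda>s. oblique (l2 s) U x"])
            (use l1 l2 c F False h in auto)
        moreover obtain U E' where "lagrangian \<Omega> U" "l2 t \<inter> U = {0}"
          "\<forall>x. ((\<lambda>s. oblique (l2 s) U x) has_vector_derivative E' x) (at t within {c..b})"
          "(\<forall>v\<in>l2 t \<inter> L0. v \<noteq> 0 \<longrightarrow> \<Omega> v (E' v) > 0) \<or> (\<forall>v\<in>l2 t \<inter> L0. v \<noteq> 0 \<longrightarrow> \<Omega> v (E' v) < 0)"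
          using d unfolding definite_crossing_at_def by blast
        ultimately show ?thesis
          unfolding definite_crossing_at_def l2[OF tt] by (intro exI[of _ U] exI[of _ E'] conjI allI) auto
      qed
      ultimately show ?thesis using l2[OF tt] by auto
    qed
  qed
  ultimately have "path_velocity a b ?l fa fb D" "\<forall>t\<in>{a..b}. lagrangian \<Omega> (?l t)"
      "\<forall>t\<in>{a..b}. ?l t \<inter> L0 = {0} \<or> definite_crossing_at \<Omega> L0 {a..b} ?l t"
    unfolding path_velocity_def by blast+
  then show ?thesis unfolding definite_path_def by blast
qed

section \<open>Straight segments in a chart\<close>

lemma lagrangian_of_projection:
  fixes \<Omega> :: "'b::euclidean_space \<Rightarrow> 'b \<Rightarrow> real"
  assumes U: "lagrangian \<Omega> U" and lE: "linear E" and d: "\<And>x. x - E x \<in> U"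
    and zero: "\<And>x. x \<in> U \<Longrightarrow> E x = 0" and iso: "\<And>x y. \<Omega> (E x) (E y) = 0"
  shows "lagrangian \<Omega> (range E)" "range E \<inter> U = {0}" "oblique (range E) U = E"
proof -
  have EE: "E (E x) = E x" for x using zero[OF d[of x]] by (simp add: linear_diff[OF lE])
  have sU: "subspace U" using U by (rule lagrangian_subspace)
  show tr: "range E \<inter> U = {0}"
  proof -
    have "E x = 0" if "E x \<in> U" for x using zero[OF that] EE by simp
    moreover have "0 \<in> range E" by (metis lE linear_0 rangeI)
    ultimately show ?thesis using subspace_0[OF sU] by auto
  qed
  have s: "subspace (range E)" using lE subspace_UNIV by (rule linear_subspace_image)
  have "{x \<in> UNIV. E x = 0} = U"
  proof -
    have "x \<in> U" if "E x = 0" for x using d[of x] that by simp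
    then show ?thesis using zero by blast
  qed
  then have "dim (range E) + dim U = DIM('b)" using rank_nullity_on[OF lE subspace_UNIV] by simp
  then have "2 * dim (range E) = DIM('b)" using U by (simp add: lagrangian_def)
  then show lag: "lagrangian \<Omega> (range E)" unfolding lagrangian_def using s iso by auto
  show "oblique (range E) U = E"
    using oblique_unique[OF lagrangian_complementary[OF lag U tr]] d by (intro ext) blast
qed

text \<open>The Lagrangians transversal to \<open>U\<close> form an affine space with the
  projections along \<open>U\<close> as coordinates; this is its straight line through
  \<open>A\<close> and \<open>B\<close>.\<close>

definition chart_segment :: "'b::euclidean_space set \<Rightarrow> 'b set \<Rightarrow> 'b set \<Rightarrow> real \<Rightarrow> 'b \<Rightarrow> 'b" where
  "chart_segment U A B r x = oblique A U x + r *\<^sub>R (oblique B U x - oblique A U x)"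

lemma
  fixes \<Omega> :: "'b::euclidean_space \<Rightarrow> 'b \<Rightarrow> real"
  assumes \<Omega>: "symplectic_form \<Omega>" and AB: "lagrangian \<Omega> A" "lagrangian \<Omega> B" "lagrangian \<Omega> U"
    "A \<inter> U = {0}" "B \<inter> U = {0}"
  shows linear_chart_segment: "linear (chart_segment U A B r)"
    and lagrangian_chart_segment: "lagrangian \<Omega> (range (chart_segment U A B r))"
    and chart_segment_transversal: "range (chart_segment U A B r) \<inter> U = {0}"
    and oblique_chart_segment: "oblique (range (chart_segment U A B r)) U = chart_segment U A B r"
proof -
  note bil = symplectic_bilinear[OF \<Omega>]
  have c: "complementary A U" "complementary B U" using lagrangian_complementary AB by blast+
  note lA = linear_oblique[OF c(1)] and lB = linear_oblique[OF c(2)]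
  let ?E = "chart_segment U A B r" and ?a = "oblique A U" and ?b = "oblique B U"
  show lE: "linear ?E" unfolding chart_segment_def
    by (intro linearI) (simp_all add: linear_add[OF lA] linear_add[OF lB] linear_cmul[OF lA] linear_cmul[OF lB] algebra_simps)
  have u: "?b x - ?a x \<in> U" for x using oblique_diff_oblique_in[OF c] .
  have zero: "?E x = 0" if "x \<in> U" for x
    using oblique_zero[OF c(1) that] oblique_zero[OF c(2) that] by (simp add: chart_segment_def)
  have d: "x - ?E x \<in> U" for x
  proof -
    have "(x - ?a x) - r *\<^sub>R (?b x - ?a x) \<in> U"
      using lagrangian_subspace[OF AB(3)] u oblique_diff_in[OF c(1)] by (blast intro: subspace_diff subspace_scale)
    then show ?thesis by (simp add: chart_segment_def algebra_simps)
  qed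
  have iso: "\<Omega> (?E x) (?E y) = 0" for x y
  proof -
    have 0: "\<Omega> (?a x) (?a y) = 0" "\<Omega> (?b x) (?b y) = 0"
      using lagrangian_isotropic AB(1,2) oblique_in c by blast+
    have "\<Omega> (?b x) (?a y) = - chart_form \<Omega> U A B y x"
      unfolding chart_form_def by (rule symplectic_skew[OF \<Omega>])
    also have "\<dots> = - \<Omega> (?a x) (?b y)" using chart_form_commute[OF \<Omega> AB, of y x] by (simp add: chart_form_def)
    finally show ?thesis unfolding chart_segment_def using 0 by (simp add: bilinear_arith[OF bil] algebra_simps)
  qed
  show "lagrangian \<Omega> (range ?E)" "range ?E \<inter> U = {0}" "oblique (range ?E) U = ?E"
    by (rule lagrangian_of_projection[OF AB(3) lE d zero iso]; assumption)+
qed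

lemma chart_segment_0: "complementary A U \<Longrightarrow> range (chart_segment U A B 0) = A"
  using range_oblique[of A U] by (simp add: chart_segment_def)

lemma chart_segment_1: "complementary B U \<Longrightarrow> range (chart_segment U A B 1) = B"
  using range_oblique[of B U] by (simp add: chart_segment_def)

text \<open>In the chart of \<open>U\<close> the velocity is \<open>\<theta>'\<close> times a fixed
  map, so each crossing form is \<open>\<theta>'\<close> times a restriction of one and the same
  definite form. At times where \<open>\<theta>'\<close> vanishes a crossing has to be
  excluded.\<close>

lemma definite_path_chart_segment:
  fixes \<Omega> :: "'b::euclidean_space \<Rightarrow> 'b \<Rightarrow> real"
  assumes \<Omega>: "symplectic_form \<Omega>" and AB: "lagrangian \<Omega> A" "lagrangian \<Omega> B" "lagrangian \<Omega> U"
    "A \<inter> U = {0}" "B \<inter> U = {0}"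
    and def: "(\<forall>x. x \<notin> U \<longrightarrow> \<Omega> (oblique A U x) (oblique B U x) > 0) \<or> (\<forall>x. x \<notin> U \<longrightarrow> \<Omega> (oblique A U x) (oblique B U x) < 0)"
    and \<theta>: "\<And>t. t \<in> {a..b} \<Longrightarrow> (\<theta> has_vector_derivative \<theta>' t) (at t within {a..b})" "continuous_on {a..b} \<theta>'"
    and pos: "\<And>t. t \<in> {a..b} \<Longrightarrow> \<theta>' t > 0 \<or> range (chart_segment U A B (\<theta> t)) \<inter> L0 = {0}"
    and fl: "fa \<Longrightarrow> \<theta>' a = 0" "fb \<Longrightarrow> \<theta>' b = 0"
  shows "definite_path \<Omega> L0 a b (\<lambda>t. range (chart_segment U A B (\<theta> t))) fa fb"
proof -
  note bil = symplectic_bilinear[OF \<Omega>]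
  have c: "complementary A U" "complementary B U" using lagrangian_complementary AB by blast+
  note lA = linear_oblique[OF c(1)] and lB = linear_oblique[OF c(2)]
  let ?E = "\<lambda>t. chart_segment U A B (\<theta> t)" and ?a = "oblique A U" and ?b = "oblique B U"
  let ?l = "\<lambda>t. range (?E t)"
  define E' where "E' t x = \<theta>' t *\<^sub>R (?b x - ?a x)" for t x
  have lE: "linear (?E t)" for t by (rule linear_chart_segment[OF \<Omega> AB])
  have lE': "linear (E' t)" for t unfolding E'_def
    by (intro linearI) (simp_all add: linear_add[OF lA] linear_add[OF lB] linear_cmul[OF lA] linear_cmul[OF lB] algebra_simps)
  have lag: "lagrangian \<Omega> (?l t)" for t by (rule lagrangian_chart_segment[OF \<Omega> AB])
  have tr: "?l t \<inter> U = {0}" for t by (rule chart_segment_transversal[OF \<Omega> AB])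
  have ob: "oblique (?l t) U = ?E t" for t by (rule oblique_chart_segment[OF \<Omega> AB])
  have idem: "idempotent (?E t)" for t
    unfolding idempotent_def using lE oblique_idem[OF lagrangian_complementary[OF lag AB(3) tr]] by (simp add: ob)
  have dE: "((\<lambda>s. ?E s x) has_vector_derivative E' t x) (at t within {a..b})" if "t \<in> {a..b}" for t x
  proof -
    have "((\<lambda>s. \<theta> s *\<^sub>R (?b x - ?a x)) has_vector_derivative \<theta>' t *\<^sub>R (?b x - ?a x)) (at t within {a..b})"
      by (rule bounded_linear.has_vector_derivative[OF bounded_linear_scaleR_left \<theta>(1)[OF that]])
    from has_vector_derivative_add[OF has_vector_derivative_const this] show ?thesis
      by (simp add: chart_segment_def E'_def)
  qed
  define D where "D t = proj_derivative (?E t) (E' t)" for t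
  have "((\<lambda>s. proj (?l s) x) has_vector_derivative D t x) (at t within {a..b})" if "t \<in> {a..b}" for x t
    unfolding D_def by (rule has_vector_derivative_proj_range[OF idem that dE[OF that]])
  moreover have "continuous_on {a..b} (\<lambda>t. D t x)" for x
    unfolding D_def
  proof (rule continuous_on_proj_derivative[OF lE lE'])
    show "continuous_on {a..b} (\<lambda>s. ?E s x)" for x
      unfolding continuous_on_def using tendsto_of_has_vector_derivative[OF dE] by blast
    show "continuous_on {a..b} (\<lambda>s. E' s x)" for x
      unfolding E'_def by (intro continuous_on_scaleR \<theta>(2) continuous_on_const)
  qed
  moreover have D0: "D t x = 0" if "\<theta>' t = 0" for t x
  proof -
    have E0: "E' t = (\<lambda>x. 0)" using that by (simp add: E'_def fun_eq_iff)
    have "linear (inv (proj_corrector (?E t)))"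
      using lE by (meson bij_is_inj bij_proj_corrector inj_linear_imp_inv_linear linear_proj_corrector)
    then show ?thesis unfolding D_def proj_derivative_def E0 by (simp add: transposed_def linear_0 linear_0[OF lE])
  qed
  moreover have "?l t \<inter> L0 = {0} \<or> definite_crossing_at \<Omega> L0 {a..b} ?l t" if t: "t \<in> {a..b}" for t
  proof (cases "?l t \<inter> L0 = {0}")
    case False
    then have p: "\<theta>' t > 0" using pos[OF t] by blast
    have form: "\<Omega> v (E' t v) = \<theta>' t * \<Omega> (?a v) (?b v)" if v: "v \<in> ?l t" for v
    proof -
      have vE: "v = ?E t v" using oblique_id[OF lagrangian_complementary[OF lag AB(3) tr] v] ob by simp
      have 0: "\<Omega> (?a v) (?a v) = 0" "\<Omega> (?b v) (?b v) = 0" "\<Omega> (?b v) (?a v) = - \<Omega> (?a v) (?b v)"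
        using symplectic_self[OF \<Omega>] symplectic_skew[OF \<Omega>] by blast+
      have "\<Omega> (?E t v) (E' t v) = \<theta>' t * \<Omega> (?a v) (?b v)"
        unfolding chart_segment_def E'_def using 0 by (simp add: bilinear_arith[OF bil] algebra_simps)
      then show ?thesis using vE by simp
    qed
    have nU: "v \<notin> U" if "v \<in> ?l t \<inter> L0" "v \<noteq> 0" for v using tr[of t] that by blast
    have "(\<forall>v\<in>?l t \<inter> L0. v \<noteq> 0 \<longrightarrow> \<Omega> v (E' t v) > 0) \<or> (\<forall>v\<in>?l t \<inter> L0. v \<noteq> 0 \<longrightarrow> \<Omega> v (E' t v) < 0)"
      using def
    proof
      assume "\<forall>x. x \<notin> U \<longrightarrow> \<Omega> (?a x) (?b x) > 0"
      then show ?thesis using form nU p by (intro disjI1) (auto simp: zero_less_mult_iff)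
    next
      assume "\<forall>x. x \<notin> U \<longrightarrow> \<Omega> (?a x) (?b x) < 0"
      then show ?thesis using form nU p by (intro disjI2) (auto simp: mult_less_0_iff)
    qed
    then show ?thesis
      unfolding definite_crossing_at_def using AB(3) tr dE[OF t] ob
      by (intro disjI2 exI[of _ U] exI[of _ "E' t"]) simp
  qed simp
  ultimately have "path_velocity a b ?l fa fb D"
      "\<forall>t\<in>{a..b}. ?l t \<inter> L0 = {0} \<or> definite_crossing_at \<Omega> L0 {a..b} ?l t"
    unfolding path_velocity_def using fl by blast+
  then show ?thesis unfolding definite_path_def using lag by blast
qed

text \<open>The speed vanishes at flagged ends, where pieces are joined, and is positive at the
  others, which may be crossings.\<close>

definition time_change :: "real \<Rightarrow> real \<Rightarrow> bool \<Rightarrow> bool \<Rightarrow> (real \<Rightarrow> real) \<Rightarrow> (real \<Rightarrow> real) \<Rightarrow> bool" where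
  "time_change a b fa fb \<theta> \<theta>' \<longleftrightarrow> \<theta> a = 0 \<and> \<theta> b = 1 \<and> (\<forall>t. (\<theta> has_vector_derivative \<theta>' t) (at t within {a..b})) \<and> continuous_on {a..b} \<theta>'
     \<and> (\<forall>t\<in>{a..b}. 0 \<le> \<theta> t \<and> \<theta> t \<le> 1) \<and> (\<forall>t. a < t \<and> t < b \<longrightarrow> \<theta>' t > 0)
     \<and> (if fa then \<theta>' a = 0 else \<theta>' a > 0) \<and> (if fb then \<theta>' b = 0 else \<theta>' b > 0)"

lemma time_change_exists:
  assumes "a < b"
  shows "\<exists>\<theta> \<theta>'. time_change a b fa fb \<theta> \<theta>'"
proof -
  \<comment> \<open>The four polynomials map \<open>[0, 1]\<close> onto itself, with a derivative
    that vanishes at exactly the flagged ends.\<close>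
  define p where "p u = (if fa then if fb then 3 * u^2 - 2 * u^3 else u^2 else if fb then 2 * u - u^2 else u)" for u :: real
  define p' where "p' u = (if fa then if fb then 6 * u * (1 - u) else 2 * u else if fb then 2 * (1 - u) else 1)" for u :: real
  have dp: "(p has_real_derivative p' u) (at u)" for u
    unfolding p_def p'_def
    by (cases fa; cases fb; simp; auto intro!: derivative_eq_intros simp: algebra_simps power2_eq_square)
  have cp: "continuous_on UNIV p'" unfolding p'_def by (cases fa; cases fb; simp; intro continuous_intros)
  have p01: "p 0 = 0" "p 1 = 1" by (auto simp: p_def)
  have pos: "p' u > 0" if "0 < u" "u < 1" for u using that by (auto simp: p'_def)
  have nn: "p' u \<ge> 0" if "0 \<le> u" "u \<le> 1" for u using that by (auto simp: p'_def)
  have mono: "p u \<le> p v" if "0 \<le> u" "u \<le> v" "v \<le> 1" for u v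
    by (rule DERIV_nonneg_imp_nondecreasing[OF that(2)]) (use dp nn that in force)
  define w where "w = b - a"
  have w: "w > 0" using assms by (simp add: w_def)
  let ?u = "\<lambda>t. (t - a) / w"
  have d: "((\<lambda>t. p (?u t)) has_real_derivative p' (?u t) / w) (at t)" for t
  proof -
    have "(?u has_real_derivative 1 / w) (at t)" using w by (auto intro!: derivative_eq_intros)
    from DERIV_chain2[OF dp this] show ?thesis by simp
  qed
  have ub: "?u b = 1" using w by (simp add: w_def)
  have rng: "0 \<le> ?u t \<and> ?u t \<le> 1" if "t \<in> {a..b}" for t using that w by (auto simp: w_def field_simps)
  show ?thesis
    unfolding time_change_def
  proof (rule exI[of _ "\<lambda>t. p (?u t)"], rule exI[of _ "\<lambda>t. p' (?u t) / w"], intro conjI allI ballI impI)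
    show "p (?u a) = 0" "p (?u b) = 1" using p01 ub by auto
    show "((\<lambda>t. p (?u t)) has_vector_derivative p' (?u t) / w) (at t within {a..b})" for t
      using has_vector_derivative_at_within[OF d[of t, unfolded has_real_derivative_iff_has_vector_derivative]] .
    have "continuous_on {a..b} (\<lambda>t. p' (?u t))"
      by (rule continuous_on_compose2[OF cp]) (use w in \<open>auto intro!: continuous_intros\<close>)
    then show "continuous_on {a..b} (\<lambda>t. p' (?u t) / w)" using w by (intro continuous_intros) auto
    fix t
    show "0 \<le> p (?u t)" "p (?u t) \<le> 1" if "t \<in> {a..b}" using mono[of 0 "?u t"] mono[of "?u t" 1] rng[OF that] p01 by auto
    show "p' (?u t) / w > 0" if "a < t \<and> t < b"
      using that w by (intro divide_pos_pos pos) (auto simp: w_def field_simps)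
  next
    show "if fa then p' (?u a) / w = 0 else p' (?u a) / w > 0" using w by (auto simp: p'_def)
    show "if fb then p' (?u b) / w = 0 else p' (?u b) / w > 0" using w ub by (auto simp: p'_def)
  qed
qed

text \<open>A positive segment is regular, hence has finitely many crossings, so every subinterval
  contains a parameter without one. Corners are moved off \<open>L0\<close> in this way.\<close>

lemma chart_segment_generic:
  fixes \<Omega> :: "'b::euclidean_space \<Rightarrow> 'b \<Rightarrow> real"
  assumes \<Omega>: "symplectic_form \<Omega>" and L0: "lagrangian \<Omega> L0"
    and AB: "lagrangian \<Omega> A" "lagrangian \<Omega> B" "lagrangian \<Omega> U" "A \<inter> U = {0}" "B \<inter> U = {0}"
    and def: "\<And>x. x \<notin> U \<Longrightarrow> \<Omega> (oblique A U x) (oblique B U x) > 0"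
    and r: "0 \<le> r1" "r1 < r2" "r2 \<le> 1"
  shows "\<exists>r. r1 < r \<and> r < r2 \<and> range (chart_segment U A B r) \<inter> L0 = {0}"
proof -
  let ?l = "\<lambda>t. range (chart_segment U A B t)"
  have g: "definite_path \<Omega> L0 0 1 ?l False False"
    by (rule definite_path_chart_segment[OF \<Omega> AB, where \<theta>="\<lambda>t. t" and \<theta>'="\<lambda>t. 1"]) (use def in auto)
  have "finite {t \<in> {0..1}. crossing L0 ?l t}"
    by (rule finite_regular_crossings[OF \<Omega> L0 _ definite_path_C1[OF g] definite_path_regular[OF \<Omega> L0 _ g]]) auto
  then have "infinite ({r1<..<r2} - {t \<in> {0..1}. crossing L0 ?l t})"
    using r by (simp add: Diff_infinite_finite infinite_Ioo)
  then obtain r where "r \<in> {r1<..<r2} - {t \<in> {0..1}. crossing L0 ?l t}" using infinite_imp_nonempty by blast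
  then show ?thesis using r by (auto simp: crossing_def)
qed

text \<open>\<open>B\<close> is the graph over \<open>\<Lambda>\<close> of a map \<open>K\<close>
  into \<open>U\<close> with \<open>\<Omega> z (K y) = ?p y \<bullet> ?p z\<close>. Symmetry of the
  inner product makes the graph isotropic, and its positivity puts \<open>B\<close> on the positive
  side of \<open>\<Lambda>\<close>.\<close>

lemma positive_lagrangian_exists:
  fixes \<Omega> :: "'b::euclidean_space \<Rightarrow> 'b \<Rightarrow> real"
  assumes \<Omega>: "symplectic_form \<Omega>" and \<Lambda>: "lagrangian \<Omega> \<Lambda>" and U: "lagrangian \<Omega> U" and t: "\<Lambda> \<inter> U = {0}"
  shows "\<exists>B. lagrangian \<Omega> B \<and> B \<inter> U = {0} \<and>
    (\<forall>x. \<Omega> (oblique \<Lambda> U x) (oblique B U x) = oblique \<Lambda> U x \<bullet> oblique \<Lambda> U x)"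
proof -
  note bil = symplectic_bilinear[OF \<Omega>]
  have c: "complementary \<Lambda> U" using lagrangian_complementary[OF \<Lambda> U t] .
  let ?p = "oblique \<Lambda> U"
  have lp: "linear ?p" using linear_oblique[OF c] .
  \<comment> \<open>The matrix of \<open>\<Omega>\<close> with respect to the inner product.
    Nondegeneracy makes it invertible, and solving with it produces \<open>K\<close>.\<close>
  define A where "A k = (\<Sum>b\<in>Basis. \<Omega> b k *\<^sub>R b)" for k
  have lA: "linear A" unfolding A_def
    by (intro linearI) (simp_all add: bilinear_arith[OF bil] scaleR_add_left sum.distrib scaleR_sum_right)
  have iA: "z \<bullet> A k = \<Omega> z k" for z k
  proof -
    have "linear (\<lambda>z. \<Omega> z k)" using bil by (simp add: bilinear_def)
    from linear_expansion[OF this, of z] show ?thesis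
      by (simp add: A_def inner_sum_right mult.commute)
  qed
  have "k = 0" if k: "A k = 0" for k
  proof (rule symplectic_nondegenerate[OF \<Omega>])
    fix v
    have "\<Omega> v k = 0" using iA[of v k] k by simp
    then show "\<Omega> k v = 0" using symplectic_skew[OF \<Omega>, of k v] by simp
  qed
  then have "inj A" using linear_injective_0[OF lA] by blast
  then have bA: "bij A" using lA linear_injective_imp_surjective by (auto simp: bij_def)
  have lAi: "linear (inv A)" using lA \<open>inj A\<close> inj_linear_imp_inv_linear by blast
  define K where "K y = inv A (transposed ?p (?p y))" for y
  have lK: "linear K" unfolding K_def
    using linear_compose[OF linear_compose[OF lp linear_transposed[of ?p]] lAi] by (simp add: comp_def)
  have \<Omega>K: "\<Omega> z (K y) = ?p y \<bullet> ?p z" for z y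
  proof -
    have "\<Omega> z (K y) = z \<bullet> A (K y)" using iA by simp
    also have "A (K y) = transposed ?p (?p y)" unfolding K_def using bA by (simp add: bij_is_surj surj_f_inv_f)
    finally show ?thesis using inner_transposed[OF lp, of "?p y" z] by (simp add: inner_commute)
  qed
  have KU: "K y \<in> U" for y
  proof (rule lagrangian_maximal[OF \<Omega> U])
    fix u assume "u \<in> U"
    then have "\<Omega> u (K y) = 0" using \<Omega>K oblique_zero[OF c] by simp
    then show "\<Omega> (K y) u = 0" using symplectic_skew[OF \<Omega>, of "K y" u] by simp
  qed
  define E where "E x = ?p x + K x" for x
  have lE: "linear E" unfolding E_def by (intro linear_compose_add lp lK)
  have d: "x - E x \<in> U" for x
  proof -
    have "(x - ?p x) - K x \<in> U" using oblique_diff_in[OF c] KU lagrangian_subspace[OF U] by (blast intro: subspace_diff)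
    then show ?thesis by (simp add: E_def algebra_simps)
  qed
  have zero: "E x = 0" if "x \<in> U" for x
    using oblique_zero[OF c that] by (simp add: E_def K_def linear_0[OF linear_transposed] linear_0[OF lAi])
  have pp: "\<Omega> (?p x) (?p y) = 0" for x y using lagrangian_isotropic[OF \<Lambda>] oblique_in[OF c] by blast
  have pK: "\<Omega> (?p x) (K y) = ?p y \<bullet> ?p x" for x y using \<Omega>K oblique_idem[OF c] by simp
  have Kp: "\<Omega> (K x) (?p y) = - (?p y \<bullet> ?p x)" for x y
    using symplectic_skew[OF \<Omega>, of "K x" "?p y"] pK[of y x] by (simp add: inner_commute)
  have iso: "\<Omega> (E x) (E y) = 0" for x y
    unfolding E_def using pp pK Kp lagrangian_isotropic[OF U KU KU] by (simp add: bilinear_arith[OF bil])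
  note L = lagrangian_of_projection[OF U lE d zero iso]
  have "\<Omega> (?p x) (E x) = ?p x \<bullet> ?p x" for x
    unfolding E_def using pp pK by (simp add: bilinear_arith[OF bil])
  then show ?thesis using L by (intro exI[of _ "range E"]) simp
qed

section \<open>Cone estimates near a model Lagrangian\<close>

lemma chart_segment_model:
  assumes c: "complementary \<Lambda> U" "complementary B U"
  shows "oblique \<Lambda> U (chart_segment U \<Lambda> B r x) = oblique \<Lambda> U x"
  unfolding chart_segment_def linear_add[OF linear_oblique[OF c(1)]] linear_cmul[OF linear_oblique[OF c(1)]]
  using oblique_zero[OF c(1) oblique_diff_oblique_in[OF c]] oblique_idem[OF c(1)] by simp

text \<open>On \<open>X\<close> one has \<open>norm y \<le> (1 + C) * norm (\<pi> y)\<close>,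
  whereas on the image of \<open>U\<close> under \<open>g\<close> one has
  \<open>norm (\<pi> y) \<le> 2 * p * \<eta> * norm y\<close>; the 2 comes from
  \<open>norm u \<le> 2 * norm (g u)\<close>. The last condition on \<open>\<eta>\<close> lets these
  two cones meet only in 0.\<close>

lemma transversal_of_slope:
  fixes U :: "'b::euclidean_space set"
  assumes U: "subspace U" "\<And>x. x \<in> U \<Longrightarrow> \<pi> x = 0" and lp: "linear \<pi>" and p: "p > 0" "\<And>x. norm (\<pi> x) \<le> p * norm x"
    and X: "0 \<in> X" "\<And>x. x \<in> X \<Longrightarrow> norm (x - \<pi> x) \<le> C * norm (\<pi> x)" and C: "C \<ge> 0"
    and g: "\<And>x. norm (g x - x) \<le> \<eta> * norm x" and \<eta>: "\<eta> > 0" "\<eta> \<le> 1/2" "2 * p * (1 + C) * \<eta> < 1"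
  shows "X \<inter> g ` U = {0}"
proof -
  have "g 0 = 0" using g[of 0] by simp
  then have "0 \<in> g ` U" using subspace_0[OF U(1)] by (metis imageI)
  moreover have "g u = 0" if u: "u \<in> U" "g u \<in> X" for u
  proof -
    let ?y = "g u"
    have "norm u \<le> norm ?y + norm (?y - u)" by (metis norm_triangle_sub norm_minus_commute)
    also have "\<dots> \<le> norm ?y + (1/2) * norm u" using g[of u] mult_right_mono[OF \<eta>(2), of "norm u"] by simp
    finally have nu: "norm u \<le> 2 * norm ?y" by simp
    have "\<pi> ?y = \<pi> (?y - u)" using U(2)[OF u(1)] by (simp add: linear_diff[OF lp])
    then have "norm (\<pi> ?y) \<le> p * norm (?y - u)" using p(2) by metis
    also have "\<dots> \<le> p * (\<eta> * norm u)" using g[of u] p(1) by simp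
    also have "\<dots> \<le> p * (\<eta> * (2 * norm ?y))" using nu p(1) \<eta>(1) by simp
    finally have a: "norm (\<pi> ?y) \<le> 2 * p * \<eta> * norm ?y" by (simp add: algebra_simps)
    have "norm ?y \<le> norm (\<pi> ?y) + norm (?y - \<pi> ?y)" by (metis norm_triangle_sub)
    also have "\<dots> \<le> (1 + C) * norm (\<pi> ?y)" using X(2)[OF u(2)] by (simp add: algebra_simps)
    finally have b: "norm ?y \<le> (1 + C) * norm (\<pi> ?y)" .
    have "2 * p * \<eta> * norm ?y \<le> 2 * p * \<eta> * ((1 + C) * norm (\<pi> ?y))" using b p(1) \<eta>(1) by (intro mult_left_mono) auto
    then have "norm (\<pi> ?y) \<le> (2 * p * (1 + C) * \<eta>) * norm (\<pi> ?y)" using a by (simp add: algebra_simps)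
    then have "\<not> norm (\<pi> ?y) > 0" using mult_strict_right_mono[OF \<eta>(3), of "norm (\<pi> ?y)"] by linarith
    then show ?thesis using b by simp
  qed
  ultimately show ?thesis using X(1) by auto
qed

text \<open>In the constant, \<open>\<kappa>\<close> is the slope already present in
  \<open>a\<close>, \<open>1 + \<kappa>\<close> bounds \<open>norm a\<close> by
  \<open>norm (\<pi> a)\<close>, \<open>1 + p\<close> bounds the map \<open>x - \<pi> x\<close> on
  the displacement \<open>h - a\<close>, and the factor 2 passes from \<open>\<pi> a\<close> to
  \<open>\<pi> h\<close>.\<close>

lemma slope_of_near_identity:
  fixes \<pi> :: "'b::euclidean_space \<Rightarrow> 'b"
  assumes lp: "linear \<pi>" and p: "p > 0" "\<And>x. norm (\<pi> x) \<le> p * norm x"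
    and a: "norm (a - \<pi> a) \<le> \<eta> * \<kappa> * norm (\<pi> a)" and h: "norm (h - a) \<le> \<eta> * norm a"
    and \<eta>: "\<eta> > 0" "\<eta> \<le> 1/2" "p * (1 + \<kappa>) * \<eta> \<le> 1/2" and \<kappa>: "\<kappa> > 0"
  shows "norm (h - \<pi> h) \<le> (2 * (\<kappa> + (1 + p) * (1 + \<kappa>)) * \<eta>) * norm (\<pi> h)"
proof -
  have "\<eta> * \<kappa> * norm (\<pi> a) \<le> \<kappa> * norm (\<pi> a)" using \<eta>(2) \<kappa> by (intro mult_right_mono) (auto simp: mult_le_cancel_right1)
  then have na: "norm a \<le> (1 + \<kappa>) * norm (\<pi> a)"
    using a norm_triangle_sub[of a "\<pi> a"] by (simp add: algebra_simps)
  have hm: "\<eta> * norm a \<le> \<eta> * ((1 + \<kappa>) * norm (\<pi> a))" using na \<eta>(1) by simp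
  then have hb: "norm (h - a) \<le> \<eta> * ((1 + \<kappa>) * norm (\<pi> a))" using h by linarith
  have ph: "norm (\<pi> (h - a)) \<le> p * (\<eta> * ((1 + \<kappa>) * norm (\<pi> a)))"
    using order_trans[OF p(2) mult_left_mono[OF hb, of p]] p(1) by simp
  have "norm (\<pi> a) \<le> norm (\<pi> h) + norm (\<pi> (h - a))"
    using norm_triangle_ineq4[of "\<pi> h" "\<pi> (h - a)"] by (simp add: linear_diff[OF lp])
  also have "\<dots> \<le> norm (\<pi> h) + (p * (1 + \<kappa>) * \<eta>) * norm (\<pi> a)" using ph by (simp add: algebra_simps)
  also have "\<dots> \<le> norm (\<pi> h) + (1/2) * norm (\<pi> a)" using mult_right_mono[OF \<eta>(3), of "norm (\<pi> a)"] by simp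
  finally have pa: "norm (\<pi> a) \<le> 2 * norm (\<pi> h)" by simp
  have "h - \<pi> h = (a - \<pi> a) + ((h - a) - \<pi> (h - a))" by (simp add: linear_diff[OF lp])
  then have "norm (h - \<pi> h) = norm ((a - \<pi> a) + ((h - a) - \<pi> (h - a)))" by (rule arg_cong)
  then have "norm (h - \<pi> h) \<le> norm (a - \<pi> a) + (norm (h - a) + norm (\<pi> (h - a)))"
    using norm_triangle_ineq[of "a - \<pi> a" "(h - a) - \<pi> (h - a)"] norm_triangle_ineq4[of "h - a" "\<pi> (h - a)"] by linarith
  also have "\<dots> \<le> \<eta> * \<kappa> * norm (\<pi> a) + (\<eta> * ((1 + \<kappa>) * norm (\<pi> a)) + p * (\<eta> * ((1 + \<kappa>) * norm (\<pi> a))))"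
    using a hb ph by linarith
  also have "\<dots> = ((\<kappa> + (1 + p) * (1 + \<kappa>)) * \<eta>) * norm (\<pi> a)" by (simp add: algebra_simps)
  also have "\<dots> \<le> ((\<kappa> + (1 + p) * (1 + \<kappa>)) * \<eta>) * (2 * norm (\<pi> h))"
    using pa \<kappa> p(1) \<eta>(1) by (intro mult_left_mono) auto
  finally show ?thesis by (simp add: algebra_simps)
qed

text \<open>With \<open>A\<^sub>r = range (chart_segment U \<Lambda> B r)\<close> (so \<open>A\<^sub>0 = \<Lambda>\<close> and the path \<open>A\<^sub>r\<close> is positive), symplectic maps
  \<open>\<eta>\<close>-close to the identity preserve the transversality to \<open>U\<close> of all segments used below, and move
  \<open>A\<^sub>\<epsilon>\<close>, \<open>\<epsilon> \<le> \<eta>\<close>, to Lagrangians that are still below \<open>A\<^sub>\<mu>\<close> for \<open>\<mu> \<ge> 1/2\<close>.\<close>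
definition admissible_radius ::
  "('b::euclidean_space \<Rightarrow> 'b \<Rightarrow> real) \<Rightarrow> 'b set \<Rightarrow> 'b set \<Rightarrow> 'b set \<Rightarrow> real \<Rightarrow> bool" where
  "admissible_radius \<Omega> \<Lambda> B U \<eta> \<longleftrightarrow> \<eta> > 0 \<and> \<eta> \<le> 1/4 \<and>
    (\<forall>g r. (\<forall>x. norm (g x - x) \<le> \<eta> * norm x) \<longrightarrow> 0 \<le> r \<longrightarrow> r \<le> 1 \<longrightarrow> range (chart_segment U \<Lambda> B r) \<inter> g ` U = {0}) \<and>
    (\<forall>h \<epsilon>. symplectic_map \<Omega> h \<longrightarrow> (\<forall>x. norm (h x - x) \<le> \<eta> * norm x) \<longrightarrow> 0 \<le> \<epsilon> \<longrightarrow> \<epsilon> \<le> \<eta> \<longrightarrow>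
       (h ` range (chart_segment U \<Lambda> B \<epsilon>)) \<inter> U = {0} \<and>
       (\<forall>\<mu>. 1/2 \<le> \<mu> \<longrightarrow> \<mu> \<le> 1 \<longrightarrow>
         (\<forall>x. x \<notin> U \<longrightarrow> \<Omega> (oblique (range (chart_segment U \<Lambda> B \<mu>)) U x) (oblique (h ` range (chart_segment U \<Lambda> B \<epsilon>)) U x) < 0) \<and>
         (\<forall>g r. (\<forall>x. norm (g x - x) \<le> \<eta> * norm x) \<longrightarrow> 0 \<le> r \<longrightarrow> r \<le> 1 \<longrightarrow>
           range (chart_segment U (range (chart_segment U \<Lambda> B \<mu>)) (h ` range (chart_segment U \<Lambda> B \<epsilon>)) r) \<inter> g ` U = {0})))"

text \<open>All Lagrangians involved lie in the cone
  \<open>norm (x - ?p x) \<le> (1 + \<kappa>) * norm (?p x)\<close>, so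
  \<open>transversal_of_slope\<close> applies. For definiteness, in units of
  \<open>(norm (?p x))^2\<close> the form of \<open>A\<^sub>\<mu>\<close> over
  \<open>\<Lambda>\<close> is \<open>\<mu> \<ge> 1/2\<close>, and that of the moved
  \<open>A\<^sub>\<epsilon>\<close> is at most \<open>1/4\<close>.\<close>

lemma model_neighbourhood:
  fixes \<Omega> :: "'b::euclidean_space \<Rightarrow> 'b \<Rightarrow> real"
  assumes \<Omega>: "symplectic_form \<Omega>" and l: "lagrangian \<Omega> \<Lambda>" "lagrangian \<Omega> B" "lagrangian \<Omega> U"
    and tr: "\<Lambda> \<inter> U = {0}" "B \<inter> U = {0}"
    and f: "\<And>x. \<Omega> (oblique \<Lambda> U x) (oblique B U x) = oblique \<Lambda> U x \<bullet> oblique \<Lambda> U x"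
  shows "\<exists>\<eta>. admissible_radius \<Omega> \<Lambda> B U \<eta>"
proof -
  note bil = symplectic_bilinear[OF \<Omega>]
  have c: "complementary \<Lambda> U" "complementary B U" using lagrangian_complementary l tr by blast+
  let ?p = "oblique \<Lambda> U" and ?E = "chart_segment U \<Lambda> B"
  have lp: "linear ?p" and lb: "linear (oblique B U)" using linear_oblique c by blast+
  define k where "k x = oblique B U x - ?p x" for x
  have lk: "linear k" unfolding k_def by (intro linear_compose_sub lp lb)
  have kU: "k x \<in> U" for x unfolding k_def by (rule oblique_diff_oblique_in[OF c])
  have kp: "k (?p x) = k x" for x
  proof -
    have "k (x - ?p x) = 0" unfolding k_def using oblique_zero[OF c(1) oblique_diff_in[OF c(1)]] oblique_zero[OF c(2) oblique_diff_in[OF c(1)]] by simp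
    then show ?thesis by (simp add: linear_diff[OF lk])
  qed
  have E: "?E r x = ?p x + r *\<^sub>R k x" for r x by (simp add: chart_segment_def k_def)
  have pE: "?p (?E r x) = ?p x" for r x by (rule chart_segment_model[OF c])
  have sU: "subspace U" using l(3) by (rule lagrangian_subspace)
  have U0: "x \<in> U \<Longrightarrow> ?p x = 0" for x by (rule oblique_zero[OF c(1)])
  obtain p where p: "p > 0" "\<And>x. norm (?p x) \<le> p * norm x" using linear_bounded_pos[OF lp] by blast
  obtain \<kappa> where \<kappa>: "\<kappa> > 0" "\<And>x. norm (k x) \<le> \<kappa> * norm x" using linear_bounded_pos[OF lk] by blast
  obtain w where w: "w > 0" "\<And>x y. \<bar>\<Omega> x y\<bar> \<le> w * norm x * norm y" using bilinear_bounded_pos[OF bil] by auto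
  \<comment> \<open>The constant of \<open>slope_of_near_identity\<close>.\<close>
  define D where "D = 2 * (\<kappa> + (1 + p) * (1 + \<kappa>))"
  have D: "D > 0" unfolding D_def using p \<kappa> by (simp add: add_pos_pos)
  \<comment> \<open>Contains twice each of \<open>1\<close>, \<open>p * (2 + \<kappa>)\<close>,
    \<open>D * w\<close> and \<open>D\<close>, so that multiplied by
    \<open>\<eta> = 1 / (2 * M)\<close> each of them is at most \<open>1/4\<close>.\<close>
  define M where "M = 2 + 2 * p * (2 + \<kappa>) + 2 * D * w + 2 * D"
  have M: "M > 0" unfolding M_def using p \<kappa> D w by (simp add: add_pos_pos)
  define \<eta> where "\<eta> = 1 / (2 * M)"
  have \<eta>0: "\<eta> > 0" using M by (simp add: \<eta>_def)
  have scale: "y * \<eta> \<le> 1/4" if "2 * y \<le> M" for y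
  proof -
    have "y * \<eta> = (2 * y) / (4 * M)" by (simp add: \<eta>_def)
    also have "\<dots> \<le> M / (4 * M)" using that M by (intro divide_right_mono) auto
    finally show ?thesis using M by simp
  qed
  have pos: "p * \<kappa> > 0" "D * w > 0" using p \<kappa> D w by auto
  have \<eta>1: "\<eta> \<le> 1/4" using scale[of 1] p(1) \<kappa>(1) D w(1) pos by (simp add: M_def algebra_simps)
  have \<eta>2: "p * (2 + \<kappa>) * \<eta> \<le> 1/4" using scale[of "p * (2 + \<kappa>)"] D pos by (simp add: M_def algebra_simps)
  have \<eta>3: "D * w * \<eta> \<le> 1/4" using scale[of "D * w"] D p(1) pos by (simp add: M_def algebra_simps)
  have \<eta>4: "D * \<eta> \<le> 1/4" using scale[of D] p(1) pos by (simp add: M_def algebra_simps)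
  have \<eta>5: "p * (1 + \<kappa>) * \<eta> \<le> 1/2"
  proof -
    have "p * (1 + \<kappa>) * \<eta> \<le> p * (2 + \<kappa>) * \<eta>" using p \<eta>0 by (intro mult_right_mono) auto
    then show ?thesis using \<eta>2 by simp
  qed
  have trans: "X \<inter> g ` U = {0}" if "0 \<in> X" "\<And>x. x \<in> X \<Longrightarrow> norm (x - ?p x) \<le> (1 + \<kappa>) * norm (?p x)"
    "\<And>x. norm (g x - x) \<le> \<eta> * norm x" for X g
    by (rule transversal_of_slope[OF sU U0 lp p that(1,2) _ that(3) \<eta>0]) (use \<eta>1 \<eta>2 \<kappa> in \<open>auto simp: algebra_simps\<close>)
  have kb: "norm (k x) \<le> \<kappa> * norm (?p x)" for x using \<kappa>(2)[of "?p x"] kp by simp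
  have slopeE: "norm (?E r x - ?p (?E r x)) \<le> r * \<kappa> * norm (?p (?E r x))" if "0 \<le> r" for r x
    unfolding pE using kb[of x] that by (simp add: E mult.assoc mult_left_mono)
  have one: "range (?E r) \<inter> g ` U = {0}" if g: "\<forall>x. norm (g x - x) \<le> \<eta> * norm x" and r: "0 \<le> r" "r \<le> 1" for g r
  proof (rule trans)
    show "0 \<in> range (?E r)" using linear_0[OF linear_chart_segment[OF \<Omega> l tr]] by (metis rangeI)
    show "norm (g x - x) \<le> \<eta> * norm x" for x using g by blast
    fix x assume "x \<in> range (?E r)"
    then obtain y where y: "x = ?E r y" by blast
    have "r * \<kappa> * norm (?p x) \<le> (1 + \<kappa>) * norm (?p x)" using r \<kappa>(1) by (intro mult_right_mono) (auto simp: mult_le_cancel_right2 add_increasing)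
    then show "norm (x - ?p x) \<le> (1 + \<kappa>) * norm (?p x)" using slopeE[OF r(1), of y] y by simp
  qed
  have two: "(h ` range (?E \<epsilon>)) \<inter> U = {0} \<and>
       (\<forall>\<mu>. 1/2 \<le> \<mu> \<longrightarrow> \<mu> \<le> 1 \<longrightarrow>
         (\<forall>x. x \<notin> U \<longrightarrow> \<Omega> (oblique (range (?E \<mu>)) U x) (oblique (h ` range (?E \<epsilon>)) U x) < 0) \<and>
         (\<forall>g r. (\<forall>x. norm (g x - x) \<le> \<eta> * norm x) \<longrightarrow> 0 \<le> r \<longrightarrow> r \<le> 1 \<longrightarrow>
           range (chart_segment U (range (?E \<mu>)) (h ` range (?E \<epsilon>)) r) \<inter> g ` U = {0}))"
    if h: "symplectic_map \<Omega> h" "\<forall>x. norm (h x - x) \<le> \<eta> * norm x" and \<epsilon>: "0 \<le> \<epsilon>" "\<epsilon> \<le> \<eta>" for h \<epsilon>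
  proof -
    let ?Z = "h ` range (?E \<epsilon>)"
    have lZ: "lagrangian \<Omega> ?Z" by (rule lagrangian_image[OF h(1) lagrangian_chart_segment[OF \<Omega> l tr]])
    have slZ: "norm (z - ?p z) \<le> D * \<eta> * norm (?p z)" if "z \<in> ?Z" for z
    proof -
      obtain x where x: "z = h (?E \<epsilon> x)" using \<open>z \<in> ?Z\<close> by blast
      let ?a = "?E \<epsilon> x"
      have "\<epsilon> * \<kappa> * norm (?p ?a) \<le> \<eta> * \<kappa> * norm (?p ?a)" using \<epsilon> \<kappa>(1) by (intro mult_right_mono) auto
      then have "norm (?a - ?p ?a) \<le> \<eta> * \<kappa> * norm (?p ?a)" using slopeE[OF \<epsilon>(1), of x] by linarith
      from slope_of_near_identity[OF lp p this, of z] show ?thesis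
        using h(2) x \<eta>0 \<eta>1 \<eta>5 \<kappa>(1) by (simp add: D_def)
    qed
    have ZU: "?Z \<inter> U = {0}"
    proof -
      have "z = 0" if "z \<in> ?Z" "z \<in> U" for z using slZ[OF that(1)] U0[OF that(2)] by simp
      then show ?thesis using subspace_0[OF lagrangian_subspace[OF lZ]] subspace_0[OF sU] by blast
    qed
    have cZ: "complementary ?Z U" using lagrangian_complementary[OF lZ l(3) ZU] .
    define u where "u x = oblique ?Z U x - ?p x" for x
    have uU: "u x \<in> U" for x unfolding u_def by (rule oblique_diff_oblique_in[OF c(1) cZ])
    have oZ: "oblique ?Z U x = ?p x + u x" for x by (simp add: u_def)
    have poZ: "?p (oblique ?Z U x) = ?p x" for x
      unfolding oZ linear_add[OF lp] using U0[OF uU] oblique_idem[OF c(1)] by simp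
    have ub: "norm (u x) \<le> D * \<eta> * norm (?p x)" for x
      using slZ[OF oblique_in[OF cZ, of x]] poZ by (simp add: u_def)
    have "\<Omega> (oblique (range (?E \<mu>)) U x) (oblique ?Z U x) < 0" if \<mu>: "1/2 \<le> \<mu>" "\<mu> \<le> 1" and x: "x \<notin> U" for \<mu> x
    proof -
      have px: "norm (?p x) > 0" using x oblique_eq_0_iff[OF c(1)] by simp
      have 0: "\<Omega> (?p x) (?p x) = 0" "\<Omega> (k x) (u x) = 0"
        using symplectic_self[OF \<Omega>] lagrangian_isotropic[OF l(3) kU uU] by auto
      have fk: "\<Omega> (?p x) (k x) = (norm (?p x))^2"
        using f[of x] 0 by (simp add: k_def bilinear_arith[OF bil] power2_norm_eq_inner)
      have kf: "\<Omega> (k x) (?p x) = - ((norm (?p x))^2)" using symplectic_skew[OF \<Omega>, of "k x" "?p x"] fk by simp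
      have "\<Omega> (oblique (range (?E \<mu>)) U x) (oblique ?Z U x) = \<Omega> (?p x) (u x) - \<mu> * (norm (?p x))^2"
        unfolding oblique_chart_segment[OF \<Omega> l tr] E oZ using 0 kf by (simp add: bilinear_arith[OF bil])
      moreover have "\<Omega> (?p x) (u x) \<le> (1/4) * (norm (?p x))^2"
      proof -
        have "\<Omega> (?p x) (u x) \<le> w * norm (?p x) * norm (u x)" using w(2)[of "?p x" "u x"] by linarith
        also have "\<dots> \<le> w * norm (?p x) * (D * \<eta> * norm (?p x))" using ub[of x] w(1) by (intro mult_left_mono) auto
        also have "\<dots> = (D * w * \<eta>) * (norm (?p x))^2" by (simp add: power2_eq_square)
        also have "\<dots> \<le> (1/4) * (norm (?p x))^2" using \<eta>3 by (intro mult_right_mono) auto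
        finally show ?thesis .
      qed
      moreover have "(1/2) * (norm (?p x))^2 \<le> \<mu> * (norm (?p x))^2" using \<mu> by (intro mult_right_mono) auto
      moreover have "(norm (?p x))^2 > 0" using px by simp
      ultimately show ?thesis by linarith
    qed
    moreover have "range (chart_segment U (range (?E \<mu>)) ?Z r) \<inter> g ` U = {0}"
      if \<mu>: "1/2 \<le> \<mu>" "\<mu> \<le> 1" and g: "\<forall>x. norm (g x - x) \<le> \<eta> * norm x" and r: "0 \<le> r" "r \<le> 1" for \<mu> g r
    proof (rule trans)
      let ?G = "chart_segment U (range (?E \<mu>)) ?Z r"
      have "linear ?G"
        by (rule linear_chart_segment[OF \<Omega> lagrangian_chart_segment[OF \<Omega> l tr] lZ l(3) chart_segment_transversal[OF \<Omega> l tr] ZU])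
      then show "0 \<in> range ?G" using linear_0 by (metis rangeI)
      show "norm (g x - x) \<le> \<eta> * norm x" for x using g by blast
      fix y assume "y \<in> range ?G"
      then obtain x where y: "y = ?G x" by blast
      have G: "y = ?p x + ((1 - r) * \<mu>) *\<^sub>R k x + r *\<^sub>R u x"
        unfolding y chart_segment_def[of _ "range (?E \<mu>)"] oblique_chart_segment[OF \<Omega> l tr] E oZ by (simp add: algebra_simps)
      have py: "?p y = ?p x"
        unfolding G linear_add[OF lp] linear_cmul[OF lp] using U0[OF uU] U0[OF kU] oblique_idem[OF c(1)] by simp
      have "y - ?p y = ((1 - r) * \<mu>) *\<^sub>R k x + r *\<^sub>R u x" using G unfolding py by simp
      then have "norm (y - ?p y) \<le> norm (((1 - r) * \<mu>) *\<^sub>R k x) + norm (r *\<^sub>R u x)"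
        using norm_triangle_ineq[of "((1 - r) * \<mu>) *\<^sub>R k x" "r *\<^sub>R u x"] by metis
      also have "\<dots> \<le> \<kappa> * norm (?p x) + 1 * norm (?p x)"
      proof (rule add_mono)
        have "(1 - r) * \<mu> \<le> 1" using r \<mu> by (intro mult_le_one) auto
        then have "\<bar>(1 - r) * \<mu>\<bar> * norm (k x) \<le> 1 * (\<kappa> * norm (?p x))"
          using kb[of x] r \<mu> \<kappa>(1) by (intro mult_mono) auto
        then show "norm (((1 - r) * \<mu>) *\<^sub>R k x) \<le> \<kappa> * norm (?p x)" by simp
        have "norm (u x) \<le> 1 * norm (?p x)"
          using ub[of x] mult_right_mono[of "D * \<eta>" 1 "norm (?p x)"] \<eta>4 by simp
        then have "\<bar>r\<bar> * norm (u x) \<le> 1 * (1 * norm (?p x))" using r by (intro mult_mono) auto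
        then show "norm (r *\<^sub>R u x) \<le> 1 * norm (?p x)" by simp
      qed
      finally show "norm (y - ?p y) \<le> (1 + \<kappa>) * norm (?p y)" by (simp add: py algebra_simps)
    qed
    ultimately show ?thesis using ZU by blast
  qed
  show ?thesis
    unfolding admissible_radius_def using \<eta>0 \<eta>1 one two by (intro exI[of _ \<eta>]) blast
qed

section \<open>Existence of regular representatives\<close>

lemma symplectic_map_inv:
  assumes S: "symplectic_map \<Omega> S"
  shows "symplectic_map \<Omega> (inv S)"
proof -
  have b: "linear S" "bij S" and p: "\<And>u v. \<Omega> (S u) (S v) = \<Omega> u v" using S by (auto simp: symplectic_map_def)
  have "\<Omega> (inv S u) (inv S v) = \<Omega> u v" for u v
    using p[of "inv S u" "inv S v"] b(2) by (simp add: bij_is_surj surj_f_inv_f)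
  then show ?thesis
    using b inj_linear_imp_inv_linear[OF b(1) bij_is_inj[OF b(2)]] bij_imp_bij_inv[OF b(2)] by (simp add: symplectic_map_def)
qed

lemma symplectic_map_comp:
  assumes "symplectic_map \<Omega> S" "symplectic_map \<Omega> T"
  shows "symplectic_map \<Omega> (\<lambda>x. S (T x))"
  using assms linear_compose[of T S] bij_comp[of T S] by (simp add: symplectic_map_def comp_def)

lemma chart_segment_image:
  fixes S :: "'b::euclidean_space \<Rightarrow> 'b"
  assumes S: "linear S" "bij S" and c: "complementary A U" "complementary B U"
  shows "range (chart_segment (S ` U) (S ` A) (S ` B) r) = S ` range (chart_segment U A B r)"
proof -
  have e: "chart_segment (S ` U) (S ` A) (S ` B) r (S x) = S (chart_segment U A B r x)" for x
    unfolding chart_segment_def using oblique_image[OF S c(1)] oblique_image[OF S c(2)]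
    by (simp add: linear_add[OF S(1)] linear_diff[OF S(1)] linear_cmul[OF S(1)])
  have "range (chart_segment (S ` U) (S ` A) (S ` B) r) = (\<lambda>x. chart_segment (S ` U) (S ` A) (S ` B) r (S x)) ` UNIV"
    using S(2) by (metis bij_is_surj image_image)
  also have "\<dots> = S ` range (chart_segment U A B r)" unfolding e by (simp add: image_image)
  finally show ?thesis .
qed

lemma Int_image_eq_0:
  assumes "linear S" "bij S" "X \<inter> Y = {0}"
  shows "S ` X \<inter> S ` Y = {0}"
  using assms image_Int[OF bij_is_inj[OF assms(2)], of X Y] by (simp add: linear_0)

text \<open>\<open>P\<close> stands for a sign condition, so that positivity and negativity are
  transported by one argument.\<close>

lemma chart_form_image:
  assumes S: "symplectic_map \<Omega> S" and c: "complementary A U" "complementary B U"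
    and P: "\<And>x. x \<notin> U \<Longrightarrow> P (\<Omega> (oblique A U x) (oblique B U x))" and y: "y \<notin> S ` U"
  shows "P (\<Omega> (oblique (S ` A) (S ` U) y) (oblique (S ` B) (S ` U) y))"
proof -
  have b: "linear S" "bij S" and p: "\<And>u v. \<Omega> (S u) (S v) = \<Omega> u v" using S by (auto simp: symplectic_map_def)
  obtain x where x: "y = S x" using b(2) by (metis bij_pointE)
  then have "x \<notin> U" using y by blast
  then show ?thesis unfolding x oblique_image[OF b c(1)] oblique_image[OF b c(2)] p by (rule P)
qed

text \<open>The frame \<open>\<Psi> s\<close> is frozen. The path first climbs the positive segment
  from parameter \<open>\<epsilon>\<close> to \<open>\<mu>\<close>, then goes straight to its
  target, which lies below \<open>A\<^sub>\<mu>\<close> because \<open>\<Psi> t\<close> is close to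
  \<open>\<Psi> s\<close>; the second half is therefore negative. Transversality to the image of
  \<open>U\<close> under \<open>\<Psi> r\<close> is kept for the homotopy to the original
  path.\<close>

lemma definite_path_step:
  fixes \<Omega> :: "'b::euclidean_space \<Rightarrow> 'b \<Rightarrow> real"
  assumes \<Omega>: "symplectic_form \<Omega>" and L0: "lagrangian \<Omega> L0"
    and l: "lagrangian \<Omega> \<Lambda>" "lagrangian \<Omega> B" "lagrangian \<Omega> U" and tr: "\<Lambda> \<inter> U = {0}" "B \<inter> U = {0}"
    and f: "\<And>x. x \<notin> U \<Longrightarrow> \<Omega> (oblique \<Lambda> U x) (oblique B U x) > 0"
    and \<eta>: "admissible_radius \<Omega> \<Lambda> B U \<eta>"
    and st: "s < t" and Sp: "\<And>r. r \<in> {s..t} \<Longrightarrow> symplectic_map \<Omega> (\<Psi> r)"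
    and near: "\<And>r x. r \<in> {s..t} \<Longrightarrow> norm (inv (\<Psi> s) (\<Psi> r x) - x) \<le> \<eta> * norm x"
    and \<epsilon>: "0 \<le> \<epsilon>" "\<epsilon> \<le> \<eta>" "0 \<le> \<epsilon>'" "\<epsilon>' \<le> \<eta>"
    and fs: "fs \<Longrightarrow> \<Psi> s ` range (chart_segment U \<Lambda> B \<epsilon>) \<inter> L0 = {0}"
    and ft: "ft \<Longrightarrow> \<Psi> t ` range (chart_segment U \<Lambda> B \<epsilon>') \<inter> L0 = {0}"
  shows "\<exists>l. definite_path \<Omega> L0 s t l fs ft \<and> l s = \<Psi> s ` range (chart_segment U \<Lambda> B \<epsilon>) \<and>
     l t = \<Psi> t ` range (chart_segment U \<Lambda> B \<epsilon>') \<and> (\<forall>r\<in>{s..t}. l r \<inter> \<Psi> r ` U = {0})"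
proof -
  let ?S = "\<Psi> s" and ?A = "\<lambda>r. range (chart_segment U \<Lambda> B r)"
  have S: "symplectic_map \<Omega> ?S" using Sp st by simp
  then have lS: "linear ?S" "bij ?S" by (auto simp: symplectic_map_def)
  have inv: "?S (inv ?S x) = x" for x using lS(2) by (simp add: bij_is_surj surj_f_inv_f)
  have \<eta>1: "\<eta> > 0" "\<eta> \<le> 1/4" using \<eta> by (auto simp: admissible_radius_def)
  have one: "?A r \<inter> g ` U = {0}" if "\<forall>x. norm (g x - x) \<le> \<eta> * norm x" "0 \<le> r" "r \<le> 1" for g r
    using \<eta> that unfolding admissible_radius_def by blast
  have c: "complementary \<Lambda> U" "complementary B U" using lagrangian_complementary l tr by blast+
  have img: "range (chart_segment (?S ` U) (?S ` \<Lambda>) (?S ` B) r) = ?S ` ?A r" for r by (rule chart_segment_image[OF lS c])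
  have l': "lagrangian \<Omega> (?S ` \<Lambda>)" "lagrangian \<Omega> (?S ` B)" "lagrangian \<Omega> (?S ` U)" using lagrangian_image[OF S] l by blast+
  have tr': "?S ` \<Lambda> \<inter> ?S ` U = {0}" "?S ` B \<inter> ?S ` U = {0}" using Int_image_eq_0[OF lS] tr by blast+
  have f': "\<Omega> (oblique (?S ` \<Lambda>) (?S ` U) y) (oblique (?S ` B) (?S ` U) y) > 0" if "y \<notin> ?S ` U" for y
    by (rule chart_form_image[OF S c, where P="\<lambda>x. x > 0", OF f that])
  \<comment> \<open>Generic, to keep the corner off \<open>L0\<close>, and above \<open>1/2\<close>,
    the margin built into \<open>admissible_radius\<close>.\<close>
  obtain \<mu> where \<mu>: "1/2 < \<mu>" "\<mu> < 1" and n\<mu>: "?S ` ?A \<mu> \<inter> L0 = {0}"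
    using chart_segment_generic[OF \<Omega> L0 l' tr' f', of "1/2" 1] unfolding img by auto
  \<comment> \<open>\<open>\<Psi> t\<close> seen in the frame of \<open>\<Psi> s\<close>; it is
    \<open>\<eta>\<close>-close to the identity.\<close>
  define h where "h x = inv ?S (\<Psi> t x)" for x
  have h: "symplectic_map \<Omega> h" unfolding h_def using symplectic_map_comp[OF symplectic_map_inv[OF S] Sp[of t]] st by simp
  have hn: "\<forall>x. norm (h x - x) \<le> \<eta> * norm x" unfolding h_def using near[of t] st by simp
  let ?Z = "h ` ?A \<epsilon>'"
  have SZ: "?S ` ?Z = \<Psi> t ` ?A \<epsilon>'" unfolding h_def by (simp add: image_image inv)
  have two: "?Z \<inter> U = {0}" "\<And>x. x \<notin> U \<Longrightarrow> \<Omega> (oblique (?A \<mu>) U x) (oblique ?Z U x) < 0"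
    "\<And>g r. \<forall>x. norm (g x - x) \<le> \<eta> * norm x \<Longrightarrow> 0 \<le> r \<Longrightarrow> r \<le> 1 \<Longrightarrow> range (chart_segment U (?A \<mu>) ?Z r) \<inter> g ` U = {0}"
  proof -
    have "?Z \<inter> U = {0} \<and> (\<forall>\<mu>. 1/2 \<le> \<mu> \<longrightarrow> \<mu> \<le> 1 \<longrightarrow>
         (\<forall>x. x \<notin> U \<longrightarrow> \<Omega> (oblique (?A \<mu>) U x) (oblique ?Z U x) < 0) \<and>
         (\<forall>g r. (\<forall>x. norm (g x - x) \<le> \<eta> * norm x) \<longrightarrow> 0 \<le> r \<longrightarrow> r \<le> 1 \<longrightarrow> range (chart_segment U (?A \<mu>) ?Z r) \<inter> g ` U = {0}))"
      by (rule \<eta>[unfolded admissible_radius_def, THEN conjunct2, THEN conjunct2, THEN conjunct2,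
            THEN spec[of _ h], THEN spec[of _ \<epsilon>'], THEN mp, OF h, THEN mp, OF hn, THEN mp, OF \<epsilon>(3), THEN mp, OF \<epsilon>(4)])
    then show "?Z \<inter> U = {0}" "\<And>x. x \<notin> U \<Longrightarrow> \<Omega> (oblique (?A \<mu>) U x) (oblique ?Z U x) < 0"
    "\<And>g r. \<forall>x. norm (g x - x) \<le> \<eta> * norm x \<Longrightarrow> 0 \<le> r \<Longrightarrow> r \<le> 1 \<Longrightarrow> range (chart_segment U (?A \<mu>) ?Z r) \<inter> g ` U = {0}"
      using \<mu> by auto
  qed
  have lA: "lagrangian \<Omega> (?A r)" "?A r \<inter> U = {0}" for r
    using lagrangian_chart_segment[OF \<Omega> l tr] chart_segment_transversal[OF \<Omega> l tr] by blast+
  have lZ: "lagrangian \<Omega> ?Z" using lagrangian_image[OF h lA(1)] .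
  have cA: "complementary (?A \<mu>) U" "complementary ?Z U" using lagrangian_complementary lA lZ l(3) two(1) by blast+
  have cS: "complementary (?S ` ?A \<mu>) (?S ` U)" "complementary (?S ` ?Z) (?S ` U)" using complementary_image[OF lS] cA by blast+
  have img2: "range (chart_segment (?S ` U) (?S ` ?A \<mu>) (?S ` ?Z) r) = ?S ` range (chart_segment U (?A \<mu>) ?Z r)" for r
    by (rule chart_segment_image[OF lS cA])
  define c' where "c' = (s + t) / 2"
  have c': "s < c'" "c' < t" using st by (auto simp: c'_def)
  obtain \<theta>1 \<theta>1' where "time_change s c' fs True \<theta>1 \<theta>1'" using time_change_exists[OF c'(1)] by blast
  then have T1: "\<theta>1 s = 0" "\<theta>1 c' = 1" "\<forall>t. (\<theta>1 has_vector_derivative \<theta>1' t) (at t within {s..c'})" "continuous_on {s..c'} \<theta>1'"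
     "\<forall>t\<in>{s..c'}. 0 \<le> \<theta>1 t \<and> \<theta>1 t \<le> 1" "\<forall>t. s < t \<and> t < c' \<longrightarrow> \<theta>1' t > 0"
     "if fs then \<theta>1' s = 0 else \<theta>1' s > 0" "if True then \<theta>1' c' = 0 else \<theta>1' c' > 0"
    unfolding time_change_def by blast+
  obtain \<theta>2 \<theta>2' where "time_change c' t True ft \<theta>2 \<theta>2'" using time_change_exists[OF c'(2)] by blast
  then have T2: "\<theta>2 c' = 0" "\<theta>2 t = 1" "\<forall>r. (\<theta>2 has_vector_derivative \<theta>2' r) (at r within {c'..t})" "continuous_on {c'..t} \<theta>2'"
     "\<forall>r\<in>{c'..t}. 0 \<le> \<theta>2 r \<and> \<theta>2 r \<le> 1" "\<forall>r. c' < r \<and> r < t \<longrightarrow> \<theta>2' r > 0"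
     "if True then \<theta>2' c' = 0 else \<theta>2' c' > 0" "if ft then \<theta>2' t = 0 else \<theta>2' t > 0"
    unfolding time_change_def by blast+
  define \<rho> where "\<rho> r = \<epsilon> + (\<mu> - \<epsilon>) * \<theta>1 r" for r
  have d0: "\<mu> - \<epsilon> > 0" using \<mu> \<epsilon> \<eta>1 by linarith
  have \<rho>: "\<rho> s = \<epsilon>" "\<rho> c' = \<mu>" by (auto simp: \<rho>_def T1)
  have \<rho>01: "0 \<le> \<rho> r \<and> \<rho> r \<le> 1" if "r \<in> {s..c'}" for r
  proof -
    have "0 \<le> \<theta>1 r" "\<theta>1 r \<le> 1" using T1(5) that by auto
    then have "0 \<le> (\<mu> - \<epsilon>) * \<theta>1 r" "(\<mu> - \<epsilon>) * \<theta>1 r \<le> (\<mu> - \<epsilon>) * 1" using d0 by (auto intro: mult_left_mono)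
    then show ?thesis using \<mu> \<epsilon> by (simp add: \<rho>_def)
  qed
  define l1 where "l1 r = range (chart_segment (?S ` U) (?S ` \<Lambda>) (?S ` B) (\<rho> r))" for r
  have g1: "definite_path \<Omega> L0 s c' l1 fs True"
    unfolding l1_def
  proof (rule definite_path_chart_segment[OF \<Omega> l' tr', where \<theta>'="\<lambda>r. (\<mu> - \<epsilon>) * \<theta>1' r"])
    show "(\<forall>x. x \<notin> ?S ` U \<longrightarrow> \<Omega> (oblique (?S ` \<Lambda>) (?S ` U) x) (oblique (?S ` B) (?S ` U) x) > 0) \<or>
      (\<forall>x. x \<notin> ?S ` U \<longrightarrow> \<Omega> (oblique (?S ` \<Lambda>) (?S ` U) x) (oblique (?S ` B) (?S ` U) x) < 0)" using f' by blast
    show "(\<rho> has_vector_derivative (\<mu> - \<epsilon>) * \<theta>1' r) (at r within {s..c'})" for r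
    proof -
      have "((\<lambda>r. (\<mu> - \<epsilon>) * \<theta>1 r) has_vector_derivative (\<mu> - \<epsilon>) * \<theta>1' r) (at r within {s..c'})"
        using T1(3) by (intro has_vector_derivative_mult_right) blast
      from has_vector_derivative_add[OF has_vector_derivative_const this, of \<epsilon>] show ?thesis by (simp add: \<rho>_def[abs_def])
    qed
    show "continuous_on {s..c'} (\<lambda>r. (\<mu> - \<epsilon>) * \<theta>1' r)" using T1(4) by (intro continuous_intros)
    show "(\<mu> - \<epsilon>) * \<theta>1' r > 0 \<or> range (chart_segment (?S ` U) (?S ` \<Lambda>) (?S ` B) (\<rho> r)) \<inter> L0 = {0}" if r: "r \<in> {s..c'}" for r
    proof -
      consider "s < r \<and> r < c'" | "r = c'" | "r = s" using r by force
      then show ?thesis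
      proof cases
        case 1 then show ?thesis using T1(6) d0 by simp
      next
        case 2 then show ?thesis using n\<mu> \<rho> by (simp add: img)
      next
        case 3 then show ?thesis using fs \<rho> T1(7) d0 by (cases fs) (auto simp: img)
      qed
    qed
    show "fs \<Longrightarrow> (\<mu> - \<epsilon>) * \<theta>1' s = 0" "True \<Longrightarrow> (\<mu> - \<epsilon>) * \<theta>1' c' = 0" using T1(7,8) by auto
  qed
  define l2 where "l2 r = range (chart_segment (?S ` U) (?S ` ?A \<mu>) (?S ` ?Z) (\<theta>2 r))" for r
  have l2c: "l2 c' = ?S ` ?A \<mu>" unfolding l2_def T2 by (rule chart_segment_0[OF cS(1)])
  have l2t: "l2 t = ?S ` ?Z" unfolding l2_def T2 by (rule chart_segment_1[OF cS(2)])
  have g2: "definite_path \<Omega> L0 c' t l2 True ft"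
    unfolding l2_def
  proof (rule definite_path_chart_segment[OF \<Omega> _ _ l'(3), where \<theta>'=\<theta>2'])
    show "lagrangian \<Omega> (?S ` ?A \<mu>)" "lagrangian \<Omega> (?S ` ?Z)" using lagrangian_image[OF S] lA lZ by blast+
    show "?S ` ?A \<mu> \<inter> ?S ` U = {0}" by (rule Int_image_eq_0[OF lS lA(2)])
    show "?S ` ?Z \<inter> ?S ` U = {0}" by (rule Int_image_eq_0[OF lS two(1)])
    have "\<Omega> (oblique (?S ` ?A \<mu>) (?S ` U) y) (oblique (?S ` ?Z) (?S ` U) y) < 0" if "y \<notin> ?S ` U" for y
      by (rule chart_form_image[OF S cA, where P="\<lambda>x. x < 0", OF two(2) that])
    then show "(\<forall>x. x \<notin> ?S ` U \<longrightarrow> \<Omega> (oblique (?S ` ?A \<mu>) (?S ` U) x) (oblique (?S ` ?Z) (?S ` U) x) > 0) \<or>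
      (\<forall>x. x \<notin> ?S ` U \<longrightarrow> \<Omega> (oblique (?S ` ?A \<mu>) (?S ` U) x) (oblique (?S ` ?Z) (?S ` U) x) < 0)" by blast
    show "(\<theta>2 has_vector_derivative \<theta>2' r) (at r within {c'..t})" for r using T2(3) by blast
    show "continuous_on {c'..t} \<theta>2'" by (rule T2(4))
    show "\<theta>2' r > 0 \<or> range (chart_segment (?S ` U) (?S ` ?A \<mu>) (?S ` ?Z) (\<theta>2 r)) \<inter> L0 = {0}" if r: "r \<in> {c'..t}" for r
    proof -
      consider "c' < r \<and> r < t" | "r = c'" | "r = t" using r by force
      then show ?thesis
      proof cases
        case 1 then show ?thesis using T2(6) by simp
      next
        case 2 then show ?thesis using n\<mu> l2c unfolding l2_def by simp
      next
        case 3
        have "range (chart_segment (?S ` U) (?S ` ?A \<mu>) (?S ` ?Z) (\<theta>2 t)) = \<Psi> t ` ?A \<epsilon>'"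
          using l2t unfolding l2_def SZ .
        then show ?thesis unfolding 3 using ft T2(8) by (cases ft) simp_all
      qed
    qed
    show "True \<Longrightarrow> \<theta>2' c' = 0" "ft \<Longrightarrow> \<theta>2' t = 0" using T2(7,8) by auto
  qed
  have l1c: "l1 c' = ?S ` ?A \<mu>" unfolding l1_def \<rho> img ..
  let ?l = "\<lambda>r. if r \<le> c' then l1 r else l2 r"
  have "definite_path \<Omega> L0 s t ?l fs ft"
    by (rule definite_path_glue[OF g1 g2 _ c']) (use l1c l2c n\<mu> in auto)
  moreover have "?l s = ?S ` ?A \<epsilon>" using c' by (simp add: l1_def \<rho> img)
  moreover have "?l t = \<Psi> t ` ?A \<epsilon>'" using c' l2t SZ by simp
  moreover have "?l r \<inter> \<Psi> r ` U = {0}" if r: "r \<in> {s..t}" for r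
  proof -
    \<comment> \<open>In the frame of \<open>\<Psi> s\<close> the moving transversal is the image of
      \<open>U\<close> under a map near the identity, as \<open>admissible_radius\<close>
      requires.\<close>
    define g where "g x = inv ?S (\<Psi> r x)" for x
    have gU: "\<Psi> r ` U = ?S ` (g ` U)" unfolding g_def by (simp add: image_image inv)
    have gn: "\<forall>x. norm (g x - x) \<le> \<eta> * norm x" unfolding g_def using near[OF r] by blast
    show ?thesis
    proof (cases "r \<le> c'")
      case True
      then have "?A (\<rho> r) \<inter> g ` U = {0}" using one[OF gn] \<rho>01[of r] r by simp
      then show ?thesis unfolding gU using Int_image_eq_0[OF lS] True by (simp add: l1_def img)
    next
      case False
      then have "range (chart_segment U (?A \<mu>) ?Z (\<theta>2 r)) \<inter> g ` U = {0}" using two(3)[OF gn] T2(5) r by simp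
      then show ?thesis unfolding gU using Int_image_eq_0[OF lS] False by (simp add: l2_def img2)
    qed
  qed
  ultimately show ?thesis by blast
qed

text \<open>\<open>F\<close> is continuous on the compact square and vanishes on the diagonal, so
  uniform continuity yields one mesh width for all frames. By linearity
  \<open>F (s, t) * norm x\<close> dominates the displacement of \<open>x\<close>.\<close>

lemma linear_path_uniform:
  fixes \<Psi> :: "real \<Rightarrow> 'b::euclidean_space \<Rightarrow> 'b"
  assumes \<Psi>: "\<And>t. t \<in> {a..b} \<Longrightarrow> linear (\<Psi> t) \<and> bij (\<Psi> t)" and cont: "\<And>x. continuous_on {a..b} (\<lambda>t. \<Psi> t x)" and \<eta>: "\<eta> > 0"
  shows "\<exists>\<delta>>0. \<forall>s\<in>{a..b}. \<forall>t\<in>{a..b}. \<bar>t - s\<bar> < \<delta> \<longrightarrow> (\<forall>x. norm (inv (\<Psi> s) (\<Psi> t x) - x) \<le> \<eta> * norm x)"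
proof -
  let ?K = "{a..b} \<times> {a..b}"
  define F where "F q = (\<Sum>e\<in>Basis. norm (inv (\<Psi> (fst q)) (\<Psi> (snd q) e) - e))" for q
  have "continuous_on ?K (\<lambda>q. inv (\<Psi> (fst q)) (\<Psi> (snd q) e))" for e
    unfolding continuous_on_def
  proof
    fix q assume q: "q \<in> ?K"
    have c1: "continuous_on ?K (\<lambda>q. \<Psi> (fst q) x)" for x
      by (rule continuous_on_compose2[OF cont]) (auto intro!: continuous_intros)
    have c2: "continuous_on ?K (\<lambda>q. \<Psi> (snd q) x)" for x
      by (rule continuous_on_compose2[OF cont]) (auto intro!: continuous_intros)
    have lim: "((\<lambda>q. \<Psi> (fst q) x) \<longlongrightarrow> \<Psi> (fst q) x) (at q within ?K)"
      "((\<lambda>q. \<Psi> (snd q) x) \<longlongrightarrow> \<Psi> (snd q) x) (at q within ?K)" for x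
      using c1 c2 q unfolding continuous_on_def by blast+
    have ev: "\<forall>\<^sub>F p in at q within ?K. p \<in> ?K" by (simp add: eventually_at_filter)
    have ev1: "\<forall>\<^sub>F p in at q within ?K. linear (\<Psi> (fst p))" using ev by eventually_elim (use \<Psi> in auto)
    have ev2: "\<forall>\<^sub>F p in at q within ?K. linear (inv (\<Psi> (fst p)))"
      using ev
    proof eventually_elim
      case (elim p)
      then have "linear (\<Psi> (fst p))" "bij (\<Psi> (fst p))" using \<Psi>[of "fst p"] by auto
      then show ?case by (auto intro: inj_linear_imp_inv_linear bij_is_inj)
    qed
    have q1: "linear (\<Psi> (fst q))" "bij (\<Psi> (fst q))" using \<Psi> q by auto
    have q2: "linear (inv (\<Psi> (fst q)))" using q1 by (auto intro: inj_linear_imp_inv_linear bij_is_inj)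
    show "((\<lambda>q. inv (\<Psi> (fst q)) (\<Psi> (snd q) e)) \<longlongrightarrow> inv (\<Psi> (fst q)) (\<Psi> (snd q) e)) (at q within ?K)"
      by (rule tendsto_linear_family[OF ev2 q2 tendsto_inv_linear_family[OF ev1 q1 lim(1)] lim(2)])
  qed
  then have "continuous_on ?K F" unfolding F_def by (intro continuous_intros) auto
  then have "uniformly_continuous_on ?K F" by (rule compact_uniformly_continuous) (simp add: compact_Times)
  then obtain \<delta> where \<delta>: "\<delta> > 0" "\<forall>q\<in>?K. \<forall>q'\<in>?K. dist q' q < \<delta> \<longrightarrow> dist (F q') (F q) < \<eta>"
    using \<eta> unfolding uniformly_continuous_on_def by blast
  show ?thesis
  proof (intro exI[of _ \<delta>] conjI ballI impI allI)
    fix s t x assume st: "s \<in> {a..b}" "t \<in> {a..b}" "\<bar>t - s\<bar> < \<delta>"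
    have s: "linear (\<Psi> s)" "bij (\<Psi> s)" and t: "linear (\<Psi> t)" using \<Psi> st by auto
    have "dist (F (s, t)) (F (s, s)) < \<eta>" using \<delta>(2) st by (auto simp: dist_Pair_Pair dist_real_def)
    moreover have "F (s, s) = 0" unfolding F_def using s(2) by (simp add: bij_is_inj)
    ultimately have F: "F (s, t) \<le> \<eta>" by (auto simp: dist_real_def)
    have li: "linear (inv (\<Psi> s))" using s by (auto intro: inj_linear_imp_inv_linear bij_is_inj)
    have lT: "linear (\<lambda>x. inv (\<Psi> s) (\<Psi> t x) - x)"
      using linear_compose[OF t li] by (intro linear_compose_sub) (auto simp: comp_def linear_ident)
    have "norm (inv (\<Psi> s) (\<Psi> t x) - x) \<le> (\<Sum>e\<in>Basis. \<bar>x \<bullet> e\<bar> * norm (inv (\<Psi> s) (\<Psi> t e) - e))"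
      using linear_expansion[OF lT, of x] norm_sum[of "\<lambda>e. (x \<bullet> e) *\<^sub>R (inv (\<Psi> s) (\<Psi> t e) - e)" Basis] by simp
    also have "\<dots> \<le> (\<Sum>e\<in>Basis. norm x * norm (inv (\<Psi> s) (\<Psi> t e) - e))"
      by (intro sum_mono mult_right_mono) (auto simp: Basis_le_norm)
    also have "\<dots> = F (s, t) * norm x" by (simp add: F_def sum_distrib_left mult.commute)
    also have "\<dots> \<le> \<eta> * norm x" using F by (intro mult_right_mono) auto
    finally show "norm (inv (\<Psi> s) (\<Psi> t x) - x) \<le> \<eta> * norm x" .
  qed (rule \<delta>(1))
qed

text \<open>The interval is cut into pieces short enough for \<open>definite_path_step\<close>. At
  interior nodes the path passes through the image of \<open>A\<^sub>r\<close> for a small generic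
  \<open>r\<close>, since that of \<open>\<Lambda>\<close> may meet \<open>L0\<close>. At
  \<open>a\<close> and \<open>b\<close> the exact position is required, crossing or not, and no flag
  is set.\<close>

lemma definite_path_exists:
  fixes \<Omega> :: "'b::euclidean_space \<Rightarrow> 'b \<Rightarrow> real"
  assumes \<Omega>: "symplectic_form \<Omega>" and L0: "lagrangian \<Omega> L0" and \<Lambda>: "lagrangian \<Omega> \<Lambda>"
    and U: "lagrangian \<Omega> U" "\<Lambda> \<inter> U = {0}" and ab: "a < b"
    and Sp: "\<And>t. t \<in> {a..b} \<Longrightarrow> symplectic_map \<Omega> (\<Psi> t)" and cont: "\<And>x. continuous_on {a..b} (\<lambda>t. \<Psi> t x)"
  shows "\<exists>l. definite_path \<Omega> L0 a b l False False \<and> l a = \<Psi> a ` \<Lambda> \<and> l b = \<Psi> b ` \<Lambda> \<and> (\<forall>t\<in>{a..b}. l t \<inter> \<Psi> t ` U = {0})"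
proof -
  obtain B where B: "lagrangian \<Omega> B" "B \<inter> U = {0}"
    and f: "\<And>x. \<Omega> (oblique \<Lambda> U x) (oblique B U x) = oblique \<Lambda> U x \<bullet> oblique \<Lambda> U x"
    using positive_lagrangian_exists[OF \<Omega> \<Lambda> U] by blast
  note l = \<Lambda> B(1) U(1) and tr = U(2) B(2)
  have c: "complementary \<Lambda> U" "complementary B U" using lagrangian_complementary l tr by blast+
  have pos: "\<Omega> (oblique \<Lambda> U x) (oblique B U x) > 0" if "x \<notin> U" for x
    using f[of x] that oblique_eq_0_iff[OF c(1), of x] by simp
  obtain \<eta> where \<eta>: "admissible_radius \<Omega> \<Lambda> B U \<eta>" using model_neighbourhood[OF \<Omega> l tr f] by blast
  have \<eta>0: "\<eta> > 0" "\<eta> \<le> 1/4" using \<eta> by (auto simp: admissible_radius_def)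
  have lin: "linear (\<Psi> t) \<and> bij (\<Psi> t)" if "t \<in> {a..b}" for t using Sp[OF that] by (simp add: symplectic_map_def)
  obtain \<delta> where \<delta>: "\<delta> > 0"
    "\<And>s t x. s \<in> {a..b} \<Longrightarrow> t \<in> {a..b} \<Longrightarrow> \<bar>t - s\<bar> < \<delta> \<Longrightarrow> norm (inv (\<Psi> s) (\<Psi> t x) - x) \<le> \<eta> * norm x"
    using linear_path_uniform[OF lin cont \<eta>0(1)] by blast
  obtain N :: nat where N: "real N > max 1 ((b - a) / \<delta>)" using reals_Archimedean2 by blast
  define w where "w = (b - a) / real N"
  have w: "w > 0" "w < \<delta>" "real N * w = b - a" using N ab \<delta>(1) by (auto simp: w_def field_simps)
  let ?A = "\<lambda>r. range (chart_segment U \<Lambda> B r)"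
  define \<tau> where "\<tau> i = a + real i * w" for i :: nat
  have \<tau>in: "\<tau> i \<in> {a..b}" if "i \<le> N" for i
  proof -
    have "real i * w \<le> real N * w" using that w by (intro mult_right_mono) auto
    then show ?thesis using w by (simp add: \<tau>_def)
  qed
  have \<tau>S: "\<tau> (Suc i) = \<tau> i + w" for i by (simp add: \<tau>_def algebra_simps)
  have step: "\<exists>l. definite_path \<Omega> L0 (\<tau> i) (\<tau> (Suc i)) l fs ft \<and> l (\<tau> i) = \<Psi> (\<tau> i) ` ?A \<epsilon> \<and>
     l (\<tau> (Suc i)) = \<Psi> (\<tau> (Suc i)) ` ?A \<epsilon>' \<and> (\<forall>r\<in>{\<tau> i..\<tau> (Suc i)}. l r \<inter> \<Psi> r ` U = {0})"
    if i: "i < N" and \<epsilon>: "0 \<le> \<epsilon>" "\<epsilon> \<le> \<eta>" "0 \<le> \<epsilon>'" "\<epsilon>' \<le> \<eta>"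
      and fs: "fs \<Longrightarrow> \<Psi> (\<tau> i) ` ?A \<epsilon> \<inter> L0 = {0}" and ft: "ft \<Longrightarrow> \<Psi> (\<tau> (Suc i)) ` ?A \<epsilon>' \<inter> L0 = {0}" for i \<epsilon> \<epsilon>' fs ft
  proof (rule definite_path_step[OF \<Omega> L0 l tr pos \<eta> _ _ _ \<epsilon> fs ft])
    have sub: "r \<in> {a..b}" if "r \<in> {\<tau> i..\<tau> (Suc i)}" for r
      using that \<tau>in[of i] \<tau>in[of "Suc i"] i by auto
    show "\<tau> i < \<tau> (Suc i)" using w \<tau>S by simp
    show "symplectic_map \<Omega> (\<Psi> r)" if "r \<in> {\<tau> i..\<tau> (Suc i)}" for r using Sp sub[OF that] by blast
    show "norm (inv (\<Psi> (\<tau> i)) (\<Psi> r x) - x) \<le> \<eta> * norm x" if "r \<in> {\<tau> i..\<tau> (Suc i)}" for r x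
      using that \<tau>S[of i] w \<tau>in[of i] i sub[OF that] by (intro \<delta>(2)) auto
  qed
  have A0: "?A 0 = \<Lambda>" by (rule chart_segment_0[OF c(1)])
  \<comment> \<open>\<open>\<epsilon>\<close> and \<open>fl\<close> stay general: inside the
    induction the right end is a generic flagged node, in the conclusion it is \<open>b\<close> with
    \<open>\<epsilon> = 0\<close> and without flag.\<close>
  have main: "\<exists>l. definite_path \<Omega> L0 a (\<tau> (Suc i)) l False fl \<and> l a = \<Psi> a ` \<Lambda> \<and>
      l (\<tau> (Suc i)) = \<Psi> (\<tau> (Suc i)) ` ?A \<epsilon> \<and> (\<forall>r\<in>{a..\<tau> (Suc i)}. l r \<inter> \<Psi> r ` U = {0})"
    if "Suc i \<le> N" "0 \<le> \<epsilon>" "\<epsilon> \<le> \<eta>" "fl \<Longrightarrow> \<Psi> (\<tau> (Suc i)) ` ?A \<epsilon> \<inter> L0 = {0}" for i \<epsilon> fl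
    using that
  proof (induction i arbitrary: \<epsilon> fl)
    case 0
    have "\<tau> 0 = a" by (simp add: \<tau>_def)
    then show ?case using step[of 0 0 \<epsilon> False fl] 0 \<eta>0 A0 by auto
  next
    case (Suc i)
    let ?S = "\<Psi> (\<tau> (Suc i))"
    have S: "symplectic_map \<Omega> ?S" using Sp \<tau>in[of "Suc i"] Suc.prems(1) by simp
    then have lS: "linear ?S" "bij ?S" by (auto simp: symplectic_map_def)
    have "\<exists>r. 0 < r \<and> r < \<eta> \<and> range (chart_segment (?S ` U) (?S ` \<Lambda>) (?S ` B) r) \<inter> L0 = {0}"
    proof (rule chart_segment_generic[OF \<Omega> L0])
      show "lagrangian \<Omega> (?S ` \<Lambda>)" "lagrangian \<Omega> (?S ` B)" "lagrangian \<Omega> (?S ` U)" using lagrangian_image[OF S] l by blast+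
      show "?S ` \<Lambda> \<inter> ?S ` U = {0}" "?S ` B \<inter> ?S ` U = {0}" using Int_image_eq_0[OF lS] tr by blast+
      show "\<Omega> (oblique (?S ` \<Lambda>) (?S ` U) y) (oblique (?S ` B) (?S ` U) y) > 0" if "y \<notin> ?S ` U" for y
        by (rule chart_form_image[OF S c, where P="\<lambda>x. x > 0", OF pos that])
    qed (use \<eta>0 in auto)
    then obtain r where r: "0 < r" "r < \<eta>" "?S ` ?A r \<inter> L0 = {0}" unfolding chart_segment_image[OF lS c] by blast
    obtain l1 where l1: "definite_path \<Omega> L0 a (\<tau> (Suc i)) l1 False True" "l1 a = \<Psi> a ` \<Lambda>" "l1 (\<tau> (Suc i)) = ?S ` ?A r"
      "\<forall>r\<in>{a..\<tau> (Suc i)}. l1 r \<inter> \<Psi> r ` U = {0}"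
      using Suc.IH[of r True] Suc.prems(1) r by auto
    have i: "Suc i < N" using Suc.prems(1) by simp
    have "\<exists>l. definite_path \<Omega> L0 (\<tau> (Suc i)) (\<tau> (Suc (Suc i))) l True fl \<and> l (\<tau> (Suc i)) = ?S ` ?A r \<and>
     l (\<tau> (Suc (Suc i))) = \<Psi> (\<tau> (Suc (Suc i))) ` ?A \<epsilon> \<and> (\<forall>r\<in>{\<tau> (Suc i)..\<tau> (Suc (Suc i))}. l r \<inter> \<Psi> r ` U = {0})"
      by (rule step[OF i]) (use r Suc.prems in auto)
    then obtain l2 where l2: "definite_path \<Omega> L0 (\<tau> (Suc i)) (\<tau> (Suc (Suc i))) l2 True fl" "l2 (\<tau> (Suc i)) = ?S ` ?A r"
      "l2 (\<tau> (Suc (Suc i))) = \<Psi> (\<tau> (Suc (Suc i))) ` ?A \<epsilon>" "\<forall>r\<in>{\<tau> (Suc i)..\<tau> (Suc (Suc i))}. l2 r \<inter> \<Psi> r ` U = {0}"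
      by blast
    have lt: "a < \<tau> (Suc i)" "\<tau> (Suc i) < \<tau> (Suc (Suc i))" 
    proof -
      have "a \<le> \<tau> i" using w by (simp add: \<tau>_def)
      then show "a < \<tau> (Suc i)" "\<tau> (Suc i) < \<tau> (Suc (Suc i))" using w(1) \<tau>S[of i] \<tau>S[of "Suc i"] by linarith+
    qed
    let ?l = "\<lambda>t. if t \<le> \<tau> (Suc i) then l1 t else l2 t"
    have "definite_path \<Omega> L0 a (\<tau> (Suc (Suc i))) ?l False fl"
      by (rule definite_path_glue[OF l1(1) l2(1) _ lt]) (use l1 l2 r in auto)
    then show ?case using l1 l2 lt by (intro exI[of _ ?l]) auto
  qed
  have "N \<noteq> 0" using N by auto
  then obtain M where M: "N = Suc M" using not0_implies_Suc by blast
  have "\<tau> N = b" using w by (simp add: \<tau>_def)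
  then show ?thesis using main[of M 0 False] M \<eta>0 A0 by auto
qed

text \<open>Conjugating the projection \<open>?p\<close> by \<open>\<Psi> t\<close> gives
  idempotents that vary continuously and have the moving Lagrangians as ranges, so
  \<open>tendsto_proj_range\<close> applies.\<close>

lemma lagrangian_family_image:
  fixes \<Omega> :: "'b::euclidean_space \<Rightarrow> 'b \<Rightarrow> real"
  assumes \<Omega>: "symplectic_form \<Omega>" and \<Lambda>: "lagrangian \<Omega> \<Lambda>"
    and Sp: "\<And>t. t \<in> S \<Longrightarrow> symplectic_map \<Omega> (\<Psi> t)" and cont: "\<And>x. continuous_on S (\<lambda>t. \<Psi> t x)"
  shows "lagrangian_family \<Omega> S (\<lambda>t. \<Psi> t ` \<Lambda>)"
proof -
  obtain U where U: "lagrangian \<Omega> U" "\<Lambda> \<inter> U = {0}"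
    using transversal_lagrangian_exists[OF \<Omega> \<Lambda>] by blast
  have c: "complementary \<Lambda> U" using lagrangian_complementary[OF \<Lambda> U] .
  let ?p = "oblique \<Lambda> U"
  have lp: "linear ?p" using linear_oblique[OF c] .
  define E where "E t x = \<Psi> t (?p (inv (\<Psi> t) x))" for t x
  have lin: "linear (\<Psi> t)" "bij (\<Psi> t)" if "t \<in> S" for t using Sp[OF that] by (auto simp: symplectic_map_def)
  have li: "linear (inv (\<Psi> t))" if "t \<in> S" for t using lin[OF that] by (auto intro: inj_linear_imp_inv_linear bij_is_inj)
  have idem: "idempotent (E t)" if "t \<in> S" for t
  proof -
    have "linear (E t)" unfolding E_def
      using linear_compose[OF linear_compose[OF li[OF that] lp] lin(1)[OF that]] by (simp add: comp_def)
    moreover have "inv (\<Psi> t) (\<Psi> t x) = x" for x using lin(2)[OF that] by (simp add: bij_is_inj)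
    ultimately show ?thesis unfolding idempotent_def by (simp add: E_def oblique_idem[OF c])
  qed
  have ran: "range (E t) = \<Psi> t ` \<Lambda>" if "t \<in> S" for t
  proof -
    have "range (inv (\<Psi> t)) = UNIV" using lin(2)[OF that] bij_imp_bij_inv bij_is_surj by blast
    then have "range (E t) = \<Psi> t ` (?p ` UNIV)" unfolding E_def by (metis image_image)
    then show ?thesis using range_oblique[OF c] by simp
  qed
  have "continuous_on S (\<lambda>t. proj (\<Psi> t ` \<Lambda>) x)" for x
    unfolding continuous_on_def
  proof
    fix t assume t: "t \<in> S"
    have ev: "\<forall>\<^sub>F s in at t within S. s \<in> S" by (simp add: eventually_at_filter)
    have lim: "((\<lambda>s. \<Psi> s x) \<longlongrightarrow> \<Psi> t x) (at t within S)" for x using cont t unfolding continuous_on_def by blast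
    have ev1: "\<forall>\<^sub>F s in at t within S. linear (\<Psi> s)" using ev by eventually_elim (use lin in auto)
    have "((\<lambda>s. ?p (inv (\<Psi> s) x)) \<longlongrightarrow> ?p (inv (\<Psi> t) x)) (at t within S)" for x
      using linear_continuous_at[OF linear_conv_bounded_linear[THEN iffD1, OF lp]]
        tendsto_inv_linear_family[OF ev1 lin[OF t] lim] by (rule isCont_tendsto_compose)
    then have limE: "((\<lambda>s. E s x) \<longlongrightarrow> E t x) (at t within S)" for x
      unfolding E_def by (rule tendsto_linear_family[OF ev1 lin(1)[OF t] lim])
    have "\<forall>\<^sub>F s in at t within S. idempotent (E s)" using ev by eventually_elim (rule idem)
    from tendsto_proj_range[OF this idem[OF t] limE, of x]
    have "((\<lambda>s. proj (range (E s)) x) \<longlongrightarrow> proj (\<Psi> t ` \<Lambda>) x) (at t within S)" using ran[OF t] by simp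
    then show "((\<lambda>s. proj (\<Psi> s ` \<Lambda>) x) \<longlongrightarrow> proj (\<Psi> t ` \<Lambda>) x) (at t within S)"
    proof (rule Lim_transform_eventually)
      show "\<forall>\<^sub>F s in at t within S. proj (range (E s)) x = proj (\<Psi> s ` \<Lambda>) x"
        using ev by eventually_elim (simp add: ran)
    qed
  qed
  then show ?thesis unfolding lagrangian_family_def using lagrangian_image[OF Sp \<Lambda>] by blast
qed

text \<open>Straight-line homotopy in the moving chart of \<open>V t\<close>. A segment whose ends
  agree is constant, which keeps the endpoints fixed.\<close>

lemma fe_homotopic_of_common_transversal:
  fixes \<Omega> :: "'b::euclidean_space \<Rightarrow> 'b \<Rightarrow> real"
  assumes \<Omega>: "symplectic_form \<Omega>" and ab: "a \<le> b"
    and fam: "lagrangian_family \<Omega> {a..b} l" "lagrangian_family \<Omega> {a..b} l'" "lagrangian_family \<Omega> {a..b} V"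
    and tr: "\<And>t. t \<in> {a..b} \<Longrightarrow> l t \<inter> V t = {0}" "\<And>t. t \<in> {a..b} \<Longrightarrow> l' t \<inter> V t = {0}"
    and ends: "l a = l' a" "l b = l' b"
  shows "fe_homotopic \<Omega> a b l l'"
proof -
  have lag: "\<And>t. t \<in> {a..b} \<Longrightarrow> lagrangian \<Omega> (l t)" "\<And>t. t \<in> {a..b} \<Longrightarrow> lagrangian \<Omega> (l' t)" "\<And>t. t \<in> {a..b} \<Longrightarrow> lagrangian \<Omega> (V t)"
    using fam unfolding lagrangian_family_def by blast+
  have c: "complementary (l t) (V t)" "complementary (l' t) (V t)" if "t \<in> {a..b}" for t
    using lagrangian_complementary lag[OF that] tr[OF that] by blast+
  have cont: "continuous_on {a..b} (\<lambda>t. oblique (k t) (V t) x)"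
    if k: "lagrangian_family \<Omega> {a..b} k" and ck: "\<And>t. t \<in> {a..b} \<Longrightarrow> complementary (k t) (V t)" for k x
    unfolding continuous_on_def
  proof
    fix t assume t: "t \<in> {a..b}"
    have dims: "\<forall>\<^sub>F s in at t within {a..b}. subspace (j s) \<and> dim (j s) = dim (j t)" if j: "lagrangian_family \<Omega> {a..b} j" for j
    proof -
      have "subspace (j s) \<and> dim (j s) = dim (j t)" if "s \<in> {a..b}" for s
      proof -
        have "lagrangian \<Omega> (j s)" "lagrangian \<Omega> (j t)" using j that t unfolding lagrangian_family_def by blast+
        then show ?thesis unfolding lagrangian_def by simp
      qed
      then show ?thesis by (simp add: eventually_at_filter always_eventually)
    qed
    have lim: "((\<lambda>s. proj (j s) x) \<longlongrightarrow> proj (j t) x) (at t within {a..b})" if "lagrangian_family \<Omega> {a..b} j" for j x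
      using that t unfolding lagrangian_family_def continuous_on_def by blast
    show "((\<lambda>s. oblique (k s) (V s) x) \<longlongrightarrow> oblique (k t) (V t) x) (at t within {a..b})"
      by (rule tendsto_oblique[OF ck[OF t] dims[OF k] dims[OF fam(3)] lim[OF k] lim[OF fam(3)]])
  qed
  define H where "H s t = range (chart_segment (V t) (l t) (l' t) s)" for s t
  let ?K = "{0..1::real} \<times> {a..b}"
  have lagH: "lagrangian \<Omega> (H s t)" if "t \<in> {a..b}" for s t
    unfolding H_def by (rule lagrangian_chart_segment[OF \<Omega> lag[OF that] tr[OF that]])
  have idem: "idempotent (chart_segment (V t) (l t) (l' t) s)" if t: "t \<in> {a..b}" for s t
  proof -
    have "complementary (H s t) (V t)"
      using lagrangian_complementary[OF lagH[OF t] lag(3)[OF t]] chart_segment_transversal[OF \<Omega> lag[OF t] tr[OF t]]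
      unfolding H_def by blast
    from oblique_idem[OF this] show ?thesis
      unfolding idempotent_def H_def oblique_chart_segment[OF \<Omega> lag[OF t] tr[OF t]]
      using linear_chart_segment[OF \<Omega> lag[OF t] tr[OF t]] by blast
  qed
  have cs: "continuous_on ?K (\<lambda>q. chart_segment (V (snd q)) (l (snd q)) (l' (snd q)) (fst q) x)" for x
  proof -
    have 1: "continuous_on ?K (\<lambda>q. oblique (l (snd q)) (V (snd q)) x)"
      by (rule continuous_on_compose2[OF cont[OF fam(1) c(1)]]) (auto intro!: continuous_intros)
    have 2: "continuous_on ?K (\<lambda>q. oblique (l' (snd q)) (V (snd q)) x)"
      by (rule continuous_on_compose2[OF cont[OF fam(2) c(2)]]) (auto intro!: continuous_intros)
    show ?thesis unfolding chart_segment_def by (intro continuous_intros 1 2)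
  qed
  have HC: "continuous_on ?K (\<lambda>(s, t). proj (H s t) x)" for x
    unfolding continuous_on_def case_prod_unfold
  proof
    fix q assume q: "q \<in> ?K"
    let ?E = "\<lambda>q. chart_segment (V (snd q)) (l (snd q)) (l' (snd q)) (fst q)"
    have ev: "\<forall>\<^sub>F p in at q within ?K. p \<in> ?K" by (simp add: eventually_at_filter)
    have "\<forall>\<^sub>F p in at q within ?K. idempotent (?E p)" using ev by eventually_elim (use idem in auto)
    moreover have "idempotent (?E q)" using idem q by auto
    moreover have "((\<lambda>p. ?E p x) \<longlongrightarrow> ?E q x) (at q within ?K)" for x using cs q unfolding continuous_on_def by blast
    ultimately show "((\<lambda>p. proj (H (fst p) (snd p)) x) \<longlongrightarrow> proj (H (fst q) (snd q)) x) (at q within ?K)"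
      unfolding H_def by (rule tendsto_proj_range)
  qed
  have H01: "H 0 t = l t" "H 1 t = l' t" if "t \<in> {a..b}" for t
    unfolding H_def using chart_segment_0[OF c(1)[OF that]] chart_segment_1[OF c(2)[OF that]] by blast+
  have He: "H s t = l t" if "l t = l' t" "t \<in> {a..b}" for s t
    unfolding H_def chart_segment_def using that range_oblique[OF c(1)[OF that(2)]] by simp
  have e: "H s a = l a" "H s b = l b" for s using He ends ab by auto
  show ?thesis
    unfolding fe_homotopic_def by (rule exI[of _ H]) (use lagH HC H01 e in blast)
qed

lemma regular_representative_exists:
  fixes \<Omega> :: "'b::euclidean_space \<Rightarrow> 'b \<Rightarrow> real"
  assumes \<Omega>: "symplectic_form \<Omega>" and L0: "lagrangian \<Omega> L0" and \<Lambda>: "lagrangian \<Omega> \<Lambda>" and ab: "a < b"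
    and Sp: "\<And>t. t \<in> {a..b} \<Longrightarrow> symplectic_map \<Omega> (\<Psi> t)" and cont: "\<And>x. continuous_on {a..b} (\<lambda>t. \<Psi> t x)"
  shows "\<exists>l. fe_homotopic \<Omega> a b (\<lambda>t. \<Psi> t ` \<Lambda>) l \<and> C1_lagr_path \<Omega> a b l \<and> regular_crossings \<Omega> L0 a b l"
proof -
  obtain U where U: "lagrangian \<Omega> U" "\<Lambda> \<inter> U = {0}"
    using transversal_lagrangian_exists[OF \<Omega> \<Lambda>] by blast
  obtain l where l: "definite_path \<Omega> L0 a b l False False" "l a = \<Psi> a ` \<Lambda>" "l b = \<Psi> b ` \<Lambda>"
    and tr: "\<forall>t\<in>{a..b}. l t \<inter> \<Psi> t ` U = {0}"
    using definite_path_exists[OF \<Omega> L0 \<Lambda> U ab Sp cont] by blast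
  have C1: "C1_lagr_path \<Omega> a b l" using definite_path_C1[OF l(1)] .
  have "fe_homotopic \<Omega> a b (\<lambda>t. \<Psi> t ` \<Lambda>) l"
  proof (rule fe_homotopic_of_common_transversal[OF \<Omega> less_imp_le[OF ab]])
    show "lagrangian_family \<Omega> {a..b} (\<lambda>t. \<Psi> t ` \<Lambda>)" by (rule lagrangian_family_image[OF \<Omega> \<Lambda> Sp cont])
    show "lagrangian_family \<Omega> {a..b} (\<lambda>t. \<Psi> t ` U)" by (rule lagrangian_family_image[OF \<Omega> U(1) Sp cont])
    show "lagrangian_family \<Omega> {a..b} l" using C1 by (simp add: C1_lagr_path_def lagr_path_eq_family)
    show "\<Psi> t ` \<Lambda> \<inter> \<Psi> t ` U = {0}" if "t \<in> {a..b}" for t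
      using Int_image_eq_0[of "\<Psi> t" \<Lambda> U] Sp[OF that] U(2) by (simp add: symplectic_map_def)
    show "l t \<inter> \<Psi> t ` U = {0}" if "t \<in> {a..b}" for t using tr that by blast
  qed (use l in auto)
  then show ?thesis using C1 definite_path_regular[OF \<Omega> L0 ab l(1)] by blast
qed

section \<open>Comparison of the two indices\<close>

text \<open>\<open>val\<close> shows that all admissible representatives give the same number and
  \<open>regular_representative_exists\<close> that there is one. Both are needed to evaluate the
  definite description.\<close>

lemma CLM_eq_potential:
  fixes \<Omega> :: "'b::euclidean_space \<Rightarrow> 'b \<Rightarrow> real"
  assumes \<Omega>: "symplectic_form \<Omega>" and L0: "lagrangian \<Omega> L0" and \<Lambda>: "lagrangian \<Omega> \<Lambda>" and ab: "a < b"
    and Sp: "\<And>t. t \<in> {a..b} \<Longrightarrow> symplectic_map \<Omega> (\<Psi> t)" and cont: "\<And>x. continuous_on {a..b} (\<lambda>t. \<Psi> t x)"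
    and m: "maslov_potential \<Omega> L0 {a..b} (\<lambda>t. \<Psi> t ` \<Lambda>) m"
  shows "2 * CLM \<Omega> L0 (\<lambda>t. \<Psi> t ` \<Lambda>) a b
    = m b - m a + int (dim (\<Psi> a ` \<Lambda> \<inter> L0)) - int (dim (\<Psi> b ` \<Lambda> \<inter> L0))"
proof -
  let ?l = "\<lambda>t. \<Psi> t ` \<Lambda>"
  have fam: "lagrangian_family \<Omega> {a..b} ?l" by (rule lagrangian_family_image[OF \<Omega> \<Lambda> Sp cont])
  have val: "2 * crossing_sum \<Omega> L0 a b l' = m b - m a + int (dim (?l a \<inter> L0)) - int (dim (?l b \<inter> L0))"
    if h: "fe_homotopic \<Omega> a b ?l l'" and C1: "C1_lagr_path \<Omega> a b l'" and r: "regular_crossings \<Omega> L0 a b l'" for l'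
  proof -
    have fam': "lagrangian_family \<Omega> {a..b} l'" using C1 by (simp add: C1_lagr_path_def lagr_path_eq_family)
    obtain m' where m': "maslov_potential \<Omega> L0 {a..b} l' m'" using maslov_potential_exists[OF \<Omega> L0 fam'] by auto
    have "m b - m a = m' b - m' a"
      by (rule maslov_potential_homotopy_invariant[OF \<Omega> L0 less_imp_le[OF ab] h fam fam' m m'])
    moreover have "m' b - m' a = 2 * crossing_sum \<Omega> L0 a b l' + int (dim (l' b \<inter> L0)) - int (dim (l' a \<inter> L0))"
      by (rule maslov_potential_crossing_sum[OF \<Omega> L0 ab C1 r m'])
    moreover have "l' a = ?l a \<and> l' b = ?l b"
    proof -
      obtain H :: "real \<Rightarrow> real \<Rightarrow> 'b set" where H: "\<forall>t\<in>{a..b}. H 0 t = ?l t \<and> H 1 t = l' t"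
          "\<forall>s\<in>{0..1}. H s a = ?l a \<and> H s b = ?l b"
        using h unfolding fe_homotopic_def by (elim exE conjE) simp
      have "a \<in> {a..b}" "b \<in> {a..b}" "(1::real) \<in> {0..1}" using ab by auto
      then show ?thesis using H by metis
    qed
    ultimately show ?thesis by simp
  qed
  obtain l0 where l0: "fe_homotopic \<Omega> a b ?l l0" "C1_lagr_path \<Omega> a b l0" "regular_crossings \<Omega> L0 a b l0"
    using regular_representative_exists[OF \<Omega> L0 \<Lambda> ab Sp cont] by blast
  have "CLM \<Omega> L0 ?l a b = crossing_sum \<Omega> L0 a b l0"
    unfolding CLM_def
  proof (rule the_equality)
    show "\<exists>l'. fe_homotopic \<Omega> a b ?l l' \<and> C1_lagr_path \<Omega> a b l' \<and> regular_crossings \<Omega> L0 a b l' \<and>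
      crossing_sum \<Omega> L0 a b l0 = crossing_sum \<Omega> L0 a b l'" using l0 by blast
    fix k assume "\<exists>l'. fe_homotopic \<Omega> a b ?l l' \<and> C1_lagr_path \<Omega> a b l' \<and> regular_crossings \<Omega> L0 a b l' \<and>
      k = crossing_sum \<Omega> L0 a b l'"
    then obtain l' where "fe_homotopic \<Omega> a b ?l l'" "C1_lagr_path \<Omega> a b l'" "regular_crossings \<Omega> L0 a b l'"
      "k = crossing_sum \<Omega> L0 a b l'" by blast
    then show "k = crossing_sum \<Omega> L0 a b l0" using val[of l'] val[OF l0] by simp
  qed
  then show ?thesis using val[OF l0] by simp
qed

section \<open>The doubled symplectic space, its diagonal and graphs\<close>

lemma symplectic_form_sum_form:
  assumes \<omega>: "symplectic_form \<omega>"
  shows "symplectic_form (sum_form \<omega>)"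
proof -
  note bil = symplectic_bilinear[OF \<omega>]
  have "linear (sum_form \<omega> u)" "linear (\<lambda>v. sum_form \<omega> v u)" for u
    unfolding sum_form_def by (intro linearI; simp add: bilinear_arith[OF bil] algebra_simps)+
  moreover have "sum_form \<omega> u v = - sum_form \<omega> v u" for u v
    unfolding sum_form_def using symplectic_skew[OF \<omega>, of "fst u" "fst v"] symplectic_skew[OF \<omega>, of "snd u" "snd v"] by simp
  moreover have "u = 0" if "\<forall>v. sum_form \<omega> u v = 0" for u
  proof -
    have "\<omega> (fst u) x = 0" "\<omega> (snd u) x = 0" for x
      using that[rule_format, of "(x, 0)"] that[rule_format, of "(0, x)"] by (simp_all add: sum_form_def bilinear_arith[OF bil])
    then have "fst u = 0" "snd u = 0" using symplectic_nondegenerate[OF \<omega>] by blast+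
    then show ?thesis by (simp add: prod_eq_iff)
  qed
  ultimately show ?thesis unfolding symplectic_form_def by blast
qed

lemma lagrangian_Times:
  assumes "lagrangian \<omega> A" "lagrangian \<omega> B"
  shows "lagrangian (sum_form \<omega>) (A \<times> B)"
  using assms unfolding lagrangian_def sum_form_def by (auto simp: subspace_Times dim_Times)

lemma diagonal_eq_image: "diagonal = range (\<lambda>v. (v, v))"
  by (auto simp: diagonal_def)

lemma graph_eq_image: "graph A = range (\<lambda>v. (v, A v))"
  by (auto simp: graph_def)

lemma lagrangian_diagonal:
  fixes \<omega> :: "'a::euclidean_space \<Rightarrow> 'a \<Rightarrow> real"
  shows "lagrangian (sum_form \<omega>) (diagonal :: ('a \<times> 'a) set)"
proof -
  have l: "linear (\<lambda>v::'a. (v, v))" by (intro linearI) auto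
  have "dim (range (\<lambda>v::'a. (v, v))) = DIM('a)"
    using dim_image_eq[OF l, of UNIV] by (simp add: inj_on_def)
  then show ?thesis
    unfolding lagrangian_def diagonal_eq_image using linear_subspace_image[OF l subspace_UNIV] by (auto simp: sum_form_def)
qed

text \<open>The map \<open>id \<times> A\<close>. It exhibits graphs as symplectic images of the
  diagonal, which brings \<open>CZ\<close> within reach of \<open>CLM_eq_potential\<close>.\<close>

definition second_factor_map :: "('a \<Rightarrow> 'a) \<Rightarrow> 'a \<times> 'a \<Rightarrow> 'a \<times> 'a" where
  "second_factor_map A p = (fst p, A (snd p))"

lemma symplectic_second_factor_map:
  assumes "symplectic_map \<omega> A"
  shows "symplectic_map (sum_form \<omega>) (second_factor_map A)"
proof -
  have A: "linear A" "bij A" "\<And>u v. \<omega> (A u) (A v) = \<omega> u v" using assms by (auto simp: symplectic_map_def)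
  have "linear (second_factor_map A)" unfolding second_factor_map_def
    by (intro linearI) (simp_all add: linear_add[OF A(1)] linear_cmul[OF A(1)])
  moreover have "bij (second_factor_map A)"
  proof (rule o_bij[of "second_factor_map (inv A)"])
    show "second_factor_map (inv A) \<circ> second_factor_map A = id" "second_factor_map A \<circ> second_factor_map (inv A) = id"
      using A(2) by (auto simp: fun_eq_iff second_factor_map_def bij_is_inj bij_is_surj surj_f_inv_f)
  qed
  ultimately show ?thesis using A(3) by (simp add: symplectic_map_def sum_form_def second_factor_map_def)
qed

lemma graph_eq_second_factor_map: "graph A = second_factor_map A ` diagonal"
  unfolding graph_eq_image diagonal_eq_image by (simp add: image_image second_factor_map_def)

text \<open>The subspace \<open>(L \<times> 0) \<times> 0 \<times> 0\<close> is isotropic; its orthogonal complement restricts the graph to \<open>L\<close>,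
  and there all first components drop out of the Kashiwara form.\<close>
lemma kashiwara_graph:
  fixes \<omega> :: "'a::euclidean_space \<Rightarrow> 'a \<Rightarrow> real"
  assumes \<omega>: "symplectic_form \<omega>" and l: "lagrangian \<omega> L" "lagrangian \<omega> L0" "lagrangian \<omega> B" and A: "symplectic_map \<omega> A"
  shows "kashiwara (sum_form \<omega>) (L \<times> L0) (graph A) (L \<times> B) = kashiwara \<omega> L0 (A ` L) B"
proof -
  note bil = symplectic_bilinear[OF \<omega>] and \<Omega> = symplectic_form_sum_form[OF \<omega>]
  note sb = symmetric_bilinear_kashiwara_polar[OF \<Omega>]
  have lA: "linear A" using A by (simp add: symplectic_map_def)
  have s: "subspace L" "subspace L0" "subspace B" using l lagrangian_subspace by blast+
  have sG: "subspace (graph A)" unfolding graph_eq_image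
    by (rule linear_subspace_image[OF _ subspace_UNIV]) (auto intro!: linearI simp: linear_add[OF lA] linear_cmul[OF lA])
  let ?W = "(L \<times> L0) \<times> graph A \<times> (L \<times> B)"
  have sW: "subspace ?W" using s sG by (intro subspace_Times)
  define I where "I = (\<lambda>d. ((d, 0::'a), (0::'a, 0::'a), (0::'a, 0::'a))) ` L"
  have I0: "I \<subseteq> ?W" unfolding I_def using s subspace_0 linear_0[OF lA] by (auto simp: graph_def)
  have sI: "subspace I" unfolding I_def by (rule linear_subspace_image[OF _ s(1)]) (auto intro!: linearI)
  define J where "J = {p \<in> ?W. \<forall>i\<in>I. kashiwara_polar (sum_form \<omega>) p i = 0}"
  have J: "p \<in> J \<longleftrightarrow> (\<exists>x1\<in>L. \<exists>x2\<in>L0. \<exists>v\<in>L. \<exists>z1\<in>L. \<exists>z2\<in>B. p = ((x1, x2), (v, A v), (z1, z2)))" for p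
  proof -
    have "(\<forall>i\<in>I. kashiwara_polar (sum_form \<omega>) ((x1, x2), (v, A v), (z1, z2)) i = 0) \<longleftrightarrow> v \<in> L"
      if z: "z1 \<in> L" for x1 x2 v z1 z2
    proof -
      have "kashiwara_polar (sum_form \<omega>) ((x1, x2), (v, A v), (z1, z2)) ((d, 0), (0, 0), (0, 0)) = \<omega> v d / 2" if d: "d \<in> L" for d
      proof -
        have "\<omega> z1 d = 0" using lagrangian_isotropic[OF l(1) z d] .
        moreover have "\<omega> d v = - \<omega> v d" by (rule symplectic_skew[OF \<omega>])
        ultimately show ?thesis by (simp add: kashiwara_polar_def sum_form_def bilinear_arith[OF bil])
      qed
      note kp = this
      have "(\<forall>i\<in>I. kashiwara_polar (sum_form \<omega>) ((x1, x2), (v, A v), (z1, z2)) i = 0)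
        \<longleftrightarrow> (\<forall>d\<in>L. kashiwara_polar (sum_form \<omega>) ((x1, x2), (v, A v), (z1, z2)) ((d, 0), (0, 0), (0, 0)) = 0)"
        unfolding I_def by blast
      also have "\<dots> \<longleftrightarrow> (\<forall>d\<in>L. \<omega> v d = 0)" by (rule ball_cong[OF refl]) (simp add: kp)
      also have "\<dots> \<longleftrightarrow> v \<in> L" using lagrangian_maximal[OF \<omega> l(1)] lagrangian_isotropic[OF l(1)] by blast
      finally show ?thesis .
    qed
    note iff = this
    show ?thesis
    proof
      assume p: "p \<in> J"
      then obtain x1 x2 v z1 z2 where e: "p = ((x1, x2), (v, A v), (z1, z2))" "x1 \<in> L" "x2 \<in> L0" "z1 \<in> L" "z2 \<in> B"
        unfolding J_def graph_def by auto
      then have "v \<in> L" using p iff[OF e(4)] unfolding J_def by blast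
      then show "\<exists>x1\<in>L. \<exists>x2\<in>L0. \<exists>v\<in>L. \<exists>z1\<in>L. \<exists>z2\<in>B. p = ((x1, x2), (v, A v), (z1, z2))" using e by blast
    next
      assume "\<exists>x1\<in>L. \<exists>x2\<in>L0. \<exists>v\<in>L. \<exists>z1\<in>L. \<exists>z2\<in>B. p = ((x1, x2), (v, A v), (z1, z2))"
      then obtain x1 x2 v z1 z2 where e: "p = ((x1, x2), (v, A v), (z1, z2))" "x1 \<in> L" "x2 \<in> L0" "v \<in> L" "z1 \<in> L" "z2 \<in> B"
        by blast
      have "p \<in> ?W" using e unfolding graph_def by blast
      then show "p \<in> J" using iff[OF e(5)] e(1,4) unfolding J_def by blast
    qed
  qed
  have sJ: "subspace J" unfolding J_def
    using sb sW by (intro subspace_annihilator) (auto simp: symmetric_bilinear_def)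
  define g where "g p = (snd (fst p), snd (fst (snd p)), snd (snd (snd p)))" for p :: "('a \<times> 'a) \<times> ('a \<times> 'a) \<times> ('a \<times> 'a)"
  have lg: "linear g" unfolding g_def by (intro linearI) auto
  have gJ: "g ` J = L0 \<times> A ` L \<times> B"
  proof
    show "g ` J \<subseteq> L0 \<times> A ` L \<times> B" unfolding g_def by (auto simp: J)
    show "L0 \<times> A ` L \<times> B \<subseteq> g ` J"
    proof clarify
      fix x v z assume "x \<in> L0" "v \<in> L" "z \<in> B"
      then have "((0, x), (v, A v), (0, z)) \<in> J" using s(1) subspace_0 by (auto simp: J)
      then have "g ((0, x), (v, A v), (0, z)) \<in> g ` J" by (rule imageI)
      then show "(x, A v, z) \<in> g ` J" by (simp add: g_def)
    qed
  qed
  have "kashiwara (sum_form \<omega>) (L \<times> L0) (graph A) (L \<times> B) = signature (\<lambda>p. kashiwara_polar (sum_form \<omega>) p p) J"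
    unfolding kashiwara_def J_def kashiwara_polar_same[symmetric]
  proof (rule signature_reduction[OF sb sW sI I0])
    fix x y assume "x \<in> I" "y \<in> I"
    then show "kashiwara_polar (sum_form \<omega>) x y = 0"
      unfolding I_def kashiwara_polar_def by (auto simp: sum_form_def bilinear_arith[OF bil])
  qed
  also have "\<dots> = signature (\<lambda>p. kashiwara_form \<omega> (g p)) J"
  proof (rule signature_cong)
    fix p assume "p \<in> J"
    then obtain x1 x2 v z1 z2 where p: "x1 \<in> L" "v \<in> L" "z1 \<in> L" "p = ((x1, x2), (v, A v), (z1, z2))" unfolding J by blast
    then show "kashiwara_polar (sum_form \<omega>) p p = kashiwara_form \<omega> (g p)"
      using lagrangian_isotropic[OF l(1)] unfolding kashiwara_polar_same by (simp add: kashiwara_form_def sum_form_def g_def)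
  qed
  also have "\<dots> = signature (kashiwara_form \<omega>) (g ` J)"
    by (rule signature_pullback[OF lg sJ]) (simp add: kashiwara_form_def bilinear_arith[OF bil])
  finally show ?thesis unfolding gJ kashiwara_def .
qed

text \<open>The cocycle identity for \<open>L1\<close>, \<open>L0\<close>, \<open>l y\<close>,
  \<open>U\<close> turns \<open>\<tau>(L0, l y, U) - \<tau>(L1, L0, l y)\<close> into
  \<open>\<tau>(L1, l y, U)\<close> minus the constant \<open>\<tau>(L1, L0, U)\<close>.\<close>

lemma maslov_potential_change_reference:
  assumes \<Omega>: "symplectic_form \<Omega>" and L: "lagrangian \<Omega> L0" "lagrangian \<Omega> L1" and l: "lagrangian_family \<Omega> K l"
    and m: "maslov_potential \<Omega> L0 K l m"
  shows "maslov_potential \<Omega> L1 K l (\<lambda>x. m x - kashiwara \<Omega> L1 L0 (l x))"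
  unfolding maslov_potential_def
proof
  fix x assume x: "x \<in> K"
  obtain U where U: "lagrangian \<Omega> U" "l x \<inter> U = {0}"
    and ev: "\<forall>\<^sub>F y in at x within K. m y - m x = kashiwara \<Omega> L0 (l y) U - kashiwara \<Omega> L0 (l x) U"
    using m x unfolding maslov_potential_def by blast
  have lx: "lagrangian \<Omega> (l x)" using l x by (simp add: lagrangian_family_def)
  have "\<forall>\<^sub>F y in at x within K. m y - kashiwara \<Omega> L1 L0 (l y) - (m x - kashiwara \<Omega> L1 L0 (l x))
      = kashiwara \<Omega> L1 (l y) U - kashiwara \<Omega> L1 (l x) U"
    using ev eventually_lagrangian[OF l x U]
  proof eventually_elim
    case (elim y)
    show ?case
      using elim(1) kashiwara_cocycle[OF \<Omega> L(2,1) elim(2) U(1)] kashiwara_cocycle[OF \<Omega> L(2,1) lx U(1)] by linarith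
  qed
  then show "\<exists>U. lagrangian \<Omega> U \<and> l x \<inter> U = {0} \<and> (\<forall>\<^sub>F y in at x within K.
      m y - kashiwara \<Omega> L1 L0 (l y) - (m x - kashiwara \<Omega> L1 L0 (l x)) = kashiwara \<Omega> L1 (l y) U - kashiwara \<Omega> L1 (l x) U)"
    using U by blast
qed

text \<open>By \<open>maslov_potential_any\<close> the transversal of the graph may be taken as
  \<open>L \<times> B\<close>, with \<open>B\<close> transversal to the moved \<open>L\<close>. For
  transversals of this shape \<open>kashiwara_graph\<close> identifies the two indices.\<close>

lemma maslov_potential_graph:
  fixes \<omega> :: "'a::euclidean_space \<Rightarrow> 'a \<Rightarrow> real"
  assumes \<omega>: "symplectic_form \<omega>" and L: "lagrangian \<omega> L" "lagrangian \<omega> L0"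
    and Sp: "\<And>t. t \<in> S \<Longrightarrow> symplectic_map \<omega> (\<psi> t)"
    and fam: "lagrangian_family (sum_form \<omega>) S (\<lambda>t. graph (\<psi> t))"
    and m: "maslov_potential (sum_form \<omega>) (L \<times> L0) S (\<lambda>t. graph (\<psi> t)) m"
  shows "maslov_potential \<omega> L0 S (\<lambda>t. \<psi> t ` L) m"
  unfolding maslov_potential_def
proof
  note \<Omega> = symplectic_form_sum_form[OF \<omega>]
  fix t assume t: "t \<in> S"
  have lt: "lagrangian \<omega> (\<psi> t ` L)" by (rule lagrangian_image[OF Sp[OF t] L(1)])
  obtain B where B: "lagrangian \<omega> B" "\<psi> t ` L \<inter> B = {0}"
    using transversal_lagrangian_exists[OF \<omega> lt] by metis
  have lin: "linear (\<psi> t)" "bij (\<psi> t)" using Sp[OF t] by (auto simp: symplectic_map_def)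
  have "graph (\<psi> t) \<inter> (L \<times> B) = {0}"
  proof -
    have "v = 0 \<and> \<psi> t v = 0" if "v \<in> L" "\<psi> t v \<in> B" for v
    proof -
      have 0: "\<psi> t v = 0" using that B(2) by blast
      then have "\<psi> t v = \<psi> t 0" using linear_0[OF lin(1)] by simp
      then show ?thesis using 0 injD[OF bij_is_inj[OF lin(2)]] by blast
    qed
    moreover have "(0, 0) \<in> graph (\<psi> t) \<inter> (L \<times> B)"
      using linear_0[OF lin(1)] subspace_0[OF lagrangian_subspace[OF L(1)]] subspace_0[OF lagrangian_subspace[OF B(1)]]
      by (auto simp: graph_def)
    ultimately show ?thesis unfolding graph_def zero_prod_def by blast
  qed
  from maslov_potential_any[OF \<Omega> lagrangian_Times[OF L] fam m t lagrangian_Times[OF L(1) B(1)] this]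
  have "\<forall>\<^sub>F s in at t within S. m s - m t = kashiwara (sum_form \<omega>) (L \<times> L0) (graph (\<psi> s)) (L \<times> B)
      - kashiwara (sum_form \<omega>) (L \<times> L0) (graph (\<psi> t)) (L \<times> B)" .
  moreover have "\<forall>\<^sub>F s in at t within S. s \<in> S" by (simp add: eventually_at_filter)
  ultimately have "\<forall>\<^sub>F s in at t within S. m s - m t = kashiwara \<omega> L0 (\<psi> s ` L) B - kashiwara \<omega> L0 (\<psi> t ` L) B"
  proof eventually_elim
    case (elim s)
    then show ?case using kashiwara_graph[OF \<omega> L B(1) Sp[OF elim(2)]] kashiwara_graph[OF \<omega> L B(1) Sp[OF t]] by simp
  qed
  then show "\<exists>U. lagrangian \<omega> U \<and> \<psi> t ` L \<inter> U = {0} \<and>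
      (\<forall>\<^sub>F s in at t within S. m s - m t = kashiwara \<omega> L0 (\<psi> s ` L) U - kashiwara \<omega> L0 (\<psi> t ` L) U)"
    using B by blast
qed

theorem theorem2p14:
  fixes \<omega> :: "'a::euclidean_space \<Rightarrow> 'a \<Rightarrow> real" and n :: nat
    and L L0 :: "'a set" and \<psi> :: "real \<Rightarrow> 'a \<Rightarrow> 'a" and T :: real
  assumes "symplectic_form \<omega>" and "DIM('a) = 2 * n"
    and "lagrangian \<omega> L" and "lagrangian \<omega> L0"
    and "0 < T"
    and "\<forall>t\<in>{0..T}. symplectic_map \<omega> (\<psi> t)"
    and "\<forall>x. continuous_on {0..T} (\<lambda>t. \<psi> t x)"
    and "\<psi> 0 = id"
  shows "\<bar>CLM \<omega> L0 (\<lambda>t. \<psi> t ` L) 0 T - CZ \<omega> \<psi> 0 T\<bar>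
           \<le> int (2 * n) - int (dim (set_sum (graph (\<psi> T) \<inter> diagonal) (diagonal \<inter> (L \<times> L0))))"
proof -
  note \<omega> = assms(1) and L = assms(3,4) and T = assms(5)
  note \<Omega> = symplectic_form_sum_form[OF \<omega>]
  have Sp: "\<And>t. t \<in> {0..T} \<Longrightarrow> symplectic_map \<omega> (\<psi> t)" and cont: "\<And>x. continuous_on {0..T} (\<lambda>t. \<psi> t x)"
    using assms(6,7) by blast+
  let ?\<Psi> = "\<lambda>t. second_factor_map (\<psi> t)" and ?\<Delta> = "diagonal :: ('a \<times> 'a) set" and ?\<delta> = "L \<times> L0"
  let ?G = "\<lambda>t. graph (\<psi> t)"
  have Sp': "\<And>t. t \<in> {0..T} \<Longrightarrow> symplectic_map (sum_form \<omega>) (?\<Psi> t)" using Sp symplectic_second_factor_map by blast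
  have cont': "\<And>x. continuous_on {0..T} (\<lambda>t. ?\<Psi> t x)"
    unfolding second_factor_map_def by (intro continuous_intros cont)
  have l\<Delta>: "lagrangian (sum_form \<omega>) ?\<Delta>" by (rule lagrangian_diagonal)
  have l\<delta>: "lagrangian (sum_form \<omega>) ?\<delta>" by (rule lagrangian_Times[OF L])
  have G: "?\<Psi> t ` ?\<Delta> = ?G t" for t by (simp add: graph_eq_second_factor_map)
  have fam: "lagrangian_family (sum_form \<omega>) {0..T} ?G"
    using lagrangian_family_image[OF \<Omega> l\<Delta> Sp' cont'] unfolding G .
  obtain m where m: "maslov_potential (sum_form \<omega>) ?\<Delta> {0..T} ?G m"
    using maslov_potential_exists[OF \<Omega> l\<Delta> fam] by auto
  define m' where "m' t = m t - kashiwara (sum_form \<omega>) ?\<delta> ?\<Delta> (?G t)" for t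
  have p: "maslov_potential (sum_form \<omega>) ?\<delta> {0..T} ?G m'"
    using maslov_potential_change_reference[OF \<Omega> l\<Delta> l\<delta> fam m] unfolding m'_def .
  have m': "maslov_potential \<omega> L0 {0..T} (\<lambda>t. \<psi> t ` L) m'"
    by (rule maslov_potential_graph[OF \<omega> L Sp fam p])
  have CZ: "2 * CZ \<omega> \<psi> 0 T = m T - m 0 + int (dim (?G 0 \<inter> ?\<Delta>)) - int (dim (?G T \<inter> ?\<Delta>))"
    using CLM_eq_potential[OF \<Omega> l\<Delta> l\<Delta> T Sp' cont', of m] m unfolding G CZ_def by simp
  have CLM: "2 * CLM \<omega> L0 (\<lambda>t. \<psi> t ` L) 0 T = m' T - m' 0 + int (dim (\<psi> 0 ` L \<inter> L0)) - int (dim (\<psi> T ` L \<inter> L0))"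
    by (rule CLM_eq_potential[OF \<omega> L(2,1) T Sp cont m'])
  have G0: "?G 0 = ?\<Delta>" unfolding assms(8) by (simp add: graph_def diagonal_def)
  have lG: "lagrangian (sum_form \<omega>) (?G T)" using fam T by (simp add: lagrangian_family_def)
  have dims: "dim ?\<Delta> = 2 * n" "dim ?\<delta> = 2 * n"
    using l\<Delta> l\<delta> assms(2) unfolding lagrangian_def by auto
  have d1: "dim (?\<delta> \<inter> ?\<Delta>) = dim (L \<inter> L0)"
  proof -
    have "?\<delta> \<inter> ?\<Delta> = (\<lambda>v. (v, v)) ` (L \<inter> L0)" by (auto simp: diagonal_def)
    then show ?thesis using dim_image_eq[of "\<lambda>v::'a. (v, v)" "L \<inter> L0"] by (simp add: inj_on_def linear_iff)
  qed
  have d2: "dim (?\<delta> \<inter> ?G T) = dim (\<psi> T ` L \<inter> L0)"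
  proof -
    have b: "linear (\<psi> T)" "bij (\<psi> T)" using Sp[of T] T by (auto simp: symplectic_map_def)
    have e: "?\<delta> \<inter> ?G T = (\<lambda>v. (v, \<psi> T v)) ` (L \<inter> \<psi> T -` L0)" by (auto simp: graph_def)
    have "dim (?\<delta> \<inter> ?G T) = dim (L \<inter> \<psi> T -` L0)"
      unfolding e by (rule dim_image_eq) (auto simp: inj_on_def linear_iff linear_add[OF b(1)] linear_cmul[OF b(1)])
    moreover have "\<psi> T ` (L \<inter> \<psi> T -` L0) = \<psi> T ` L \<inter> L0" by auto
    moreover have "dim (\<psi> T ` (L \<inter> \<psi> T -` L0)) = dim (L \<inter> \<psi> T -` L0)"
      using b(2) by (intro dim_image_eq[OF b(1)]) (meson bij_is_inj inj_on_subset subset_UNIV)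
    ultimately show ?thesis by simp
  qed
  \<comment> \<open>At time 0 the graph is the whole diagonal, whence the term \<open>2 * n\<close>,
    and there the Kashiwara correction vanishes because two of its arguments coincide.\<close>
  have diff: "2 * (CLM \<omega> L0 (\<lambda>t. \<psi> t ` L) 0 T - CZ \<omega> \<psi> 0 T)
      = - kashiwara (sum_form \<omega>) ?\<delta> ?\<Delta> (?G T) + int (dim (?\<delta> \<inter> ?\<Delta>)) - int (dim (?\<delta> \<inter> ?G T)) - int (2 * n) + int (dim (?\<Delta> \<inter> ?G T))"
    using CLM CZ kashiwara_degenerate[OF \<Omega> l\<delta> l\<Delta>] G0 dims(1) d1 d2 assms(8)
    by (simp add: m'_def Int_commute)
  have bound: "\<bar>kashiwara (sum_form \<omega>) ?\<delta> ?\<Delta> (?G T)\<bar> \<le> int (2 * n) - int (dim (?\<delta> \<inter> ?\<Delta>)) - int (dim (?\<Delta> \<inter> ?G T))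
      - int (dim (?\<delta> \<inter> ?G T)) + 2 * int (dim (?\<delta> \<inter> ?\<Delta> \<inter> ?G T))"
    using abs_kashiwara_le[OF \<Omega> l\<delta> l\<Delta> lG] dims(2) by simp
  let ?e = "set_sum (?G T \<inter> ?\<Delta>) (?\<Delta> \<inter> ?\<delta>)"
  have s: "subspace (?G T \<inter> ?\<Delta>)" "subspace (?\<Delta> \<inter> ?\<delta>)"
    using lagrangian_subspace l\<Delta> l\<delta> lG by (blast intro: subspace_inter)+
  have "(?G T \<inter> ?\<Delta>) \<inter> (?\<Delta> \<inter> ?\<delta>) = ?\<delta> \<inter> ?\<Delta> \<inter> ?G T" by blast
  then have e: "dim ?e + dim (?\<delta> \<inter> ?\<Delta> \<inter> ?G T) = dim (?\<Delta> \<inter> ?G T) + dim (?\<delta> \<inter> ?\<Delta>)"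
    using dim_sums_Int[OF s] unfolding set_sum_def by (simp add: Int_commute)
  have "?e \<subseteq> ?\<Delta>" unfolding set_sum_def using subspace_add[OF lagrangian_subspace[OF l\<Delta>]] by blast
  then have e2: "dim ?e \<le> 2 * n" using dim_subset dims(1) by metis
  have "dim (?\<delta> \<inter> ?\<Delta> \<inter> ?G T) \<le> dim (?\<delta> \<inter> ?G T)" by (rule dim_subset) blast
  \<comment> \<open>Here \<open>ab\<close>, \<open>bc\<close>, \<open>ac\<close>, \<open>abc\<close>
    are the dimensions of the intersections of \<open>?\<delta>\<close>, \<open>?\<Delta>\<close>
    and \<open>?G T\<close>, in this order. The bound on \<open>k\<close> gives
    \<open>2 * X \<le> 2 * (abc - ac) \<le> 0\<close> from above and
    \<open>2 * X \<ge> - 2 * (2 * n - ab - bc + abc)\<close>, which is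
    \<open>- 2 * (2 * n - e)\<close>, from below.\<close>
  moreover have "\<bar>X\<bar> \<le> int (2 * n) - int e"
    if "abc \<le> ac" "2 * X = - k + int ab - int ac - int (2 * n) + int bc"
      "\<bar>k\<bar> \<le> int (2 * n) - int ab - int bc - int ac + 2 * int abc" "e + abc = bc + ab" "e \<le> 2 * n"
    for X k :: int and ab ac bc abc e :: nat
    using that by linarith
  ultimately show ?thesis using diff bound e e2 by blast
qed

end
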